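(* Let $\Omega=\{0,1\}^{\mathbb{N}}$ with the uniform measure. Let $(\omega_i)_{i\in\mathbb{N}}$ be a sequence of elements of $\Omega$ such that $\omega_0$ is Martin-Löf random and $\omega_i$ is $(\omega_0,\ldots,\omega_{i-1})$-random for all $i\ge 1$. Let $T:\Omega\to\Omega$ be a computable bijective ergodic map. Then there exists a sequence $(\omega'_i)_{i\in\mathbb{N}}$ of elements of $\Omega$ such that: - for every $i$, $\omega'_i$ is an element of the orbit of $\omega_i$, i.e. $\omega'_i=T^{n_i}(\omega_i)$ for some integer $n_i$; - the sequence $(\omega'_i)_{i\in\mathbb{N}}$ is a Martin-Löf random element of $\Omega^{\mathbb{N}}$.
   Context: For a finite binary string $x$, $x\Omega$ denotes the set of infinite binary sequences with prefix $x$. The uniform (Lebesgue) measure on $\Omega$ gives $x\Omega$ measure $2^{-|x|}$; $\Omega^{\mathbb{N}}$ carries the product of uniform measures. A set is effectively open if it is the union of a computably enumerable family of basic open sets (in $\Omega$: the sets $x\Omega$; in $\Omega^{\mathbb{N}}$: the sets specifying finitely many bits of finitely many coordinates). A set is effectively null if there is an algorithm that, given a rational $\varepsilon>0$, enumerates an effectively open cover of it of measure at most $\varepsilon$. A point is (Martin-Löf) random if it belongs to no effectively null set; it is $(\omega_0,\ldots,\omega_{i-1})$-random if the same holds with algorithms having oracle access to $\omega_0,\ldots,\omega_{i-1}$. A map $T:\Omega\to\Omega$ is computable if a Turing machine reading the infinite sequence $\omega$ on its input tape writes the bits of $T(\omega)$ one after another on a write-only output tape. Ergodic means that $T$ preserves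 the uniform measure $\mu$ ($\mu(T^{-1}(B))=\mu(B)$ for measurable $B$) and every measurable $B$ with $T^{-1}(B)=B$ up to a null set has measure $0$ or $1$. *)

theory Defs
  imports "HOL-Probability.Probability" "HOL-Library.Nat_Bijection"
begin

type_synonym bitseq = "nat \<Rightarrow> bool"

definition uniform :: "bitseq measure" where
  "uniform = (\<Pi>\<^sub>M i\<in>UNIV. measure_pmf (bernoulli_pmf (1/2)))"

definition uniform_seq :: "(nat \<Rightarrow> bitseq) measure" where
  "uniform_seq = (\<Pi>\<^sub>M i\<in>UNIV. uniform)"

definition cylinder :: "bool list \<Rightarrow> bitseq set" where
  "cylinder x = {\<omega>. \<forall>i<length x. \<omega> i = x ! i}"

(* A triple (i, n, b) specifies that bit n of coordinate i is b.  A contradictory list denotes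
   the empty set, which does not affect unions of such sets. *)
definition cylinder_seq :: "(nat \<times> nat \<times> bool) list \<Rightarrow> (nat \<Rightarrow> bitseq) set" where
  "cylinder_seq c = {\<omega>. \<forall>(i, n, b) \<in> set c. \<omega> i n = b}"

definition string_code :: "bool list \<Rightarrow> nat" where
  "string_code x = list_encode (map of_bool x)"

definition cond_code :: "(nat \<times> nat \<times> bool) list \<Rightarrow> nat" where
  "cond_code c = list_encode (map (\<lambda>(i, n, b). prod_encode (i, prod_encode (n, of_bool b))) c)"


(* Algorithms with oracle access are programs for partial recursive functions.  The oracle is a
   family A of bit sequences; Query applied to (j, n) returns bit n of the sequence A j. *)
datatype recf =
    Zero
  | Succ
  | Proj nat
  | Query
  | Comp recf "recf list"
  | PrimRec recf recf
  | Mu recf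

inductive eval :: "(nat \<Rightarrow> bitseq) \<Rightarrow> recf \<Rightarrow> nat list \<Rightarrow> nat \<Rightarrow> bool"
  for A :: "nat \<Rightarrow> bitseq" where
  Zero: "eval A Zero xs 0"
| Succ: "eval A Succ [x] (Suc x)"
| Proj: "i < length xs \<Longrightarrow> eval A (Proj i) xs (xs ! i)"
| Query: "eval A Query [j, n] (of_bool (A j n))"
| Comp: "list_all2 (\<lambda>g y. eval A g xs y) gs ys \<Longrightarrow> eval A f ys z \<Longrightarrow> eval A (Comp f gs) xs z"
| PrimRec_0: "eval A f xs y \<Longrightarrow> eval A (PrimRec f g) (0 # xs) y"
| PrimRec_Suc: "eval A (PrimRec f g) (n # xs) r \<Longrightarrow> eval A g (n # r # xs) y
    \<Longrightarrow> eval A (PrimRec f g) (Suc n # xs) y"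
| Mu: "eval A f (n # xs) 0 \<Longrightarrow> (\<forall>m<n. \<exists>y. eval A f (m # xs) (Suc y)) \<Longrightarrow> eval A (Mu f) xs n"

(* The numbers listed by the program e on input xs.  The value at stage k may be undefined, so
   these are exactly the sets that are computably enumerable in A, including the empty set. *)
definition enumerated :: "(nat \<Rightarrow> bitseq) \<Rightarrow> recf \<Rightarrow> nat list \<Rightarrow> nat set" where
  "enumerated A e xs = {y. \<exists>k. eval A e (xs @ [k]) y}"

definition enumerated_open ::
  "('c \<Rightarrow> nat) \<Rightarrow> ('c \<Rightarrow> 'a set) \<Rightarrow> (nat \<Rightarrow> bitseq) \<Rightarrow> recf \<Rightarrow> nat list \<Rightarrow> 'a set" where
  "enumerated_open code basic A e xs = (\<Union>c\<in>{c. code c \<in> enumerated A e xs}. basic c)"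

(* The rational bound is given to the algorithm as numerator p and denominator q. *)
definition effectively_null ::
  "('c \<Rightarrow> nat) \<Rightarrow> ('c \<Rightarrow> 'a set) \<Rightarrow> 'a measure \<Rightarrow> (nat \<Rightarrow> bitseq) \<Rightarrow> 'a set \<Rightarrow> bool" where
  "effectively_null code basic M A N \<longleftrightarrow>
    (\<exists>e. \<forall>p q :: nat. p > 0 \<and> q > 0 \<longrightarrow>
      N \<subseteq> enumerated_open code basic A e [p, q] \<and>
      measure M (enumerated_open code basic A e [p, q]) \<le> real p / real q)"

definition no_oracle :: "nat \<Rightarrow> bitseq" where
  "no_oracle = (\<lambda>j n. False)"

definition first_oracle :: "nat \<Rightarrow> (nat \<Rightarrow> bitseq) \<Rightarrow> (nat \<Rightarrow> bitseq)" where
  "first_oracle i \<omega> = (\<lambda>j. if j < i then \<omega> j else (\<lambda>n. False))"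

definition random_relative :: "(nat \<Rightarrow> bitseq) \<Rightarrow> bitseq \<Rightarrow> bool" where
  "random_relative A \<omega> \<longleftrightarrow> (\<nexists>N. effectively_null string_code cylinder uniform A N \<and> \<omega> \<in> N)"

definition ml_random :: "bitseq \<Rightarrow> bool" where
  "ml_random \<omega> \<longleftrightarrow> random_relative no_oracle \<omega>"

definition ml_random_seq :: "(nat \<Rightarrow> bitseq) \<Rightarrow> bool" where
  "ml_random_seq \<omega> \<longleftrightarrow>
    (\<nexists>N. effectively_null cond_code cylinder_seq uniform_seq no_oracle N \<and> \<omega> \<in> N)"


datatype dir = Left | Stay | Right

(* delta q a s, for state q, scanned input bit a and scanned work symbol s, gives the new state,
   the input head move, the symbol written on the work tape, the work head move, and the bit (if
   any) appended to the write-only output tape.  State 0 is initial and symbol 0 is blank. *)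
record tm =
  states :: nat
  symbols :: nat
  delta :: "nat \<Rightarrow> bool \<Rightarrow> nat \<Rightarrow> nat \<times> dir \<times> nat \<times> dir \<times> bool option"

definition wf_tm :: "tm \<Rightarrow> bool" where
  "wf_tm M \<longleftrightarrow> 0 < states M \<and> 0 < symbols M \<and>
    (\<forall>q<states M. \<forall>a. \<forall>s<symbols M.
      case delta M q a s of (q', _, s', _, _) \<Rightarrow> q' < states M \<and> s' < symbols M)"

record config =
  state :: nat
  input_pos :: nat
  work_tape :: "nat \<Rightarrow> nat"
  work_pos :: nat
  out :: "bool list"

(* Tapes are one-way infinite: a left move at cell 0 has no effect. *)
fun move :: "dir \<Rightarrow> nat \<Rightarrow> nat" where
  "move Left n = n - 1"
| "move Stay n = n"
| "move Right n = n + 1"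

definition step :: "tm \<Rightarrow> bitseq \<Rightarrow> config \<Rightarrow> config" where
  "step M \<omega> c =
    (case delta M (state c) (\<omega> (input_pos c)) (work_tape c (work_pos c)) of (q, d, s, d', b) \<Rightarrow>
      \<lparr> state = q,
        input_pos = move d (input_pos c),
        work_tape = (work_tape c)(work_pos c := s),
        work_pos = move d' (work_pos c),
        out = out c @ (case b of None \<Rightarrow> [] | Some v \<Rightarrow> [v]) \<rparr>)"

definition initial :: config where
  "initial = \<lparr> state = 0, input_pos = 0, work_tape = (\<lambda>_. 0), work_pos = 0, out = [] \<rparr>"

definition output_after :: "tm \<Rightarrow> bitseq \<Rightarrow> nat \<Rightarrow> bool list" where
  "output_after M \<omega> t = out ((step M \<omega> ^^ t) initial)"

definition writes :: "tm \<Rightarrow> bitseq \<Rightarrow> bitseq \<Rightarrow> bool" where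
  "writes M \<omega> \<tau> \<longleftrightarrow>
    (\<forall>t. \<forall>i<length (output_after M \<omega> t). output_after M \<omega> t ! i = \<tau> i) \<and>
    (\<forall>n. \<exists>t. n < length (output_after M \<omega> t))"

definition computable_map :: "(bitseq \<Rightarrow> bitseq) \<Rightarrow> bool" where
  "computable_map T \<longleftrightarrow> (\<exists>M. wf_tm M \<and> (\<forall>\<omega>. writes M \<omega> (T \<omega>)))"


definition ergodic :: "'a measure \<Rightarrow> ('a \<Rightarrow> 'a) \<Rightarrow> bool" where
  "ergodic M T \<longleftrightarrow>
    T \<in> M \<rightarrow>\<^sub>M M \<and>
    (\<forall>B\<in>sets M. emeasure M (T -` B \<inter> space M) = emeasure M B) \<and>
    (\<forall>B\<in>sets M. sym_diff (T -` B \<inter> space M) B \<in> null_sets M \<longrightarrow>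
      emeasure M B = 0 \<or> emeasure M B = 1)"

definition int_iterate :: "('a \<Rightarrow> 'a) \<Rightarrow> int \<Rightarrow> 'a \<Rightarrow> 'a" where
  "int_iterate T n = (if n \<ge> 0 then T ^^ nat n else inv T ^^ nat (- n))"

lemma measure_cylinder: "measure uniform (cylinder x) = (1/2) ^ length x"
proof -
  interpret product_prob_space "\<lambda>_::nat. measure_pmf (bernoulli_pmf (1/2))" UNIV
    by standard
  have "cylinder x = {\<omega> \<in> space (\<Pi>\<^sub>M i\<in>UNIV. measure_pmf (bernoulli_pmf (1/2))).
      \<forall>i\<in>{..<length x}. \<omega> i \<in> {x ! i}}"
    by (auto simp: cylinder_def space_PiM)
  then have "emeasure uniform (cylinder x) =
      (\<Prod>i\<in>{..<length x}. emeasure (measure_pmf (bernoulli_pmf (1/2))) {x ! i})"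
    unfolding uniform_def by (subst emeasure_PiM_Collect[symmetric]) auto
  also have "\<dots> = (\<Prod>i\<in>{..<length x}. ennreal (1/2))"
    by (rule prod.cong) (auto simp: emeasure_pmf_single split: bool.splits)
  also have "\<dots> = ennreal ((1/2) ^ length x)"
    by (subst prod_ennreal) auto
  finally show ?thesis
    by (simp add: measure_def)
qed

end

theory Submission
  imports Defs "HOL-Library.More_List" "HOL-Library.Sublist"
begin

text \<open>
  The main step is that the orbit of a random point leaves every effectively open set \<open>A\<close> of
  measure less than 1.  By the mean ergodic theorem one can compute, for every cylinder \<open>I\<close>, a
  number \<open>n\<close> such that the number of visits to \<open>I\<close> before time \<open>n\<close> is, in \<open>L\<^sup>2\<close>, close to its
  mean.  By the Cauchy-Schwarz inequality the points of \<open>I\<close> whose first \<open>n\<close> iterates stay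
  in \<open>A\<close> then have measure at most \<open>\<rho>\<close> times that of \<open>I\<close>, where \<open>\<rho> < 1\<close> depends only on the
  measure of \<open>A\<close>.  The set of these points is effectively open; repeating the argument inside
  its cylinders shows that the points whose orbits never leave \<open>A\<close> form an effectively null set.

  The new coordinates are chosen one by one.  If \<open>W\<close> is an effectively open set of sequences of
  measure less than \<open>r < 1\<close>, then the points whose section of \<open>W\<close> has measure more than \<open>r\<close>
  form an effectively open set of measure less than 1, so some iterate of the next point avoids
  it, and the section of \<open>W\<close> at this iterate is an open set of the same kind.  A universal test is
  not needed: the tests are numbered by their programs, the sections of a test at the
  coordinates chosen so far contain a test relative to them (as in van Lambalgen's theorem),
  and at stage \<open>i\<close> a small member of the \<open>i\<close>-th one is added to \<open>W\<close>.  If the final sequence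
  failed a test, then its remaining coordinates would lie in \<open>W\<close> from some stage on; this depends
  on finitely many bits only, so after finitely many further stages \<open>W\<close> would be the whole space.
\<close>

section \<open>Functions computable with an oracle\<close>

text \<open>By van Lambalgen's theorem every finite part of the given sequence is random, but the
  whole need not be: setting the first bit of every \<open>\<omega> i\<close> to zero keeps all the
  relative randomness and destroys randomness in the product. So every coordinate may have to be
  moved, and infinitely many constraints must be met although each choice can attend to only
  finitely many of them.

  Two quantities are not computable in general: the rate of convergence of ergodic averages and the
  measure of an effectively open set. The rate is replaced by a search. That a time is long enough
  is confirmed at a finite stage, because the second moment of the visit count is a limit of
  computable upper bounds. The measure enters only through a rational number chosen above it. In the
  same way the thresholds and indices picked during the construction are not computed from the stage
  number; any single set in use depends on finitely many of them, which is enough for it to be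
  effectively open.\<close>

class encodable =
  fixes enc :: "'a \<Rightarrow> nat"
  assumes inj_enc: "inj enc"
begin

lemma enc_eq_iff [simp]: "enc x = enc y \<longleftrightarrow> x = y"
  using inj_enc by (simp add: inj_eq)

end

instantiation nat :: encodable
begin
definition enc_nat :: "nat \<Rightarrow> nat" where [simp]: "enc_nat n = n"
instance by standard (simp add: inj_def)
end

instantiation bool :: encodable
begin
definition enc_bool :: "bool \<Rightarrow> nat" where [simp]: "enc_bool b = of_bool b"
instance by standard (simp add: inj_def)
end

instantiation prod :: (encodable, encodable) encodable
begin
definition enc_prod :: "'a \<times> 'b \<Rightarrow> nat" where
  [simp]: "enc_prod z = prod_encode (enc (fst z), enc (snd z))"
instance by standard (auto simp: inj_def prod_encode_eq)
end

instantiation list :: (encodable) encodable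
begin
definition enc_list :: "'a list \<Rightarrow> nat" where "enc_list xs = list_encode (map enc xs)"
instance by standard (auto simp: inj_def enc_list_def list_encode_eq inj_map_eq_map inj_enc)
end

lemma enc_Nil [simp]: "enc [] = 0"
  and enc_Cons [simp]: "enc (x # xs) = Suc (prod_encode (enc x, enc xs))"
  by (simp_all add: enc_list_def)

instantiation option :: (encodable) encodable
begin
definition enc_option :: "'a option \<Rightarrow> nat" where
  "enc_option z = (case z of None \<Rightarrow> 0 | Some x \<Rightarrow> Suc (enc x))"
instance by standard (auto simp: inj_def enc_option_def split: option.splits)
end

lemma enc_None [simp]: "enc None = 0" and enc_Some [simp]: "enc (Some x) = Suc (enc x)"
  by (simp_all add: enc_option_def)

text \<open>All arguments are coded into one number. Nothing is required of the program on numbers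
  that are not codes: there it may diverge or return anything, so subprograms must be kept away from
  such numbers.\<close>

definition computable_in :: "(nat \<Rightarrow> bitseq) \<Rightarrow> ('a::encodable \<Rightarrow> 'b::encodable) \<Rightarrow> bool" where
  "computable_in B f \<longleftrightarrow> (\<exists>e. \<forall>x. eval B e [enc x] (enc (f x)))"

named_theorems computable

lemma computable_cong: "(\<And>x. f x = g x) \<Longrightarrow> computable_in B f \<longleftrightarrow> computable_in B g"
  by (simp add: computable_in_def)

section \<open>Programs for arithmetic and for the pairing function\<close>

lemma eval_Proj0: "eval B (Proj 0) (x # xs) x"
  and eval_Proj1: "eval B (Proj (Suc 0)) (x # y # xs) y"
  and eval_Proj2: "eval B (Proj (Suc (Suc 0))) (x # y # z # xs) z"
  using eval.Proj[of 0 "x # xs" B] eval.Proj[of 1 "x # y # xs" B]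
    eval.Proj[of 2 "x # y # z # xs" B] by (auto simp: numeral_2_eq_2)

lemma eval_Comp1: "eval B g xs y \<Longrightarrow> eval B f [y] z \<Longrightarrow> eval B (Comp f [g]) xs z"
  by (rule eval.Comp[where ys = "[y]"]) auto

lemma eval_Comp2:
  "eval B g xs y \<Longrightarrow> eval B g' xs y' \<Longrightarrow> eval B f [y, y'] z \<Longrightarrow> eval B (Comp f [g, g']) xs z"
  by (rule eval.Comp[where ys = "[y, y']"]) auto

lemmas eval_basic = eval.Zero eval.Succ eval.Query eval_Proj0 eval_Proj1 eval_Proj2
  eval_Comp1 eval_Comp2

lemma program_const: "\<exists>e. \<forall>xs. eval B e xs n"
proof (induction n)
  case (Suc n)
  then obtain e where "\<forall>xs. eval B e xs n" by blast
  then have "\<forall>xs. eval B (Comp Succ [e]) xs (Suc n)" by (blast intro: eval_basic)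
  then show ?case by blast
qed (blast intro: eval.Zero)

lemma program_add: "\<exists>e. \<forall>m n. eval B e [m, n] (m + n)"
proof -
  have "eval B (PrimRec (Proj 0) (Comp Succ [Proj (Suc 0)])) [m, n] (m + n)" for m n
    by (induction m)
      (auto intro!: eval.PrimRec_0 eval.PrimRec_Suc[where r = "_ + n"] intro: eval_basic)
  then show ?thesis by blast
qed

lemma program_pred: "\<exists>e. \<forall>n. eval B e [n] (n - 1)"
proof -
  have "eval B (PrimRec Zero (Proj 0)) [n] (n - 1)" for n
    by (induction n)
      (auto intro!: eval.PrimRec_0 eval.PrimRec_Suc[where r = "_ - Suc 0"] intro: eval_basic)
  then show ?thesis by blast
qed

lemma program_diff: "\<exists>e. \<forall>m n. eval B e [m, n] (m - n)"
proof -
  obtain p where p: "\<And>n. eval B p [n] (n - 1)" using program_pred by blast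
  have *: "eval B (PrimRec (Proj 0) (Comp p [Proj (Suc 0)])) [m, n] (n - m)" for m n
  proof (induction m)
    case (Suc m)
    then show ?case
      using p[of "n - m"] by (auto intro!: eval.PrimRec_Suc[where r = "n - m"] intro: eval_basic)
  qed (auto intro!: eval.PrimRec_0 intro: eval_basic)
  have "eval B (Comp (PrimRec (Proj 0) (Comp p [Proj (Suc 0)])) [Proj (Suc 0), Proj 0]) [m, n] (m - n)"
    for m n by (rule eval_Comp2 eval_Proj0 eval_Proj1 *)+
  then show ?thesis by blast
qed

lemma program_mult: "\<exists>e. \<forall>m n. eval B e [m, n] (m * n)"
proof -
  obtain p where p: "\<And>m n. eval B p [m, n] (m + n)" using program_add by blast
  have "eval B (PrimRec Zero (Comp p [Proj (Suc 0), Proj 2])) [m, n] (m * n)" for m n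
  proof (induction m)
    case (Suc m)
    show ?case
      by (rule eval.PrimRec_Suc[OF Suc], rule eval_Comp2, rule eval_Proj1,
        unfold numeral_2_eq_2, rule eval_Proj2) (metis p add.commute mult_Suc)
  qed (auto intro!: eval.PrimRec_0 intro: eval_basic)
  then show ?thesis by blast
qed

lemma program_triangle: "\<exists>e. \<forall>n. eval B e [n] (triangle n)"
proof -
  obtain p where p: "\<And>m n. eval B p [m, n] (m + n)" using program_add by blast
  have "eval B (PrimRec Zero (Comp p [Proj (Suc 0), Comp Succ [Proj 0]])) [n] (triangle n)" for n
  proof (induction n)
    case (Suc n)
    show ?case
      by (rule eval.PrimRec_Suc[OF Suc], rule eval_Comp2, rule eval_Proj1,
        rule eval_Comp1, rule eval_Proj0, rule eval.Succ) (metis p triangle_Suc)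
  qed (auto intro!: eval.PrimRec_0 intro: eval_basic)
  then show ?thesis by blast
qed

lemma program_prod_encode: "\<exists>e. \<forall>m n. eval B e [m, n] (prod_encode (m, n))"
proof -
  obtain p where p: "\<And>m n. eval B p [m, n] (m + n)" using program_add by blast
  obtain t where t: "\<And>n. eval B t [n] (triangle n)" using program_triangle by blast
  have "eval B (Comp p [Comp t [p], Proj 0]) [m, n] (prod_encode (m, n))" for m n
    unfolding prod_encode_def by (auto intro: eval_basic p t)
  then show ?thesis by blast
qed

lemma program_prod_decode:
  "\<exists>e. \<forall>m n. eval B e [prod_encode (m, n)] m" "\<exists>e. \<forall>m n. eval B e [prod_encode (m, n)] n"
proof -
  obtain d where d: "\<And>m n. eval B d [m, n] (m - n)" using program_diff by blast
  obtain t where t: "\<And>n. eval B t [n] (triangle n)" using program_triangle by blast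
  \<comment> \<open>Since \<open>prod_encode (m, n) = triangle (m + n) + m\<close>, the diagonal
    \<open>m + n\<close> is the least \<open>k\<close> with \<open>z < triangle (Suc k)\<close>,
    where \<open>z\<close> is the code. With truncated subtraction this inequality says that
    \<open>f\<close> vanishes at \<open>k\<close>, so \<open>Mu\<close> finds the diagonal.\<close>
  define f where "f = Comp d [Comp Succ [Proj (Suc 0)], Comp t [Comp Succ [Proj 0]]]"
  have f: "eval B f [k, z] (Suc z - triangle (Suc k))" for k z
    unfolding f_def by (blast intro: eval_basic d t)
  have mono: "triangle i \<le> triangle j" if "i \<le> j" for i j
    using that by (induction rule: dec_induct) (simp_all)
  have diag: "eval B (Mu f) [prod_encode (m, n)] (m + n)" for m n
  proof (rule eval.Mu)
    show "eval B f [m + n, prod_encode (m, n)] 0"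
      using f[of "m + n" "prod_encode (m, n)"] by (simp add: prod_encode_def)
    show "\<forall>k<m + n. \<exists>y. eval B f [k, prod_encode (m, n)] (Suc y)"
    proof (intro allI impI)
      fix k assume "k < m + n"
      then have "triangle (Suc k) \<le> prod_encode (m, n)"
        using mono[of "Suc k" "m + n"] by (simp add: prod_encode_def)
      then have "Suc (prod_encode (m, n)) - triangle (Suc k)
          = Suc (prod_encode (m, n) - triangle (Suc k))"
        by (rule Suc_diff_le)
      then show "\<exists>y. eval B f [k, prod_encode (m, n)] (Suc y)"
        using f[of k "prod_encode (m, n)"] by metis
    qed
  qed
  have fst: "eval B (Comp d [Proj 0, Comp t [Mu f]]) [prod_encode (m, n)] m" for m n
  proof (rule eval_Comp2, rule eval_Proj0, rule eval_Comp1, rule diag, rule t)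
    show "eval B d [prod_encode (m, n), triangle (m + n)] m"
      using d[of "prod_encode (m, n)" "triangle (m + n)"] by (simp add: prod_encode_def)
  qed
  have snd: "eval B (Comp d [Mu f, Comp d [Proj 0, Comp t [Mu f]]]) [prod_encode (m, n)] n" for m n
    by (rule eval_Comp2, rule diag, rule fst) (metis d add_diff_cancel_left')
  show "\<exists>e. \<forall>m n. eval B e [prod_encode (m, n)] m" "\<exists>e. \<forall>m n. eval B e [prod_encode (m, n)] n"
    using fst snd by blast+
qed

section \<open>Closure rules for computable functions\<close>

lemma computable_id [computable]: "computable_in B (\<lambda>x. x)"
  unfolding computable_in_def by (blast intro: eval_Proj0)

lemma computable_compose:
  "computable_in B f \<Longrightarrow> computable_in B g \<Longrightarrow> computable_in B (\<lambda>x. f (g x))"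
  unfolding computable_in_def by (blast intro: eval_Comp1)

lemma computable_const [computable]: "computable_in B (\<lambda>x. c)"
  unfolding computable_in_def using program_const by blast

lemma computable_binary:
  assumes "\<exists>e. \<forall>x y. eval B e [enc x, enc y] (enc (h x y))"
    and "computable_in B f" "computable_in B g"
  shows "computable_in B (\<lambda>x. h (f x) (g x))"
  using assms unfolding computable_in_def by (blast intro: eval_Comp2)

lemma computable_encI: "computable_in B (\<lambda>x. enc (f x)) \<Longrightarrow> computable_in B f"
  and computable_enc [computable]: "computable_in B f \<Longrightarrow> computable_in B (\<lambda>x. enc (f x))"
  by (simp_all add: computable_in_def)

lemma computable_Pair [computable]:
  "computable_in B f \<Longrightarrow> computable_in B g \<Longrightarrow> computable_in B (\<lambda>x. (f x, g x))"
  by (rule computable_binary[where h = Pair]) (use program_prod_encode[of B] in auto)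

text \<open>A function of several arguments is presented through the projections of one tuple, so
  that the closure rules, which all concern a single variable, apply to it as well.\<close>

lemma computable_apply2:
  "computable_in B (\<lambda>z. h (fst z) (snd z)) \<Longrightarrow> computable_in B f \<Longrightarrow> computable_in B g \<Longrightarrow>
    computable_in B (\<lambda>x. h (f x) (g x))"
  using computable_compose[OF _ computable_Pair, of B "\<lambda>z. h (fst z) (snd z)" f g] by simp

lemma computable_apply3:
  "computable_in B (\<lambda>z. h (fst z) (fst (snd z)) (snd (snd z))) \<Longrightarrow>
    computable_in B f \<Longrightarrow> computable_in B g \<Longrightarrow> computable_in B k \<Longrightarrow>
    computable_in B (\<lambda>x. h (f x) (g x) (k x))"
  using computable_compose[OF _ computable_Pair[OF _ computable_Pair],
      of B "\<lambda>z. h (fst z) (fst (snd z)) (snd (snd z))" f g k] by simp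

lemma computable_fst [computable]: "computable_in B f \<Longrightarrow> computable_in B (\<lambda>x. fst (f x))"
  by (rule computable_compose[where f = fst])
    (use program_prod_decode(1)[of B] in \<open>auto simp: computable_in_def; metis\<close>)

lemma computable_snd [computable]: "computable_in B f \<Longrightarrow> computable_in B (\<lambda>x. snd (f x))"
  by (rule computable_compose[where f = snd])
    (use program_prod_decode(2)[of B] in \<open>auto simp: computable_in_def; metis\<close>)

lemma computable_Suc [computable]: "computable_in B f \<Longrightarrow> computable_in B (\<lambda>x. Suc (f x))"
  by (rule computable_compose[where f = Suc]) (auto simp: computable_in_def intro: eval.Succ)

lemma computable_add [computable]:
  "computable_in B f \<Longrightarrow> computable_in B g \<Longrightarrow> computable_in B (\<lambda>x. f x + g x :: nat)"
  by (rule computable_binary[where h = "(+)"]) (use program_add in auto)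

lemma computable_diff [computable]:
  "computable_in B f \<Longrightarrow> computable_in B g \<Longrightarrow> computable_in B (\<lambda>x. f x - g x :: nat)"
  by (rule computable_binary[where h = "(-)"]) (use program_diff in auto)

lemma computable_mult [computable]:
  "computable_in B f \<Longrightarrow> computable_in B g \<Longrightarrow> computable_in B (\<lambda>x. f x * g x :: nat)"
  by (rule computable_binary[where h = "(*)"]) (use program_mult in auto)

lemma computable_oracle [computable]:
  "computable_in B f \<Longrightarrow> computable_in B g \<Longrightarrow> computable_in B (\<lambda>x. B (f x) (g x))"
proof (rule computable_binary[where h = B])
  show "\<exists>e. \<forall>x y. eval B e [enc x, enc y] (enc (B x y))"
    unfolding enc_nat_def enc_bool_def using eval.Query[of B] by blast
qed

text \<open>\<open>PrimRec\<close> and the enumerations in the definition of null sets pass a list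
  of separate numbers, whereas \<open>computable_in\<close> expects one code; the resulting program
  packs the three numbers first.\<close>

lemma program_ternary:
  assumes "computable_in B (\<lambda>z. h (fst z) (fst (snd z)) (snd (snd z)))"
  shows "\<exists>e. \<forall>x y z. eval B e [enc x, enc y, enc z] (enc (h x y z))"
proof -
  obtain p where p: "\<And>m n. eval B p [m, n] (prod_encode (m, n))" using program_prod_encode by blast
  obtain e where "\<And>x. eval B e [enc x] (enc (h (fst x) (fst (snd x)) (snd (snd x))))"
    using assms by (auto simp: computable_in_def)
  from this[of "(x, y, z)" for x y z]
  have e: "eval B e [prod_encode (enc x, prod_encode (enc y, enc z))] (enc (h x y z))" for x y z
    by simp
  have "eval B (Comp e [Comp p [Proj 0, Comp p [Proj (Suc 0), Proj (Suc (Suc 0))]]])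
      [enc x, enc y, enc z] (enc (h x y z))" for x y z
    by (blast intro: eval_basic e p)
  then show ?thesis by blast
qed

lemma computable_rec_nat [computable]:
  assumes "computable_in B n" "computable_in B a"
    and h: "computable_in B (\<lambda>z. h (fst z) (fst (snd z)) (snd (snd z)))"
  shows "computable_in B (\<lambda>x. rec_nat (a x) (\<lambda>m r. h m r x) (n x))"
proof -
  obtain en where en: "\<And>x. eval B en [enc x] (n x)"
    using assms(1) by (auto simp: computable_in_def)
  obtain ea where ea: "\<And>x. eval B ea [enc x] (enc (a x))"
    using assms(2) by (auto simp: computable_in_def)
  obtain eh where eh: "\<And>m r x. eval B eh [m, enc r, enc x] (enc (h m r x))"
    using program_ternary[OF h] by (auto simp del: enc_prod_def)
  have "eval B (PrimRec ea eh) [k, enc x] (enc (rec_nat (a x) (\<lambda>m r. h m r x) k))" for k x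
    by (induction k) (auto intro!: eval.PrimRec_0 ea eval.PrimRec_Suc eh)
  then have "eval B (Comp (PrimRec ea eh) [en, Proj 0]) [enc x]
      (enc (rec_nat (a x) (\<lambda>m r. h m r x) (n x)))" for x
    by (blast intro: eval_Comp2 en eval_Proj0)
  then show ?thesis unfolding computable_in_def by blast
qed

text \<open>The step program of a primitive recursion on 0 or 1 runs only when the recursion
  argument is 1, so a program may be guarded against codes on which it need not halt.\<close>

lemma computable_guard:
  assumes c: "computable_in B c" and a: "computable_in B a"
    and p: "\<exists>p. \<forall>x. c x \<longrightarrow> eval B p [enc x] (enc (f x))"
  shows "computable_in B (\<lambda>x. if c x then f x else a x)"
proof -
  obtain ec where ec: "\<And>x. eval B ec [enc x] (of_bool (c x))"
    using c by (auto simp: computable_in_def)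
  obtain ea where ea: "\<And>x. eval B ea [enc x] (enc (a x))"
    using a by (auto simp: computable_in_def)
  obtain p where p: "\<And>x. c x \<Longrightarrow> eval B p [enc x] (enc (f x))" using p by blast
  let ?p = "Comp p [Proj (Suc (Suc 0))]"
  have "eval B (PrimRec ea ?p) [of_bool (c x), enc x] (enc (if c x then f x else a x))" for x
    by (auto intro!: eval.PrimRec_0 ea eval.PrimRec_Suc[where r = "enc (a x)"] p
        intro: eval_Comp1 eval_Proj2)
  then have "eval B (Comp (PrimRec ea ?p) [ec, Proj 0]) [enc x] (enc (if c x then f x else a x))" for x
    by (blast intro: eval_Comp2 ec eval_Proj0)
  then show ?thesis unfolding computable_in_def by blast
qed

lemma computable_if [computable]:
  "computable_in B c \<Longrightarrow> computable_in B f \<Longrightarrow> computable_in B g \<Longrightarrow>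
    computable_in B (\<lambda>x. if c x then f x else g x)"
  by (rule computable_guard) (auto simp: computable_in_def)

lemma computable_eq_0: "computable_in B f \<Longrightarrow> computable_in B (\<lambda>x. f x = (0::nat))"
proof (rule computable_encI)
  assume "computable_in B f"
  then have "computable_in B (\<lambda>x. 1 - f x)" by (intro computable)
  moreover have "enc (f x = 0) = 1 - f x" for x by auto
  ultimately show "computable_in B (\<lambda>x. enc (f x = 0))" by presburger
qed

lemma computable_Not [computable]: "computable_in B f \<Longrightarrow> computable_in B (\<lambda>x. \<not> f x)"
  using computable_eq_0[OF computable_enc, of B f] by simp

lemma computable_conj [computable]:
  "computable_in B f \<Longrightarrow> computable_in B g \<Longrightarrow> computable_in B (\<lambda>x. f x \<and> g x)"
proof -
  assume "computable_in B f" "computable_in B g"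
  then have "computable_in B (\<lambda>x. if f x then g x else False)" by (intro computable)
  moreover have "(if f x then g x else False) \<longleftrightarrow> f x \<and> g x" for x by simp
  ultimately show "computable_in B (\<lambda>x. f x \<and> g x)" by (simp only:)
qed

lemma computable_disj [computable]:
  "computable_in B f \<Longrightarrow> computable_in B g \<Longrightarrow> computable_in B (\<lambda>x. f x \<or> g x)"
  using computable_Not[OF computable_conj[OF computable_Not computable_Not, of B f g]] by simp

lemma computable_le [computable]:
  "computable_in B f \<Longrightarrow> computable_in B g \<Longrightarrow> computable_in B (\<lambda>x. f x \<le> (g x :: nat))"
  using computable_eq_0[OF computable_diff, of B f g] by simp

lemma computable_less [computable]:
  "computable_in B f \<Longrightarrow> computable_in B g \<Longrightarrow> computable_in B (\<lambda>x. f x < (g x :: nat))"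
  using computable_le[OF computable_Suc, of B f g] by (simp add: Suc_le_eq)

lemma computable_eq [computable]:
  fixes f g :: "'a::encodable \<Rightarrow> 'b::encodable"
  assumes "computable_in B f" "computable_in B g"
  shows "computable_in B (\<lambda>x. f x = g x)"
proof -
  have "computable_in B (\<lambda>x. enc (f x) \<le> enc (g x) \<and> enc (g x) \<le> enc (f x))"
    by (intro computable assms)
  then show ?thesis unfolding eq_iff[symmetric] by simp
qed

lemma computable_Least [computable]:
  fixes P :: "nat \<Rightarrow> 'a::encodable \<Rightarrow> bool"
  assumes P: "computable_in B (\<lambda>z. P (fst z) (snd z))" and ex: "\<And>x. \<exists>n. P n x"
  shows "computable_in B (\<lambda>x. LEAST n. P n x)"
proof -
  have "computable_in B (\<lambda>z. \<not> P (fst z) (snd z))" by (intro computable P)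
  then obtain e where e: "\<And>n x. eval B e [prod_encode (n, enc x)] (of_bool (\<not> P n x))"
    unfolding computable_in_def by (auto simp del: of_bool_not_iff)
  obtain p where p: "\<And>m n. eval B p [m, n] (prod_encode (m, n))" using program_prod_encode by blast
  have f: "eval B (Comp e [p]) [n, enc x] (of_bool (\<not> P n x))" for n x
    by (rule eval_Comp1[OF p e])
  have "eval B (Mu (Comp e [p])) [enc x] (LEAST n. P n x)" for x
  proof (rule eval.Mu)
    show "eval B (Comp e [p]) [LEAST n. P n x, enc x] 0"
      using f[of "LEAST n. P n x" x] LeastI_ex[OF ex[of x]] by simp
    show "\<forall>m<LEAST n. P n x. \<exists>y. eval B (Comp e [p]) [m, enc x] (Suc y)"
      using f[of _ x] by (auto dest!: not_less_Least) (metis One_nat_def of_bool_eq(2))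
  qed
  then show ?thesis unfolding computable_in_def by auto
qed

lemma computable_all_less [computable]:
  fixes P :: "nat \<Rightarrow> 'a::encodable \<Rightarrow> bool"
  assumes "computable_in B n" "computable_in B (\<lambda>z. P (fst z) (snd z))"
  shows "computable_in B (\<lambda>x. \<forall>i<n x. P i x)"
proof -
  have "(\<forall>i<k. P i x) = rec_nat True (\<lambda>m r. r \<and> P m x) k" for k x
    by (induction k) (auto simp: less_Suc_eq)
  moreover have "computable_in B (\<lambda>x. rec_nat True (\<lambda>m r. r \<and> P m x) (n x))"
    by (intro computable assms computable_apply2[OF assms(2)])
  ultimately show ?thesis by presburger
qed

lemma computable_ex_less [computable]:
  fixes P :: "nat \<Rightarrow> 'a::encodable \<Rightarrow> bool"
  assumes "computable_in B n" "computable_in B (\<lambda>z. P (fst z) (snd z))"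
  shows "computable_in B (\<lambda>x. \<exists>i<n x. P i x)"
  using computable_Not[OF computable_all_less[OF assms(1) computable_Not[OF assms(2)]]] by simp

lemma computable_sum_less [computable]:
  fixes h :: "nat \<Rightarrow> 'a::encodable \<Rightarrow> nat"
  assumes "computable_in B n" "computable_in B (\<lambda>z. h (fst z) (snd z))"
  shows "computable_in B (\<lambda>x. \<Sum>i<n x. h i x :: nat)"
proof -
  have "(\<Sum>i<k. h i x) = rec_nat 0 (\<lambda>m r. r + h m x) k" for k x
    by (induction k) auto
  moreover have "computable_in B (\<lambda>x. rec_nat 0 (\<lambda>m r. r + h m x) (n x))"
    by (intro computable assms computable_apply2[OF assms(2)])
  ultimately show ?thesis by presburger
qed

lemma computable_power [computable]:
  assumes "computable_in B f" "computable_in B n"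
  shows "computable_in B (\<lambda>x. f x ^ n x :: nat)"
proof -
  have "a ^ k = rec_nat 1 (\<lambda>m r. r * a) k" for a k :: nat
    by (induction k) auto
  moreover have "computable_in B (\<lambda>x. rec_nat 1 (\<lambda>m r. r * f x) (n x))"
    by (intro computable assms computable_compose[OF assms(1)])
  ultimately show ?thesis by presburger
qed

lemma computable_funpow [computable]:
  fixes f :: "'b::encodable \<Rightarrow> 'b"
  assumes "computable_in B f" "computable_in B n" "computable_in B a"
  shows "computable_in B (\<lambda>x. (f ^^ n x) (a x))"
proof -
  have "(f ^^ k) x = rec_nat x (\<lambda>m r. f r) k" for x k
    by (induction k) auto
  moreover have "computable_in B (\<lambda>x. rec_nat (a x) (\<lambda>m r. f r) (n x))"
    by (intro computable assms computable_compose[OF assms(1)])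
  ultimately show ?thesis by presburger
qed

lemma computable_on_finite:
  fixes f :: "nat \<Rightarrow> 'b::encodable"
  shows "computable_in B (\<lambda>n. if n < N then f n else c)"
proof (induction N)
  case (Suc N)
  have "(if n < Suc N then f n else c) = (if n = N then f N else if n < N then f n else c)" for n
    by auto
  then show ?case by (simp only:) (intro computable Suc)
qed (simp add: computable_const)

lemma computable_div_2 [computable]:
  assumes "computable_in B f" shows "computable_in B (\<lambda>x. f x div 2 :: nat)"
proof -
  have "n div 2 = (LEAST k. n < 2 * Suc k)" for n :: nat
    by (rule Least_equality[symmetric]) auto
  moreover have "computable_in B (\<lambda>x. LEAST k. f x < 2 * Suc k)"
    by (intro computable assms computable_compose[OF assms]) presburger
  ultimately show ?thesis by presburger
qed

lemma computable_even [computable]: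
  assumes "computable_in B f" shows "computable_in B (\<lambda>x. even (f x :: nat))"
proof -
  have "computable_in B (\<lambda>x. f x = 2 * (f x div 2))" by (intro computable assms)
  moreover have "even n \<longleftrightarrow> n = 2 * (n div 2)" for n :: nat by presburger
  ultimately show ?thesis by presburger
qed

subsection \<open>Lists and options\<close>

lemma computable_Some [computable]: "computable_in B f \<Longrightarrow> computable_in B (\<lambda>x. Some (f x))"
  using computable_Suc[OF computable_enc] by (intro computable_encI[where f = "\<lambda>x. Some (f x)"]) simp

lemma computable_Cons [computable]:
  assumes "computable_in B f" "computable_in B g"
  shows "computable_in B (\<lambda>x. f x # g x)"
proof (rule computable_encI)
  have "computable_in B (\<lambda>x. Suc (enc (f x, g x)))" by (intro computable assms)
  then show "computable_in B (\<lambda>x. enc (f x # g x))" by simp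
qed

lemma computable_case_option [computable]:
  assumes f: "computable_in B f" and a: "computable_in B a"
    and h: "computable_in B (\<lambda>z. h (fst z) (snd z))"
  shows "computable_in B (\<lambda>x. case f x of None \<Rightarrow> a x | Some y \<Rightarrow> h y x)"
proof -
  obtain ef where ef: "\<And>x. eval B ef [enc x] (enc (f x))"
    using f by (auto simp: computable_in_def)
  obtain eh where eh: "\<And>y x. eval B eh [prod_encode (enc y, enc x)] (enc (h y x))"
    using h by (auto simp: computable_in_def)
  obtain d where d: "\<And>n. eval B d [n] (n - 1)" using program_pred by blast
  obtain p where p: "\<And>m n. eval B p [m, n] (prod_encode (m, n))" using program_prod_encode by blast
  have "eval B (Comp eh [Comp p [Comp d [ef], Proj 0]]) [enc x] (enc (h (the (f x)) x))"
    if "f x \<noteq> None" for x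
  proof -
    have "eval B (Comp d [ef]) [enc x] (enc (the (f x)))"
      using that ef[of x] d[of "Suc (enc (the (f x)))"] by (auto intro: eval_Comp1)
    then show ?thesis by (blast intro: eval_Comp1 eval_Comp2 eval_Proj0 p eh)
  qed
  then have "computable_in B (\<lambda>x. if f x \<noteq> None then h (the (f x)) x else a x)"
    by (intro computable_guard computable f a) blast
  moreover have "(case f x of None \<Rightarrow> a x | Some y \<Rightarrow> h y x)
      = (if f x \<noteq> None then h (the (f x)) x else a x)" for x
    by (auto split: option.split)
  ultimately show ?thesis by presburger
qed

lemma computable_case_list [computable]:
  fixes f :: "'a::encodable \<Rightarrow> 'b::encodable list" and a :: "'a \<Rightarrow> 'c::encodable"
  assumes f: "computable_in B f" and a: "computable_in B a"
    and h: "computable_in B (\<lambda>z. h (fst z) (fst (snd z)) (snd (snd z)))"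
  shows "computable_in B (\<lambda>x. case f x of [] \<Rightarrow> a x | y # ys \<Rightarrow> h y ys x)"
proof -
  define unCons :: "'b list \<Rightarrow> ('b \<times> 'b list) option" where
    "unCons = (\<lambda>xs. case xs of [] \<Rightarrow> None | y # ys \<Rightarrow> Some (y, ys))"
  \<comment> \<open>Lists and options are coded compatibly: the empty list and \<open>None\<close>
    by 0, and a list like the option holding its head and tail. So \<open>unCons\<close> is computed
    by the identity program.\<close>
  have "enc (unCons xs) = enc xs" for xs
    by (simp add: unCons_def split: list.split)
  then have "computable_in B (\<lambda>x. unCons (f x))"
    using computable_encI[of B "\<lambda>x. unCons (f x)"] computable_enc[OF f] by simp
  moreover have "computable_in B (\<lambda>z. h (fst (fst z)) (snd (fst z)) (snd z))"
    by (intro computable computable_apply3[OF h])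
  ultimately have "computable_in B (\<lambda>x. case unCons (f x) of None \<Rightarrow> a x | Some y \<Rightarrow> h (fst y) (snd y) x)"
    using a by (intro computable_case_option)
  moreover have "(case unCons xs of None \<Rightarrow> a x | Some y \<Rightarrow> h (fst y) (snd y) x)
      = (case xs of [] \<Rightarrow> a x | y # ys \<Rightarrow> h y ys x)" for xs x
    by (simp add: unCons_def split: list.split)
  ultimately show ?thesis by simp
qed

lemma length_le_enc: "length xs \<le> enc xs"
proof (induction xs)
  case (Cons x xs)
  then show ?case using le_prod_encode_2[of "enc xs" "enc x"] by simp
qed simp

text \<open>One entry is consumed per step of a primitive recursion. The code of the list serves as
  the number of steps: it is at least the length, and steps on the exhausted list change
  nothing.\<close>

lemma computable_foldl [computable]:
  assumes l: "computable_in B l" and a: "computable_in B a"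
    and h: "computable_in B (\<lambda>z. h (fst z) (fst (snd z)) (snd (snd z)))"
  shows "computable_in B (\<lambda>x. foldl (\<lambda>r y. h r y x) (a x) (l x))"
proof -
  define s where "s = (\<lambda>x z. case fst z of [] \<Rightarrow> z | y # ys \<Rightarrow> (ys, h (snd z) y x))"
  have s [simp]: "s x ([], r) = ([], r)" "s x (y # ys, r) = (ys, h r y x)" for x y ys r
    by (simp_all add: s_def)
  have rec: "rec_nat (xs, r) (\<lambda>_. s x) n = (drop n xs, foldl (\<lambda>r y. h r y x) r (take n xs))" for x n xs r
  proof (induction n)
    case (Suc n)
    show ?case
    proof (cases "drop n xs")
      case Nil
      then show ?thesis using Suc by simp
    next
      case (Cons y ys)
      then have "n < length xs" by (metis drop_eq_Nil list.distinct(1) not_le)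
      moreover have "xs ! n = y" "drop (Suc n) xs = ys"
        using nth_via_drop[OF Cons] tl_drop[of n xs] Cons by (simp_all add: drop_Suc)
      ultimately show ?thesis using Suc Cons by (simp add: take_Suc_conv_app_nth)
    qed
  qed simp
  have "computable_in B (\<lambda>z. h (snd (fst (snd (snd (snd z))))) (fst z) (snd (snd (snd (snd z)))))"
    by (intro computable computable_apply3[OF h])
  then have "computable_in B (\<lambda>x. snd (rec_nat (l x, a x) (\<lambda>_. s x) (enc (l x))))"
    unfolding s_def by (intro computable l a)
  then show ?thesis by (simp add: rec length_le_enc)
qed

lemma computable_rev [computable]: "computable_in B f \<Longrightarrow> computable_in B (\<lambda>x. rev (f x))"
proof -
  assume "computable_in B f"
  then have "computable_in B (\<lambda>x. foldl (\<lambda>r y. y # r) [] (f x))" by (intro computable)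
  then show ?thesis by (simp add: foldl_conv_fold rev_conv_fold)
qed

lemma computable_append [computable]:
  fixes f g :: "'a::encodable \<Rightarrow> 'c::encodable list"
  assumes "computable_in B f" "computable_in B g"
  shows "computable_in B (\<lambda>x. f x @ g x)"
proof -
  have "computable_in B (\<lambda>x. foldl (\<lambda>r y. y # r) (g x) (rev (f x)))" by (intro computable assms)
  moreover have "foldl (\<lambda>r y. y # r) ys xs = rev xs @ ys" for xs ys :: "'c list"
    by (induction xs arbitrary: ys) auto
  ultimately show ?thesis by simp
qed

lemma computable_length [computable]:
  fixes f :: "'a::encodable \<Rightarrow> 'c::encodable list"
  assumes "computable_in B f"
  shows "computable_in B (\<lambda>x. length (f x))"
proof -
  have "computable_in B (\<lambda>x. foldl (\<lambda>r y. Suc r) 0 (f x))" by (intro computable assms)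
  moreover have "foldl (\<lambda>r y. Suc r) n xs = n + length xs" for n and xs :: "'c list"
    by (induction xs arbitrary: n) auto
  ultimately show ?thesis by simp
qed

lemma computable_map [computable]:
  assumes "computable_in B l" "computable_in B (\<lambda>z. h (fst z) (snd z))"
  shows "computable_in B (\<lambda>x. map (\<lambda>y. h y x) (l x))"
proof -
  have "computable_in B (\<lambda>x. foldl (\<lambda>r y. r @ [h y x]) [] (l x))"
    by (intro computable assms computable_apply2[OF assms(2)])
  moreover have "foldl (\<lambda>r y. r @ [h y x]) r xs = r @ map (\<lambda>y. h y x) xs" for r xs x
    by (induction xs arbitrary: r) auto
  ultimately show ?thesis by simp
qed

lemma computable_Ball_set [computable]:
  assumes "computable_in B l" "computable_in B (\<lambda>z. P (fst z) (snd z))"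
  shows "computable_in B (\<lambda>x. \<forall>y\<in>set (l x). P y x)"
proof -
  have "computable_in B (\<lambda>x. foldl (\<lambda>r y. r \<and> P y x) True (l x))"
    by (intro computable assms computable_apply2[OF assms(2)])
  moreover have "foldl (\<lambda>r y. r \<and> P y x) r xs \<longleftrightarrow> r \<and> (\<forall>y\<in>set xs. P y x)" for r xs x
    by (induction xs arbitrary: r) auto
  ultimately show ?thesis by simp
qed

lemma computable_upt [computable]:
  assumes "computable_in B n" shows "computable_in B (\<lambda>x. [0..<n x])"
proof -
  have "[0..<k] = rec_nat [] (\<lambda>m r. r @ [m]) k" for k by (induction k) auto
  moreover have "computable_in B (\<lambda>x. rec_nat [] (\<lambda>m r. r @ [m]) (n x))" by (intro computable assms)
  ultimately show ?thesis by presburger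
qed

lemma computable_drop [computable]:
  fixes f :: "'a::encodable \<Rightarrow> 'c::encodable list"
  assumes "computable_in B n" "computable_in B f" shows "computable_in B (\<lambda>x. drop (n x) (f x))"
proof -
  have "tl xs = (case xs of [] \<Rightarrow> [] | y # ys \<Rightarrow> ys)" for xs :: "'c list" by (cases xs) auto
  moreover have "computable_in B (\<lambda>xs :: 'c list. case xs of [] \<Rightarrow> [] | y # ys \<Rightarrow> ys)" by (intro computable)
  ultimately have "computable_in B (tl :: 'c list \<Rightarrow> 'c list)" by presburger
  then have "computable_in B (\<lambda>x. (tl ^^ n x) (f x))" by (intro computable assms)
  moreover have "(tl ^^ k) xs = drop k xs" for k and xs :: "'c list"
    by (induction k) (auto simp: drop_Suc tl_drop)
  ultimately show ?thesis by simp
qed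

lemma computable_take [computable]:
  fixes f :: "'a::encodable \<Rightarrow> 'c::encodable list"
  assumes "computable_in B n" "computable_in B f" shows "computable_in B (\<lambda>x. take (n x) (f x))"
proof -
  have "computable_in B (\<lambda>x. rev (drop (length (f x) - n x) (rev (f x))))" by (intro computable assms)
  moreover have "rev (drop (length xs - n) (rev xs)) = take n xs" for n and xs :: "'c list"
    by (cases "n \<le> length xs") (simp_all add: rev_drop)
  ultimately show ?thesis by simp
qed

lemma computable_nth_default [computable]:
  fixes f :: "'a::encodable \<Rightarrow> 'c::encodable list"
  assumes "computable_in B n" "computable_in B f" "computable_in B d"
  shows "computable_in B (\<lambda>x. nth_default (d x) (f x) (n x))"
proof -
  have "computable_in B (\<lambda>x. case drop (n x) (f x) of [] \<Rightarrow> d x | y # ys \<Rightarrow> y)"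
    by (intro computable assms)
  moreover have "(case drop k xs of [] \<Rightarrow> c | y # ys \<Rightarrow> y) = nth_default c xs k"
    for k c and xs :: "'c list"
    by (auto simp: nth_default_def nth_via_drop split: list.split)
  ultimately show ?thesis by simp
qed

lemma computable_list_update [computable]:
  fixes f :: "'a::encodable \<Rightarrow> 'c::encodable list"
  assumes "computable_in B f" "computable_in B n" "computable_in B v"
  shows "computable_in B (\<lambda>x. (f x)[n x := v x])"
proof -
  have "computable_in B (\<lambda>x. if n x < length (f x) then take (n x) (f x) @ v x # drop (Suc (n x)) (f x) else f x)"
    by (intro computable assms)
  moreover have "(if n < length xs then take n xs @ v # drop (Suc n) xs else xs) = xs[n := v]"
    for xs :: "'c list" and n v by (simp add: upd_conv_take_nth_drop list_update_beyond)
  ultimately show ?thesis by simp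
qed

section \<open>Sums and counts over all strings of a given length\<close>

lemma finite_strings [simp]: "finite {u :: bool list. length u = n}"
  using finite_lists_length_eq[of "UNIV :: bool set" n] by simp

lemma strings_Suc:
  "{u :: bool list. length u = Suc n} = Cons True ` {u. length u = n} \<union> Cons False ` {u. length u = n}"
proof (rule set_eqI)
  fix u :: "bool list"
  show "u \<in> {u. length u = Suc n} \<longleftrightarrow> u \<in> Cons True ` {u. length u = n} \<union> Cons False ` {u. length u = n}"
  proof (cases u)
    case (Cons b v)
    then show ?thesis by (cases b) (simp_all add: image_iff)
  qed (simp add: image_iff)
qed

lemma computable_sum_strings [computable]:
  fixes h :: "bool list \<Rightarrow> 'a::encodable \<Rightarrow> nat"
  assumes "computable_in B n" "computable_in B (\<lambda>z. h (fst z) (snd z))"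
  shows "computable_in B (\<lambda>x. \<Sum>u | length u = n x. h (u :: bool list) x :: nat)"
proof -
  define L :: "nat \<Rightarrow> bool list list" where
    "L = rec_nat [[]] (\<lambda>_ r. map (Cons True) r @ map (Cons False) r)"
  have L_simps: "L 0 = [[]]" "L (Suc k) = map (Cons True) (L k) @ map (Cons False) (L k)" for k
    by (simp_all add: L_def)
  have "set (L k) = {u. length u = k}" for k
    by (induction k) (simp_all only: L_simps strings_Suc set_append set_map, simp)
  moreover have "distinct (L k)" for k
    by (induction k) (auto simp: L_simps distinct_map)
  moreover have "computable_in B (\<lambda>x. foldl (\<lambda>r u. r + h u x) 0 (L (n x)))" unfolding L_def
    by (intro computable assms computable_apply2[OF assms(2)])
  moreover have "foldl (\<lambda>r u. r + h u x) r us = r + (\<Sum>u\<leftarrow>us. h u x)" for r us x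
    by (induction us arbitrary: r) auto
  moreover have "(\<Sum>u\<leftarrow>L k. h u x) = (\<Sum>u | length u = k. h u x)" for k x
    using calculation by (simp add: sum_list_distinct_conv_sum_set)
  ultimately show ?thesis by simp
qed

lemma computable_card_strings [computable]:
  fixes P :: "bool list \<Rightarrow> 'a::encodable \<Rightarrow> bool"
  assumes "computable_in B n" "computable_in B (\<lambda>z. P (fst z) (snd z))"
  shows "computable_in B (\<lambda>x. card {u :: bool list. length u = n x \<and> P u x})"
proof -
  have "computable_in B (\<lambda>x. \<Sum>u | length u = n x. if P u x then 1 else 0 :: nat)"
    by (rule computable_sum_strings[OF assms(1)]) (intro computable assms)
  moreover have "(\<Sum>u | length u = k. if P u x then 1 else 0) = card {u :: bool list. length u = k \<and> P u x}"
    for k x by (simp add: sum.If_cases Int_def)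
  ultimately show ?thesis by simp
qed

section \<open>Evaluation with fuel\<close>

text \<open>The fuel bounds only the search performed by \<open>Mu\<close>; everything else is total.\<close>

fun eval_fuel :: "(nat \<Rightarrow> bitseq) \<Rightarrow> nat \<Rightarrow> recf \<Rightarrow> nat list \<Rightarrow> nat option" where
  "eval_fuel A s Zero xs = Some 0"
| "eval_fuel A s Succ xs = (case xs of [] \<Rightarrow> None | x # ys \<Rightarrow> if ys = [] then Some (Suc x) else None)"
| "eval_fuel A s (Proj i) xs = (if i < length xs then Some (nth_default 0 xs i) else None)"
| "eval_fuel A s Query xs = (if length xs = 2 then
    Some (of_bool (A (nth_default 0 xs 0) (nth_default 0 xs 1))) else None)"
| "eval_fuel A s (Comp f gs) xs =
    (case those (map (\<lambda>g. eval_fuel A s g xs) gs) of None \<Rightarrow> None | Some ys \<Rightarrow> eval_fuel A s f ys)"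
| "eval_fuel A s (PrimRec f g) xs = (case xs of [] \<Rightarrow> None | n # ys \<Rightarrow>
    rec_nat (eval_fuel A s f ys)
      (\<lambda>m r. case r of None \<Rightarrow> None | Some v \<Rightarrow> eval_fuel A s g (m # v # ys)) n)"
| "eval_fuel A s (Mu f) xs =
    (let n = (LEAST n. s \<le> n \<or> (case eval_fuel A s f (n # xs) of None \<Rightarrow> True | Some v \<Rightarrow> v = 0))
     in if n < s \<and> eval_fuel A s f (n # xs) = Some 0 then Some n else None)"

lemma those_eq_Some_iff: "those zs = Some ys \<longleftrightarrow> zs = map Some ys"
proof (induction zs arbitrary: ys)
  case (Cons z zs)
  then show ?case by (cases ys) (auto split: option.splits)
qed auto

text \<open>The least number in the clause for \<open>Mu\<close> always exists, since
  \<open>s\<close> itself qualifies. It is an answer only if the search stopped below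
  \<open>s\<close>, and at a zero instead of an undefined value.\<close>

lemma eval_fuel_Mu_iff:
  "eval_fuel A s (Mu f) xs = Some n \<longleftrightarrow>
    n < s \<and> eval_fuel A s f (n # xs) = Some 0 \<and> (\<forall>m<n. \<exists>y. eval_fuel A s f (m # xs) = Some (Suc y))"
proof -
  let ?P = "\<lambda>n. s \<le> n \<or> (case eval_fuel A s f (n # xs) of None \<Rightarrow> True | Some v \<Rightarrow> v = 0)"
  have P: "\<not> ?P m \<longleftrightarrow> m < s \<and> (\<exists>y. eval_fuel A s f (m # xs) = Some (Suc y))" for m
    by (auto split: option.splits intro: not0_implies_Suc)
  show ?thesis
  proof
    assume "eval_fuel A s (Mu f) xs = Some n"
    then have n: "n = (LEAST n. ?P n)" "n < s" "eval_fuel A s f (n # xs) = Some 0"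
      by (auto simp: Let_def split: if_splits)
    then show "n < s \<and> eval_fuel A s f (n # xs) = Some 0 \<and>
        (\<forall>m<n. \<exists>y. eval_fuel A s f (m # xs) = Some (Suc y))"
      using P not_less_Least[of _ ?P] by blast
  next
    assume n: "n < s \<and> eval_fuel A s f (n # xs) = Some 0 \<and>
        (\<forall>m<n. \<exists>y. eval_fuel A s f (m # xs) = Some (Suc y))"
    have "(LEAST n. ?P n) = n"
    proof (rule Least_equality)
      show "?P n" using n by simp
      show "n \<le> m" if "?P m" for m
        using n that P[of m] by (meson less_trans not_le)
    qed
    then show "eval_fuel A s (Mu f) xs = Some n" using n by (simp add: Let_def)
  qed
qed

lemma eval_fuel_mono:
  "eval_fuel A s e xs = Some y \<Longrightarrow> s \<le> t \<Longrightarrow> eval_fuel A t e xs = Some y"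
proof (induction e arbitrary: xs y)
  case (Comp f gs)
  then obtain ys where ys: "map (\<lambda>g. eval_fuel A s g xs) gs = map Some ys" "eval_fuel A s f ys = Some y"
    by (auto simp: those_eq_Some_iff split: option.splits)
  from ys(1) have "map (\<lambda>g. eval_fuel A t g xs) gs = map Some ys"
    using Comp.IH(2)[OF _ _ Comp.prems(2)]
    by (induction gs arbitrary: ys) (auto simp: Cons_eq_map_conv)
  then have "those (map (\<lambda>g. eval_fuel A t g xs) gs) = Some ys" by (simp only: those_eq_Some_iff)
  then show ?case using Comp.IH(1)[OF ys(2) Comp.prems(2)] by simp
next
  case (PrimRec f g)
  then obtain n ys where xs: "xs = n # ys" by (auto split: list.splits)
  have "rec_nat (eval_fuel A s f ys)
      (\<lambda>m r. case r of None \<Rightarrow> None | Some v \<Rightarrow> eval_fuel A s g (m # v # ys)) n = Some y \<Longrightarrow>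
    rec_nat (eval_fuel A t f ys)
      (\<lambda>m r. case r of None \<Rightarrow> None | Some v \<Rightarrow> eval_fuel A t g (m # v # ys)) n = Some y" for n y
    using PrimRec.IH \<open>s \<le> t\<close> by (induction n arbitrary: y) (auto split: option.splits)
  then show ?case using PrimRec.prems xs by simp
next
  case (Mu f)
  then show ?case unfolding eval_fuel_Mu_iff by (meson less_le_trans)
qed auto

lemma eval_fuel_sound: "eval_fuel A s e xs = Some y \<Longrightarrow> eval A e xs y"
proof (induction e arbitrary: xs y)
  case Zero
  then show ?case by (auto intro: eval.Zero)
next
  case Succ
  then show ?case by (auto intro: eval.Succ split: list.splits if_splits)
next
  case (Proj i)
  then show ?case by (auto intro: eval.Proj simp: nth_default_def split: if_splits)
next
  case Query
  then have "xs = [xs ! 0, xs ! 1]" "y = of_bool (A (xs ! 0) (xs ! 1))"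
    by (auto simp: nth_default_def numeral_2_eq_2 length_Suc_conv split: if_splits)
  then show ?case by (metis eval.Query)
next
  case (Comp f gs)
  then obtain ys where ys: "map (\<lambda>g. eval_fuel A s g xs) gs = map Some ys" "eval_fuel A s f ys = Some y"
    by (auto simp: those_eq_Some_iff split: option.splits)
  have len: "length gs = length ys" using ys(1) by (metis length_map)
  have "list_all2 (\<lambda>g y. eval A g xs y) gs ys"
  proof (rule list_all2_all_nthI[OF len])
    fix i assume i: "i < length gs"
    then have "eval_fuel A s (gs ! i) xs = Some (ys ! i)" using ys(1) len by (metis nth_map)
    then show "eval A (gs ! i) xs (ys ! i)" using Comp.IH(2) i by simp
  qed
  then show ?case using Comp.IH(1)[OF ys(2)] by (rule eval.Comp)
next
  case (PrimRec f g)
  then obtain n ys where xs: "xs = n # ys" by (auto split: list.splits)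
  have "rec_nat (eval_fuel A s f ys)
      (\<lambda>m r. case r of None \<Rightarrow> None | Some v \<Rightarrow> eval_fuel A s g (m # v # ys)) n = Some y \<Longrightarrow>
    eval A (PrimRec f g) (n # ys) y" for n y
  proof (induction n arbitrary: y)
    case 0
    then show ?case using PrimRec.IH(1) by (simp add: eval.PrimRec_0)
  next
    case (Suc n)
    then show ?case using PrimRec.IH(2) by (auto split: option.splits intro: eval.PrimRec_Suc)
  qed
  then show ?case using PrimRec.prems xs by simp
next
  case (Mu f)
  then show ?case unfolding eval_fuel_Mu_iff by (blast intro: eval.Mu)
qed

lemma eval_fuel_map_mono:
  "map (\<lambda>g. eval_fuel A s g xs) gs = map Some ys \<Longrightarrow> s \<le> t \<Longrightarrow>
    map (\<lambda>g. eval_fuel A t g xs) gs = map Some ys"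
  by (induction gs arbitrary: ys) (auto simp: Cons_eq_map_conv intro: eval_fuel_mono)

lemma eval_fuel_bounded_choice:
  fixes n :: nat
  assumes "\<forall>m<n. \<exists>s y. eval_fuel A s e (x m) = Some (h m y)"
  shows "\<exists>s. \<forall>m<n. \<exists>y. eval_fuel A s e (x m) = Some (h m y)"
  using assms
proof (induction n)
  case (Suc n)
  then obtain s where s: "\<forall>m<n. \<exists>y. eval_fuel A s e (x m) = Some (h m y)" by auto
  obtain t y where "eval_fuel A t e (x n) = Some (h n y)" using Suc.prems by blast
  then show ?case
    using s by (intro exI[of _ "max s t"]) (metis eval_fuel_mono less_Suc_eq max.cobounded1 max.cobounded2)
qed simp

lemma eval_fuel_complete: "eval A e xs y \<Longrightarrow> \<exists>s. eval_fuel A s e xs = Some y"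
proof (induction rule: eval.induct)
  case (Comp xs gs ys f z)
  have "list_all2 (\<lambda>g y. \<exists>s. eval_fuel A s g xs = Some y) gs ys"
    using Comp.IH(1) by (rule list_all2_mono) blast
  then have "\<exists>s. map (\<lambda>g. eval_fuel A s g xs) gs = map Some ys"
  proof (induction gs arbitrary: ys)
    case (Cons g gs)
    from Cons.prems obtain y ys' where ys: "ys = y # ys'" and "\<exists>t. eval_fuel A t g xs = Some y"
        and "list_all2 (\<lambda>g y. \<exists>s. eval_fuel A s g xs = Some y) gs ys'"
      by (auto simp: list_all2_Cons1)
    then obtain s t where "map (\<lambda>g. eval_fuel A s g xs) gs = map Some ys'"
        "eval_fuel A t g xs = Some y"
      using Cons.IH by blast
    then show ?case using ys
      using eval_fuel_map_mono[of A s xs gs ys' "max s t"] eval_fuel_mono[of A t g xs y "max s t"]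
      by auto
  qed simp
  then obtain s where "map (\<lambda>g. eval_fuel A s g xs) gs = map Some ys" by blast
  moreover obtain t where "eval_fuel A t f ys = Some z" using Comp.IH(2) by blast
  ultimately have "map (\<lambda>g. eval_fuel A (max s t) g xs) gs = map Some ys"
      "eval_fuel A (max s t) f ys = Some z"
    by (auto intro: eval_fuel_map_mono eval_fuel_mono)
  then have "eval_fuel A (max s t) (Comp f gs) xs = Some z"
    using those_eq_Some_iff[of "map (\<lambda>g. eval_fuel A (max s t) g xs) gs" ys] by simp
  then show ?case by blast
next
  case (PrimRec_0 f xs y g)
  then show ?case by auto
next
  case (PrimRec_Suc f g n xs r y)
  then obtain s t where "eval_fuel A s (PrimRec f g) (n # xs) = Some r"
      "eval_fuel A t g (n # r # xs) = Some y" by blast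
  then have "eval_fuel A (max s t) (PrimRec f g) (n # xs) = Some r"
      "eval_fuel A (max s t) g (n # r # xs) = Some y"
    by (metis eval_fuel_mono max.cobounded1, metis eval_fuel_mono max.cobounded2)
  then show ?case by (intro exI[of _ "max s t"]) simp
next
  case (Mu f n xs)
  obtain s where s: "eval_fuel A s f (n # xs) = Some 0" using Mu.IH(1) by blast
  have "\<forall>m<n. \<exists>s y. eval_fuel A s f (m # xs) = Some (Suc y)" using Mu.IH(2) by blast
  from eval_fuel_bounded_choice[OF this]
  obtain t where t: "\<forall>m<n. \<exists>y. eval_fuel A t f (m # xs) = Some (Suc y)" by blast
  let ?s = "max (max s t) (Suc n)"
  have "eval_fuel A ?s (Mu f) xs = Some n"
    unfolding eval_fuel_Mu_iff
  proof (intro conjI allI impI)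
    show "eval_fuel A ?s f (n # xs) = Some 0" using eval_fuel_mono[OF s, of ?s] by simp
    fix m assume "m < n"
    then obtain y where "eval_fuel A t f (m # xs) = Some (Suc y)" using t by blast
    then show "\<exists>y. eval_fuel A ?s f (m # xs) = Some (Suc y)"
      using eval_fuel_mono[of A t f "m # xs" _ ?s] by auto
  qed simp
  then show ?case by blast
qed (auto simp: nth_default_def)

lemma eval_iff_fuel: "eval A e xs y \<longleftrightarrow> (\<exists>s. eval_fuel A s e xs = Some y)"
  using eval_fuel_sound eval_fuel_complete by blast

lemma eval_deterministic: "eval A e xs y \<Longrightarrow> eval A e xs z \<Longrightarrow> y = z"
  unfolding eval_iff_fuel by (metis eval_fuel_mono nle_le option.inject)

lemma computable_map_option [computable]:
  fixes f :: "'a::encodable \<Rightarrow> 'b::encodable option"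
  assumes "computable_in B f" "computable_in B (\<lambda>z. h (fst z) (snd z))"
  shows "computable_in B (\<lambda>x. map_option (\<lambda>y. h y x) (f x))"
proof -
  have "computable_in B (\<lambda>x. case f x of None \<Rightarrow> None | Some y \<Rightarrow> Some (h y x))"
    by (intro computable assms)
  moreover have "(case z of None \<Rightarrow> None | Some y \<Rightarrow> Some (h y x)) = map_option (\<lambda>y. h y x) z" for z x
    by (cases z) auto
  ultimately show ?thesis by simp
qed

lemma computable_of_bool [computable]:
  "computable_in B f \<Longrightarrow> computable_in B (\<lambda>x. of_bool (f x) :: nat)"
  using computable_enc[of B f] by simp

lemma computable_those_map:
  fixes F :: "'g \<Rightarrow> 'a::encodable \<Rightarrow> 'b::encodable option"
  assumes "\<And>g. g \<in> set gs \<Longrightarrow> computable_in B (F g)"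
  shows "computable_in B (\<lambda>x. those (map (\<lambda>g. F g x) gs))"
  using assms
proof (induction gs)
  case Nil
  then show ?case by (simp add: computable_const)
next
  case (Cons g gs)
  show ?case unfolding list.map those.simps
    by (intro computable computable_compose[OF Cons.IH]) (simp_all add: Cons.prems)
qed

text \<open>The program \<open>e\<close> is fixed and only fuel and arguments vary, so an
  interpreter for \<open>e\<close> can be built by induction on \<open>e\<close>.\<close>

lemma computable_eval_fuel_pair: "computable_in A (\<lambda>z. eval_fuel A (fst z) e (snd z))"
proof (induction e)
  case (Comp f gs)
  have "computable_in A (\<lambda>z. case those (map (\<lambda>g. eval_fuel A (fst z) g (snd z)) gs) of
      None \<Rightarrow> None | Some ys \<Rightarrow> eval_fuel A (fst z) f ys)"
    by (rule computable_case_option computable_those_map Comp.IH computable_const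
        computable_apply2[OF Comp.IH(1)] | assumption | intro computable)+
  then show ?case by simp
next
  case (PrimRec f g)
  show ?case unfolding eval_fuel.simps
    by (rule computable_case_list computable_rec_nat computable_case_option
        computable_apply2[OF PrimRec.IH(1)] computable_apply2[OF PrimRec.IH(2)] | intro computable)+
next
  case (Mu f)
  have "computable_in A (\<lambda>z. LEAST n. fst z \<le> n \<or>
      (case eval_fuel A (fst z) f (n # snd z) of None \<Rightarrow> True | Some v \<Rightarrow> v = 0))"
    by (intro computable computable_apply2[OF Mu.IH]) blast
  then have "computable_in A (\<lambda>z. let n = (LEAST n. fst z \<le> n \<or>
      (case eval_fuel A (fst z) f (n # snd z) of None \<Rightarrow> True | Some v \<Rightarrow> v = 0))
     in if n < fst z \<and> eval_fuel A (fst z) f (n # snd z) = Some 0 then Some n else None)"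
    unfolding Let_def by (intro computable_if computable_conj computable_less computable_eq
      computable_Some computable_apply2[OF Mu.IH] computable_Cons computable_fst computable_snd
      computable_id computable_const)
  then show ?case by simp
qed (unfold eval_fuel.simps, (intro computable)+)

lemma computable_eval_fuel [computable]:
  "computable_in A s \<Longrightarrow> computable_in A xs \<Longrightarrow> computable_in A (\<lambda>x. eval_fuel A (s x) e (xs x))"
  by (rule computable_apply2[OF computable_eval_fuel_pair])

section \<open>Change of oracle\<close>

primrec replace_query :: "recf \<Rightarrow> recf \<Rightarrow> recf" where
  "replace_query q Zero = Zero"
| "replace_query q Succ = Succ"
| "replace_query q (Proj i) = Proj i"
| "replace_query q Query = q"
| "replace_query q (Comp f gs) = Comp (replace_query q f) (map (replace_query q) gs)"
| "replace_query q (PrimRec f g) = PrimRec (replace_query q f) (replace_query q g)"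
| "replace_query q (Mu f) = Mu (replace_query q f)"

lemma eval_replace_query:
  assumes q: "\<And>j n. eval B q [j, n] (of_bool (A j n))"
  shows "eval A e xs y \<Longrightarrow> eval B (replace_query q e) xs y"
proof (induction rule: eval.induct)
  case (Comp xs gs ys f z)
  have "list_all2 (\<lambda>g y. eval B g xs y) (map (replace_query q) gs) ys"
    unfolding list_all2_map1 using Comp.IH(1) by (rule list_all2_mono) blast
  then show ?case using Comp.IH(2) by (simp add: eval.Comp)
next
  case (Mu f n xs)
  show ?case unfolding replace_query.simps
    by (rule eval.Mu) (use Mu.IH in blast)+
next
  case (Query j n)
  show ?case unfolding replace_query.simps by (rule q)
qed (simp_all add: eval.intros)

lemma computable_in_oracle_mono:
  assumes "computable_in A f" and "computable_in B (\<lambda>z. A (fst z) (snd z))"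
  shows "computable_in B f"
proof -
  obtain e where e: "\<And>z. eval B e [enc z] (enc (A (fst z) (snd z)))"
    using assms(2) unfolding computable_in_def by blast
  obtain p where p: "\<And>m n. eval B p [m, n] (prod_encode (m, n))" using program_prod_encode by blast
  have "eval B e [prod_encode (j, n)] (of_bool (A j n))" for j n
    using e[of "(j, n)"] by simp
  then have "eval B (Comp e [p]) [j, n] (of_bool (A j n))" for j n
    by (blast intro: eval_Comp1 p)
  from eval_replace_query[OF this] show ?thesis
    using assms(1) unfolding computable_in_def by blast
qed

lemma computable_first_oracle_Suc:
  assumes "computable_in (first_oracle i \<omega>) f"
  shows "computable_in (first_oracle (Suc i) \<omega>) f"
proof (rule computable_in_oracle_mono[OF assms])
  have "first_oracle i \<omega> j n \<longleftrightarrow> j < i \<and> first_oracle (Suc i) \<omega> j n" for j n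
    by (simp add: first_oracle_def)
  moreover have "computable_in (first_oracle (Suc i) \<omega>)
      (\<lambda>z. fst z < i \<and> first_oracle (Suc i) \<omega> (fst z) (snd z))"
    by (intro computable)
  ultimately show "computable_in (first_oracle (Suc i) \<omega>) (\<lambda>z. first_oracle i \<omega> (fst z) (snd z))"
    by (simp only:)
qed

section \<open>Approximation by maps of strings\<close>

definition seg :: "bitseq \<Rightarrow> nat \<Rightarrow> bool list" where
  "seg \<omega> s = map \<omega> [0..<s]"

lemma length_seg [simp]: "length (seg \<omega> s) = s"
  and nth_seg [simp]: "i < s \<Longrightarrow> seg \<omega> s ! i = \<omega> i"
  and seg_0 [simp]: "seg \<omega> 0 = []"
  and seg_Suc: "seg \<omega> (Suc s) = seg \<omega> s @ [\<omega> s]"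
  by (simp_all add: seg_def)

lemma take_seg [simp]: "take n (seg \<omega> s) = seg \<omega> (min n s)"
  by (simp add: seg_def take_map min_def)

lemma seg_append: "s \<le> t \<Longrightarrow> \<exists>w. seg \<omega> t = seg \<omega> s @ w"
  by (metis append_take_drop_id min.absorb1 take_seg)

lemma in_cylinder_iff: "\<omega> \<in> cylinder u \<longleftrightarrow> seg \<omega> (length u) = u"
  by (auto simp: cylinder_def list_eq_iff_nth_eq)

lemma in_cylinder_seg [simp]: "\<omega> \<in> cylinder (seg \<omega> s)"
  by (simp add: in_cylinder_iff)

lemma cylinder_Nil [simp]: "cylinder [] = UNIV"
  by (simp add: cylinder_def)

lemma cylinder_nonempty: "\<exists>\<omega>. \<omega> \<in> cylinder u"
  by (rule exI[of _ "nth_default False u"]) (simp add: cylinder_def nth_default_def)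

text \<open>The usual presentation of a continuous map by a monotone map of finite strings. After
  the simulation of machines, computability of \<open>T\<close> is used only in the form of a
  computable \<open>g\<close>.\<close>

definition approximates :: "(bool list \<Rightarrow> bool list) \<Rightarrow> (bitseq \<Rightarrow> bitseq) \<Rightarrow> bool" where
  "approximates g T \<longleftrightarrow>
    (\<forall>u v. prefix (g u) (g (u @ v))) \<and>
    (\<forall>\<omega> u. \<omega> \<in> cylinder u \<longrightarrow> T \<omega> \<in> cylinder (g u)) \<and>
    (\<forall>\<omega> n. \<exists>s. n \<le> length (g (seg \<omega> s)))"

lemma approximates_prefix: "approximates g T \<Longrightarrow> prefix u v \<Longrightarrow> prefix (g u) (g v)"
  by (auto simp: approximates_def elim!: prefixE)

lemma approximates_seg:
  assumes "approximates g T" shows "g (seg \<omega> s) = seg (T \<omega>) (length (g (seg \<omega> s)))"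
  using assms in_cylinder_iff in_cylinder_seg unfolding approximates_def by metis

lemma approximates_length:
  assumes "approximates g T" shows "\<exists>s. \<forall>t\<ge>s. n \<le> length (g (seg \<omega> t))"
proof -
  obtain s where "n \<le> length (g (seg \<omega> s))" using assms unfolding approximates_def by blast
  moreover have "length (g (seg \<omega> s)) \<le> length (g (seg \<omega> t))" if "s \<le> t" for t
    using seg_append[OF that, of \<omega>] approximates_prefix[OF assms] by (metis prefixI prefix_length_le)
  ultimately show ?thesis by (meson le_trans)
qed

lemma approximates_id: "approximates (\<lambda>u. u) (\<lambda>\<omega>. \<omega>)"
  unfolding approximates_def by (metis length_seg order_refl prefixI)

lemma approximates_comp:
  assumes f: "approximates f S" and g: "approximates g T"
  shows "approximates (\<lambda>u. f (g u)) (\<lambda>\<omega>. S (T \<omega>))"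
  unfolding approximates_def
proof (intro conjI allI impI)
  show "prefix (f (g u)) (f (g (u @ v)))" for u v
    by (rule approximates_prefix[OF f approximates_prefix[OF g prefixI]]) simp
  show "S (T \<omega>) \<in> cylinder (f (g u))" if "\<omega> \<in> cylinder u" for \<omega> u
    using that f g unfolding approximates_def by blast
  show "\<exists>s. n \<le> length (f (g (seg \<omega> s)))" for \<omega> n
  proof -
    obtain t where t: "\<forall>r\<ge>t. n \<le> length (f (seg (T \<omega>) r))" using approximates_length[OF f] by blast
    obtain s where "t \<le> length (g (seg \<omega> s))" using approximates_length[OF g] by blast
    then show ?thesis using t approximates_seg[OF g, of \<omega> s] by metis
  qed
qed

lemma approximates_funpow: "approximates g T \<Longrightarrow> approximates (g ^^ n) (T ^^ n)"
proof (induction n)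
  case 0
  then show ?case using approximates_id by (simp add: id_def)
next
  case (Suc n)
  then show ?case using approximates_comp[of g T "g ^^ n" "T ^^ n"] by (simp add: comp_def)
qed

section \<open>Simulation of Turing machines\<close>

instantiation dir :: encodable
begin
definition enc_dir :: "dir \<Rightarrow> nat" where
  "enc_dir d = (case d of Left \<Rightarrow> 0 | Stay \<Rightarrow> 1 | Right \<Rightarrow> 2)"
instance by standard (auto simp: inj_def enc_dir_def split: dir.splits)
end

lemma computable_move [computable]:
  assumes "computable_in B d" "computable_in B f"
  shows "computable_in B (\<lambda>x. move (d x) (f x))"
proof -
  have "computable_in B (\<lambda>x. if d x = Left then f x - 1 else if d x = Stay then f x else f x + 1)"
    by (intro computable assms)
  moreover have "(if d = Left then n - 1 else if d = Stay then n else n + 1) = move d n" for d n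
    by (cases d) auto
  ultimately show ?thesis by simp
qed

text \<open>Needed for \<open>delta\<close>, which is an arbitrary function outside the finitely
  many states and symbols of the machine: only its finite table can be computed, and the simulation
  must be shown never to leave that table.\<close>

lemma computable_on_finite_set:
  fixes f :: "'a::encodable \<Rightarrow> 'b::encodable"
  assumes "finite X"
  shows "\<exists>h. computable_in B h \<and> (\<forall>x\<in>X. h x = f x)"
proof -
  define N where "N = Suc (Max (enc ` X))"
  have N: "enc x < N" if "x \<in> X" for x
    unfolding N_def less_Suc_eq_le using assms that by (intro Max_ge) auto
  define h where "h x = (if enc x < N then f (inv enc (enc x)) else f undefined)" for x :: 'a
  have "computable_in B h" unfolding h_def
    by (rule computable_compose[OF computable_on_finite computable_enc[OF computable_id]])
  moreover have "\<forall>x\<in>X. h x = f x" using N by (simp add: h_def inv_f_f[OF inj_enc])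
  ultimately show ?thesis by blast
qed

type_synonym sim = "nat \<times> nat \<times> nat list \<times> nat \<times> bool list"

definition sim_step ::
  "(nat \<times> bool \<times> nat \<Rightarrow> nat \<times> dir \<times> nat \<times> dir \<times> bool option) \<Rightarrow> bool list \<Rightarrow> sim \<Rightarrow> sim" where
  "sim_step h u c = (
    let q = fst c; i = fst (snd c); ws = fst (snd (snd c)); p = fst (snd (snd (snd c)));
        z = h (q, nth_default False u i, nth_default 0 ws p)
    in (fst z, move (fst (snd z)) i, ws[p := fst (snd (snd z))], move (fst (snd (snd (snd z)))) p,
        snd (snd (snd (snd c))) @ (case snd (snd (snd (snd z))) of None \<Rightarrow> [] | Some v \<Rightarrow> [v])))"

lemma computable_sim_step [computable]:
  assumes "computable_in B h" "computable_in B u" "computable_in B c"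
  shows "computable_in B (\<lambda>x. sim_step h (u x) (c x))"
  unfolding sim_step_def Let_def
  by (intro computable assms computable_compose[OF assms(1)])

definition conf_of :: "sim \<Rightarrow> config" where
  "conf_of c = \<lparr>state = fst c, input_pos = fst (snd c), work_tape = nth_default 0 (fst (snd (snd c))),
    work_pos = fst (snd (snd (snd c))), out = snd (snd (snd (snd c)))\<rparr>"

text \<open>In \<open>length u\<close> steps the input head reads only positions below
  \<open>length u\<close>, so the padding with \<open>False\<close> is never seen. Tying the running
  time to the length also makes the map monotone.\<close>

definition tm_map :: "tm \<Rightarrow> bool list \<Rightarrow> bool list" where
  "tm_map M u = output_after M (nth_default False u) (length u)"

lemma move_le: "move d n \<le> Suc n"
  by (cases d) auto

lemma step_conf_of:
  fixes u :: "bool list" and c :: sim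
  assumes wf: "wf_tm M" and h: "\<forall>q<states M. \<forall>a. \<forall>s<symbols M. h (q, a, s) = delta M q a s"
    and c: "fst c < states M" "\<forall>s\<in>set (fst (snd (snd c))). s < symbols M"
      "fst (snd (snd (snd c))) < length (fst (snd (snd c)))"
  defines "c' \<equiv> sim_step h u c"
  shows "step M (nth_default False u) (conf_of c) = conf_of c'"
    and "fst c' < states M" "\<forall>s\<in>set (fst (snd (snd c'))). s < symbols M"
      "length (fst (snd (snd c'))) = length (fst (snd (snd c)))"
      "fst (snd (snd (snd c'))) \<le> Suc (fst (snd (snd (snd c))))"
proof -
  obtain q i ws p o' where c_eq: "c = (q, i, ws, p, o')" by (cases c) auto
  have p: "p < length ws" "ws ! p < symbols M" "q < states M" using c c_eq by auto
  obtain q' d s' d' b where z: "delta M q (nth_default False u i) (ws ! p) = (q', d, s', d', b)"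
    by (metis prod_cases5)
  have q': "q' < states M" "s' < symbols M"
    using wf z p unfolding wf_tm_def by (metis (no_types, lifting) case_prod_conv)+
  have hz: "h (q, nth_default False u i, nth_default 0 ws p) = (q', d, s', d', b)"
    using h z p by (simp add: nth_default_def)
  then have c': "c' = (q', move d i, ws[p := s'], move d' p,
      o' @ (case b of None \<Rightarrow> [] | Some v \<Rightarrow> [v]))"
    unfolding c'_def sim_step_def c_eq Let_def by simp
  have "nth_default 0 (ws[p := s']) = (nth_default 0 ws)(p := s')"
    using p by (auto simp: nth_default_def fun_eq_iff nth_list_update)
  then show "step M (nth_default False u) (conf_of c) = conf_of c'"
    using z p by (simp add: step_def conf_of_def c' c_eq nth_default_nth)
  show "fst c' < states M" "length (fst (snd (snd c'))) = length (fst (snd (snd c)))"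
      "fst (snd (snd (snd c'))) \<le> Suc (fst (snd (snd (snd c))))"
    using q' move_le by (simp_all add: c' c_eq)
  show "\<forall>s\<in>set (fst (snd (snd c'))). s < symbols M"
    using q' c set_update_subset_insert[of ws p s'] by (auto simp: c' c_eq)
qed

lemma computable_tm_map:
  assumes wf: "wf_tm M" shows "computable_in B (tm_map M)"
proof -
  have "finite ({..<states M} \<times> (UNIV :: bool set) \<times> {..<symbols M})" by simp
  from computable_on_finite_set[OF this, of B "\<lambda>(q, a, s). delta M q a s"]
  obtain h where h: "computable_in B h"
      "\<forall>q<states M. \<forall>a. \<forall>s<symbols M. h (q, a, s) = delta M q a s" by auto
  \<comment> \<open>After \<open>t\<close> steps the work head is at cell \<open>t\<close> at most,
    so \<open>Suc (length u)\<close> cells suffice for \<open>length u\<close> steps.\<close>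
  define c0 :: "bool list \<Rightarrow> sim" where "c0 u = (0, 0, map (\<lambda>_. 0) [0..<Suc (length u)], 0, [])" for u
  have "rec_nat (c0 u) (\<lambda>_ c. sim_step h u c) t = c \<Longrightarrow> t \<le> length u \<Longrightarrow>
      fst c < states M \<and> (\<forall>s\<in>set (fst (snd (snd c))). s < symbols M) \<and>
      length (fst (snd (snd c))) = Suc (length u) \<and> fst (snd (snd (snd c))) \<le> t \<and>
      (step M (nth_default False u) ^^ t) initial = conf_of c" for u t c
  proof (induction t arbitrary: c)
    case 0
    have "nth_default 0 (map (\<lambda>_. 0) [0..<n]) = (\<lambda>_. 0 :: nat)" for n :: nat
      by (auto simp: nth_default_def fun_eq_iff)
    then show ?case using 0 wf by (auto simp: c0_def wf_tm_def conf_of_def initial_def)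
  next
    case (Suc t)
    define d where "d = rec_nat (c0 u) (\<lambda>_ c. sim_step h u c) t"
    have c: "c = sim_step h u d" using Suc.prems by (simp add: d_def)
    have d: "fst d < states M" "\<forall>s\<in>set (fst (snd (snd d))). s < symbols M"
        "length (fst (snd (snd d))) = Suc (length u)" "fst (snd (snd (snd d))) \<le> t"
        "(step M (nth_default False u) ^^ t) initial = conf_of d"
      using Suc.IH[of d] Suc.prems(2) by (auto simp: d_def)
    have "fst (snd (snd (snd d))) < length (fst (snd (snd d)))" using d Suc.prems(2) by simp
    note s = step_conf_of[OF wf h(2) d(1,2) this, of u, folded c]
    show ?case using s d by auto
  qed
  then have "tm_map M u = snd (snd (snd (snd (rec_nat (c0 u) (\<lambda>_ c. sim_step h u c) (length u)))))" for u
    by (simp add: tm_map_def output_after_def conf_of_def)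
  moreover have "computable_in B (\<lambda>u. snd (snd (snd (snd
      (rec_nat (c0 u) (\<lambda>_ c. sim_step h u c) (length u))))))"
    unfolding c0_def by (intro computable h)
  ultimately show ?thesis using computable_cong[of "tm_map M"] by simp
qed

lemma output_after_mono: "s \<le> t \<Longrightarrow> prefix (output_after M \<omega> s) (output_after M \<omega> t)"
proof (induction rule: dec_induct)
  case (step n)
  have "prefix (output_after M \<omega> n) (output_after M \<omega> (Suc n))"
    by (simp add: output_after_def step_def split: prod.split)
  with step show ?case by (rule_tac prefix_order.trans)
qed simp

lemma step_cong: "\<omega> (input_pos c) = \<tau> (input_pos c) \<Longrightarrow> step M \<omega> c = step M \<tau> c"
  by (simp add: step_def)

lemma output_after_cong:
  assumes "\<And>i. i < s \<Longrightarrow> \<omega> i = \<tau> i"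
  shows "t \<le> s \<Longrightarrow> output_after M \<omega> t = output_after M \<tau> t"
proof -
  have "t \<le> s \<Longrightarrow> (step M \<omega> ^^ t) initial = (step M \<tau> ^^ t) initial \<and>
      input_pos ((step M \<omega> ^^ t) initial) \<le> t"
  proof (induction t)
    case (Suc t)
    then have "step M \<omega> ((step M \<omega> ^^ t) initial) = step M \<tau> ((step M \<omega> ^^ t) initial)"
      by (intro step_cong assms) auto
    moreover have "input_pos (step M \<omega> c) \<le> Suc (input_pos c)" for c
      using move_le by (simp add: step_def split: prod.split)
    then have "input_pos (step M \<omega> ((step M \<omega> ^^ t) initial)) \<le> Suc t"
      using Suc by (meson Suc_leD Suc_le_mono order_trans)
    ultimately show ?case using Suc by auto
  qed (simp add: initial_def)
  then show "t \<le> s \<Longrightarrow> output_after M \<omega> t = output_after M \<tau> t" by (simp add: output_after_def)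
qed

lemma tm_map_eq: "\<omega> \<in> cylinder u \<Longrightarrow> tm_map M u = output_after M \<omega> (length u)"
  unfolding tm_map_def
  by (rule output_after_cong[where s = "length u"]) (auto simp: cylinder_def nth_default_def)

lemma approximates_tm_map:
  assumes "\<forall>\<omega>. writes M \<omega> (T \<omega>)" shows "approximates (tm_map M) T"
  unfolding approximates_def
proof (intro conjI allI impI)
  show "prefix (tm_map M u) (tm_map M (u @ v))" for u v
  proof -
    obtain \<omega> where \<omega>: "\<omega> \<in> cylinder (u @ v)" using cylinder_nonempty by blast
    then have "\<omega> \<in> cylinder u" by (auto simp: cylinder_def nth_append split: if_splits)
    then show ?thesis using \<omega> by (simp add: tm_map_eq output_after_mono)
  qed
  show "T \<omega> \<in> cylinder (tm_map M u)" if "\<omega> \<in> cylinder u" for \<omega> u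
    using assms tm_map_eq[OF that] unfolding writes_def cylinder_def by fastforce
  show "\<exists>s. n \<le> length (tm_map M (seg \<omega> s))" for \<omega> n
    using assms unfolding writes_def by (metis in_cylinder_seg length_seg less_imp_le tm_map_eq)
qed

section \<open>Open sets of bit sequences\<close>

lemma prob_space_uniform: "prob_space uniform"
  unfolding uniform_def by (intro prob_space_PiM measure_pmf.prob_space_axioms)

interpretation uniform: prob_space uniform
  by (rule prob_space_uniform)

lemma space_uniform [simp]: "space uniform = UNIV"
  by (simp add: uniform_def space_PiM)

lemma sets_cylinder [measurable]: "cylinder u \<in> sets uniform"
proof -
  have "Measurable.pred uniform (\<lambda>\<omega>. \<forall>i\<in>{..<length u}. \<omega> i = u ! i)"
    unfolding uniform_def by measurable
  then show ?thesis by (simp add: pred_def cylinder_def lessThan_def)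
qed

lemma seg_eq_sum:
  fixes f :: "bool list \<Rightarrow> real"
  shows "f (seg \<omega> s) = (\<Sum>u | length u = s. f u * indicator (cylinder u) \<omega>)"
proof -
  have "(\<Sum>u | length u = s. f u * indicator (cylinder u) \<omega>) = (\<Sum>u\<in>{seg \<omega> s}. f u)"
    by (rule sum.mono_neutral_cong_right) (auto simp: in_cylinder_iff indicator_def)
  then show ?thesis by simp
qed

lemma integral_seg:
  fixes f :: "bool list \<Rightarrow> real"
  shows "integrable uniform (\<lambda>\<omega>. f (seg \<omega> s))"
    and "(\<integral>\<omega>. f (seg \<omega> s) \<partial>uniform) = (\<Sum>u | length u = s. f u) / 2 ^ s"
proof -
  have "has_bochner_integral uniform (\<lambda>\<omega>. \<Sum>u | length u = s. f u * indicator (cylinder u) \<omega>)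
      (\<Sum>u | length u = s. f u * measure uniform (cylinder u))"
    by (intro has_bochner_integral_sum has_bochner_integral_mult_right has_bochner_integral_real_indicator)
      (simp_all add: sets_cylinder uniform.emeasure_eq_measure)
  moreover have "(\<Sum>u | length u = s. f u * measure uniform (cylinder u)) = (\<Sum>u | length u = s. f u) / 2 ^ s"
    unfolding sum_divide_distrib by (rule sum.cong) (simp_all add: measure_cylinder power_divide)
  ultimately show "integrable uniform (\<lambda>\<omega>. f (seg \<omega> s))"
      "(\<integral>\<omega>. f (seg \<omega> s) \<partial>uniform) = (\<Sum>u | length u = s. f u) / 2 ^ s"
    unfolding seg_eq_sum[of f] by (simp_all add: has_bochner_integral_iff)
qed

lemma sets_seg [measurable]: "{\<omega>. P (seg \<omega> s)} \<in> sets uniform"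
proof -
  have "{\<omega>. P (seg \<omega> s)} = (\<Union>u\<in>{u. length u = s \<and> P u}. cylinder u)"
    by (auto simp: in_cylinder_iff)
  also have "\<dots> \<in> sets uniform"
    by (rule sets.finite_UN) (auto intro: finite_subset[OF _ finite_strings])
  finally show ?thesis .
qed

lemma measure_seg: "measure uniform {\<omega>. P (seg \<omega> s)} = card {u. length u = s \<and> P u} / 2 ^ s"
proof -
  have "measure uniform {\<omega>. P (seg \<omega> s)} = (\<integral>\<omega>. of_bool (P (seg \<omega> s)) \<partial>uniform)"
  proof -
    have "indicator {\<omega>. P (seg \<omega> s)} = (\<lambda>\<omega>. of_bool (P (seg \<omega> s)) :: real)"
      by (auto simp: fun_eq_iff)
    then show ?thesis
      using Bochner_Integration.integral_indicator[of uniform "{\<omega>. P (seg \<omega> s)}"] by simp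
  qed
  then show ?thesis by (simp add: integral_seg(2)[of "\<lambda>u. of_bool (P u)"] Int_def)
qed

text \<open>Effectively open sets are given below by decidable \<open>upward\<close> properties in
  place of enumerations: a string is accepted once it is long enough for the relevant enumeration to
  have been run that far. The stages \<open>{\<omega>. R (seg \<omega> s)}\<close> then increase,
  and their measures are found by counting strings.\<close>

definition upward :: "(bool list \<Rightarrow> bool) \<Rightarrow> bool" where
  "upward R \<longleftrightarrow> (\<forall>u v. R u \<longrightarrow> R (u @ v))"

definition open_of :: "(bool list \<Rightarrow> bool) \<Rightarrow> bitseq set" where
  "open_of R = {\<omega>. \<exists>s. R (seg \<omega> s)}"

lemma open_of_eq_cylinders: "open_of R = (\<Union>u\<in>{u. R u}. cylinder u)"
  unfolding open_of_def by (auto simp: in_cylinder_iff) metis+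

lemma sets_open_of [measurable]: "open_of R \<in> sets uniform"
  unfolding open_of_eq_cylinders by (intro sets.countable_UN') (auto simp: sets_cylinder)

lemma upward_seg: "upward R \<Longrightarrow> R (seg \<omega> s) \<Longrightarrow> s \<le> t \<Longrightarrow> R (seg \<omega> t)"
  using seg_append unfolding upward_def by metis

lemma upward_prefix: "upward R \<Longrightarrow> R u \<Longrightarrow> prefix u v \<Longrightarrow> R v"
  by (auto simp: upward_def elim: prefixE)

lemma measure_open_of_tendsto:
  assumes "upward R"
  shows "(\<lambda>s. measure uniform {\<omega>. R (seg \<omega> s)}) \<longlonglongrightarrow> measure uniform (open_of R)"
proof -
  have "open_of R = (\<Union>s. {\<omega>. R (seg \<omega> s)})" by (auto simp: open_of_def)
  moreover have "incseq (\<lambda>s. {\<omega>. R (seg \<omega> s)})"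
    using upward_seg[OF assms] by (auto simp: incseq_def)
  ultimately show ?thesis
    using uniform.finite_Lim_measure_incseq[of "\<lambda>s. {\<omega>. R (seg \<omega> s)}"]
    by (auto simp: image_subset_iff sets_seg)
qed

lemma measure_open_of_le:
  assumes "upward R" "\<And>s. measure uniform {\<omega>. R (seg \<omega> s)} \<le> c"
  shows "measure uniform (open_of R) \<le> c"
  by (rule LIMSEQ_le_const2[OF measure_open_of_tendsto[OF assms(1)]]) (use assms(2) in blast)

lemma measure_seg_le_open_of: "measure uniform {\<omega>. R (seg \<omega> s)} \<le> measure uniform (open_of R)"
  by (rule uniform.finite_measure_mono[OF _ sets_open_of]) (auto simp: open_of_def)

lemma open_of_approximates:
  assumes R: "upward R" and g: "approximates g T"
  shows "open_of (\<lambda>u. R (g u)) = T -` open_of R"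
proof (intro set_eqI iffI)
  fix \<omega> assume "\<omega> \<in> open_of (\<lambda>u. R (g u))"
  then show "\<omega> \<in> T -` open_of R"
    using approximates_seg[OF g, of \<omega>] by (auto simp: open_of_def) metis
next
  fix \<omega> assume "\<omega> \<in> T -` open_of R"
  then obtain n where "R (seg (T \<omega>) n)" by (auto simp: open_of_def)
  moreover obtain s where "n \<le> length (g (seg \<omega> s))" using approximates_length[OF g] by blast
  ultimately have "R (g (seg \<omega> s))"
    using approximates_seg[OF g, of \<omega> s] upward_seg[OF R] by metis
  then show "\<omega> \<in> open_of (\<lambda>u. R (g u))" by (auto simp: open_of_def)
qed

lemma upward_approximates: "upward R \<Longrightarrow> approximates g T \<Longrightarrow> upward (\<lambda>u. R (g u))"
  unfolding upward_def[of "\<lambda>u. R (g u)"] by (meson approximates_prefix prefixI upward_prefix)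

section \<open>Tests\<close>

definition ml_test :: "(nat \<Rightarrow> bitseq) \<Rightarrow> (nat \<Rightarrow> bool list \<Rightarrow> bool) \<Rightarrow> bool" where
  "ml_test B D \<longleftrightarrow> computable_in B (\<lambda>z. D (fst z) (snd z)) \<and>
    (\<forall>k. upward (D k) \<and> measure uniform (open_of (D k)) \<le> (1 / 2) ^ k)"

lemma computable_list_decode: "computable_in B f \<Longrightarrow> computable_in B (\<lambda>x. list_decode (f x))"
  using computable_encI[of B "\<lambda>x. list_decode (f x)"] by (simp add: enc_list_def map_idI computable_enc)

lemma string_code_eq_enc: "string_code u = enc u"
  by (simp add: string_code_def enc_list_def comp_def enc_bool_def[abs_def])

text \<open>For the bound \<open>p / q\<close> the member of index \<open>q\<close> of a test can
  thus be used, whatever \<open>p\<close> is.\<close>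

lemma half_power_le_divide: "(1 / 2 :: real) ^ q \<le> p / q" if "0 < p" "0 < q" for p q :: nat
proof -
  have "real q \<le> 2 ^ q" using of_nat_less_two_power[of q] by (simp add: less_imp_le)
  then have "1 * real q \<le> real p * 2 ^ q"
    using that by (intro mult_mono) auto
  then show ?thesis using that by (simp add: power_divide field_simps)
qed

lemma random_relative_passes:
  assumes "random_relative B x" and D: "ml_test B D"
  shows "\<exists>k. x \<notin> open_of (D k)"
proof (rule ccontr)
  assume "\<nexists>k. x \<notin> open_of (D k)"
  then have x: "x \<in> open_of (D k)" for k by blast
  have comp: "computable_in B (\<lambda>z. D (fst z) (snd z))" using D by (simp add: ml_test_def)
  define str :: "nat \<Rightarrow> bool list" where "str n = map odd (list_decode n)" for n
  have str: "\<exists>n. str n = u" for u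
  proof
    show "str (list_encode (map of_bool u)) = u" by (simp add: str_def comp_def)
  qed
  have nonempty: "\<exists>n. D q (str n)" for q
    using x[of q] str by (auto simp: open_of_def) metis
  \<comment> \<open>The enumerating program is obtained from a total function, so a rejected string
    must be replaced by an accepted one. The least accepted one exists because \<open>x\<close> is
    assumed to lie in every member of the test.\<close>
  define f where "f q n = (if D q (str n) then str n else str (LEAST n. D q (str n)))" for q n
  have f: "D q (f q n)" for q n
    unfolding f_def using LeastI_ex[OF nonempty[of q]] by auto
  have f_eq: "D q u \<Longrightarrow> \<exists>n. f q n = u" for q u
    using str[of u] by (auto simp: f_def)
  have cstr: "computable_in B str" unfolding str_def by (intro computable computable_list_decode)
  have least: "computable_in B (\<lambda>q. LEAST n. D q (str n))"
    by (intro computable computable_apply2[OF comp] computable_compose[OF cstr] nonempty)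
  have "computable_in B (\<lambda>z :: nat \<times> nat \<times> nat. f (fst (snd z)) (snd (snd z)))"
    unfolding f_def by (intro computable computable_apply2[OF comp] computable_compose[OF cstr]
      computable_compose[OF least])
  then obtain e where e: "\<And>p q n. eval B e [p, q, n] (enc (f q n))"
    using program_ternary[of B "\<lambda>(p :: nat) q n. f q n"] by auto
  have "enumerated B e [p, q] = {enc u |u. D q u}" for p q
  proof (intro set_eqI iffI)
    fix y assume "y \<in> enumerated B e [p, q]"
    then obtain n where "eval B e [p, q, n] y" by (auto simp: enumerated_def)
    then have "y = enc (f q n)" using e eval_deterministic by blast
    then show "y \<in> {enc u |u. D q u}" using f by blast
  next
    fix y assume "y \<in> {enc u |u. D q u}"
    then obtain n where "y = enc (f q n)" using f_eq by blast
    then show "y \<in> enumerated B e [p, q]" using e[of p q n] by (auto simp: enumerated_def)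
  qed
  then have open_eq: "enumerated_open string_code cylinder B e [p, q] = open_of (D q)" for p q
    by (auto simp: enumerated_open_def string_code_eq_enc open_of_eq_cylinders)
  have "effectively_null string_code cylinder uniform B (\<Inter>q. open_of (D q))"
    unfolding effectively_null_def
  proof (rule exI[of _ e], unfold open_eq, intro allI impI conjI)
    fix p q :: nat assume "0 < p \<and> 0 < q"
    then show "measure uniform (open_of (D q)) \<le> real p / real q"
      using D half_power_le_divide[of p q] unfolding ml_test_def by (meson order_trans)
  qed blast
  then show False using assms(1) x unfolding random_relative_def by blast
qed

definition passes_tests :: "(nat \<Rightarrow> bitseq) \<Rightarrow> bitseq \<Rightarrow> bool" where
  "passes_tests B x \<longleftrightarrow> (\<forall>D. ml_test B D \<longrightarrow> (\<exists>k. x \<notin> open_of (D k)))"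

text \<open>Pulling a test back along \<open>T\<close> gives a test: \<open>g\<close> makes the
  preimages effectively open, and \<open>T\<close> preserves their measures.\<close>

lemma passes_tests_image:
  assumes x: "passes_tests B x" and g: "approximates g T" "computable_in B g"
    and T: "\<And>R. measure uniform (T -` open_of R) = measure uniform (open_of R)"
  shows "passes_tests B (T x)"
  unfolding passes_tests_def
proof (intro allI impI)
  fix D assume D: "ml_test B D"
  have "ml_test B (\<lambda>k u. D k (g u))"
    unfolding ml_test_def
  proof (intro conjI allI)
    have "computable_in B (\<lambda>z. D (fst z) (snd z))" using D by (simp add: ml_test_def)
    then show "computable_in B (\<lambda>z. D (fst z) (g (snd z)))"
      by (rule computable_apply2) (intro computable computable_compose[OF g(2)])+
    fix k
    have "upward (D k)" using D by (simp add: ml_test_def)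
    then show "upward (\<lambda>u. D k (g u))" "measure uniform (open_of (\<lambda>u. D k (g u))) \<le> (1 / 2) ^ k"
      using upward_approximates open_of_approximates g D T by (auto simp: ml_test_def)
  qed
  then obtain k where "x \<notin> open_of (\<lambda>u. D k (g u))"
    using x unfolding passes_tests_def by blast
  moreover have "upward (D k)" using D by (simp add: ml_test_def)
  ultimately show "\<exists>k. T x \<notin> open_of (D k)"
    using open_of_approximates[OF _ g(1)] by blast
qed

section \<open>A mean ergodic theorem\<close>

locale ergodic_system = prob_space M for M :: "'a measure" +
  fixes T :: "'a \<Rightarrow> 'a"
  assumes ergodic: "ergodic M T"
begin

lemma measurable_funpow [measurable]: "T ^^ i \<in> M \<rightarrow>\<^sub>M M"
proof (induction i)
  case (Suc i)
  have "T \<in> M \<rightarrow>\<^sub>M M" using ergodic by (simp add: ergodic_def)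
  from measurable_compose[OF Suc this] show ?case by (simp add: comp_def)
qed (simp add: id_def)

lemma distr_funpow: "distr M M (T ^^ i) = M"
proof (induction i)
  case (Suc i)
  have T: "T \<in> M \<rightarrow>\<^sub>M M" using ergodic by (simp add: ergodic_def)
  have "distr M M T = M"
    using ergodic T by (intro measure_eqI) (simp_all add: ergodic_def emeasure_distr)
  then show ?case using distr_distr[OF T measurable_funpow[of i]] Suc by (simp add: comp_def)
qed (simp add: id_def distr_id2)

lemma integral_funpow:
  fixes f :: "'a \<Rightarrow> real"
  assumes "f \<in> borel_measurable M"
  shows "(\<integral>x. f ((T ^^ i) x) \<partial>M) = (\<integral>x. f x \<partial>M)"
  using integral_distr[OF measurable_funpow[of i] assms] distr_funpow by simp

lemma integrable_funpow:
  fixes f :: "'a \<Rightarrow> real"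
  assumes "integrable M f"
  shows "integrable M (\<lambda>x. f ((T ^^ i) x))"
  using integrable_distr[OF measurable_funpow[of i], of f] distr_funpow assms by simp

definition avg :: "nat \<Rightarrow> ('a \<Rightarrow> real) \<Rightarrow> 'a \<Rightarrow> real" where
  "avg n f x = (\<Sum>i<n. f ((T ^^ i) x)) / n"

lemma avg_measurable [measurable]: "f \<in> borel_measurable M \<Longrightarrow> avg n f \<in> borel_measurable M"
  unfolding avg_def[abs_def]
  by (intro borel_measurable_divide borel_measurable_sum borel_measurable_const)
    (rule measurable_compose[OF measurable_funpow])

lemma integral_avg:
  assumes "integrable M f" "0 < n"
  shows "(\<integral>x. avg n f x \<partial>M) = (\<integral>x. f x \<partial>M)" "integrable M (avg n f)"
proof -
  have "(\<integral>x. avg n f x \<partial>M) = (\<Sum>i<n. \<integral>x. f ((T ^^ i) x) \<partial>M) / n"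
    unfolding avg_def using integrable_funpow[OF assms(1)] by simp
  also have "\<dots> = (\<integral>x. f x \<partial>M)"
    using assms by (simp add: integral_funpow)
  finally show "(\<integral>x. avg n f x \<partial>M) = (\<integral>x. f x \<partial>M)" .
  show "integrable M (avg n f)"
    unfolding avg_def[abs_def] using integrable_funpow[OF assms(1)] by simp
qed

lemma avg_bounds:
  assumes "\<And>x. 0 \<le> f x" "\<And>x. f x \<le> 1"
  shows "0 \<le> avg n f x" "avg n f x \<le> 1"
proof -
  show "0 \<le> avg n f x" unfolding avg_def using assms by (simp add: sum_nonneg)
  have "(\<Sum>i<n. f ((T ^^ i) x)) \<le> n"
    using sum_bounded_above[of "{..<n}" "\<lambda>i. f ((T ^^ i) x)" 1] assms by simp
  then show "avg n f x \<le> 1" unfolding avg_def by (cases "n = 0") simp_all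
qed

lemma shifted_sum_diff:
  fixes a :: "nat \<Rightarrow> real"
  assumes "\<And>k. 0 \<le> a k" "\<And>k. a k \<le> 1"
  shows "\<bar>(\<Sum>i<n. a (i + j)) - (\<Sum>i<n. a i)\<bar> \<le> j"
proof (induction j)
  case (Suc j)
  have "(\<Sum>i<n. a (i + Suc j)) + a j = (\<Sum>i<n. a (i + j)) + a (n + j)"
    using sum.lessThan_Suc_shift[of "\<lambda>i. a (i + j)" n] sum.lessThan_Suc[of "\<lambda>i. a (i + j)" n]
    by simp
  then show ?case using Suc assms[of j] assms[of "n + j"] by (simp add: abs_le_iff)
qed simp

text \<open>The iterated average is a mean of \<open>m\<close> shifted sums. A shift by
  \<open>j < m\<close> drops \<open>j\<close> terms and gains \<open>j\<close> others, all in the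
  unit interval, so each shifted sum differs from the original one by at most
  \<open>m\<close>.\<close>

lemma avg_avg:
  assumes f: "\<And>x. 0 \<le> f x" "\<And>x. f x \<le> 1" and n: "0 < n" "0 < m"
  shows "\<bar>avg n (avg m f) x - avg n f x\<bar> \<le> m / n"
proof -
  define a where "a k = f ((T ^^ k) x)" for k
  have "(T ^^ (i + j)) x = (T ^^ j) ((T ^^ i) x)" for i j
    by (metis add.commute comp_apply funpow_add)
  then have "avg n (avg m f) x = (\<Sum>i<n. (\<Sum>j<m. a (i + j)) / m) / n"
    unfolding avg_def a_def by simp
  also have "\<dots> = (\<Sum>j<m. (\<Sum>i<n. a (i + j))) / (m * n)"
    by (subst sum.swap) (simp add: sum_divide_distrib)
  finally have 1: "avg n (avg m f) x = (\<Sum>j<m. (\<Sum>i<n. a (i + j))) / (m * n)" .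
  have 2: "avg n f x = (\<Sum>j<m. (\<Sum>i<n. a i)) / (m * n)"
    using n unfolding avg_def a_def by simp
  have "\<bar>(\<Sum>j<m. (\<Sum>i<n. a (i + j))) - (\<Sum>j<m. (\<Sum>i<n. a i))\<bar> \<le> (\<Sum>j<m. real m)"
  proof -
    have "\<bar>(\<Sum>i<n. a (i + j)) - (\<Sum>i<n. a i)\<bar> \<le> real m" if "j \<in> {..<m}" for j
      using shifted_sum_diff[where a = a and n = n and j = j] f that by (simp add: a_def)
    then have "(\<Sum>j<m. \<bar>(\<Sum>i<n. a (i + j)) - (\<Sum>i<n. a i)\<bar>) \<le> (\<Sum>j<m. real m)"
      by (rule sum_mono)
    moreover have "\<bar>\<Sum>j<m. (\<Sum>i<n. a (i + j)) - (\<Sum>i<n. a i)\<bar>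
        \<le> (\<Sum>j<m. \<bar>(\<Sum>i<n. a (i + j)) - (\<Sum>i<n. a i)\<bar>)" by (rule sum_abs)
    ultimately show ?thesis
      using sum_subtractf[of "\<lambda>j. \<Sum>i<n. a (i + j)" "\<lambda>j. \<Sum>i<n. a i" "{..<m}"] by simp
  qed
  then have "\<bar>(\<Sum>j<m. (\<Sum>i<n. a (i + j))) - (\<Sum>j<m. (\<Sum>i<n. a i))\<bar> / (m * n) \<le> (m * m) / (m * n)"
    by (intro divide_right_mono) simp_all
  then show ?thesis unfolding 1 2 diff_divide_distrib[symmetric] abs_divide using n by simp
qed

lemma avg_square_le: "(avg n h x)\<^sup>2 \<le> avg n (\<lambda>x. (h x)\<^sup>2) x"
proof (cases "n = 0")
  case False
  have "(\<Sum>i<n. h ((T ^^ i) x) * 1)\<^sup>2 \<le> (\<Sum>i<n. (h ((T ^^ i) x))\<^sup>2) * (\<Sum>i<n. 1\<^sup>2)"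
    by (rule Cauchy_Schwarz_ineq_sum)
  then show ?thesis using False
    by (simp add: avg_def power_divide divide_simps power2_eq_square mult.commute)
qed (simp add: avg_def)

lemma integrable_bounded:
  fixes h :: "'a \<Rightarrow> real"
  assumes "h \<in> borel_measurable M" "\<And>x. \<bar>h x\<bar> \<le> C"
  shows "integrable M h"
  using assms by (intro integrable_const_bound[of h C]) auto

text \<open>Averaging contracts the L2 norm: Cauchy-Schwarz holds at every point, and the average of
  the squares has the same integral as the square by invariance.\<close>

lemma integral_avg_square_le:
  fixes h :: "'a \<Rightarrow> real"
  assumes h: "h \<in> borel_measurable M" "\<And>x. \<bar>h x\<bar> \<le> C" and n: "0 < n"
  shows "(\<integral>x. (avg n h x)\<^sup>2 \<partial>M) \<le> (\<integral>x. (h x)\<^sup>2 \<partial>M)"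
proof -
  have sq: "\<bar>(h x)\<^sup>2\<bar> \<le> C\<^sup>2" for x
    using h(2)[of x] by (simp add: abs_le_square_iff[symmetric])
  have int: "integrable M (\<lambda>x. (h x)\<^sup>2)"
    by (rule integrable_bounded[OF _ sq]) (use h in measurable)
  have "integrable M (\<lambda>x. (avg n h x)\<^sup>2)"
  proof (rule integrable_bounded)
    show "\<bar>(avg n h x)\<^sup>2\<bar> \<le> C\<^sup>2" for x
    proof -
      have "avg n (\<lambda>x. (h x)\<^sup>2) x \<le> C\<^sup>2"
        using sum_bounded_above[of "{..<n}" "\<lambda>i. (h ((T ^^ i) x))\<^sup>2" "C\<^sup>2"] sq n
        by (simp add: avg_def divide_simps mult.commute)
      then show ?thesis using avg_square_le[of n h x] by simp
    qed
  qed (use h in measurable)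
  then have "(\<integral>x. (avg n h x)\<^sup>2 \<partial>M) \<le> (\<integral>x. avg n (\<lambda>x. (h x)\<^sup>2) x \<partial>M)"
    using integral_avg(2)[OF int n] by (intro integral_mono avg_square_le)
  then show ?thesis using integral_avg(1)[OF int n] by simp
qed

lemma square_diff_le:
  fixes a b :: real
  assumes "0 \<le> a" "a \<le> 1" "0 \<le> b" "b \<le> 1" "\<bar>a - b\<bar> \<le> d"
  shows "b\<^sup>2 \<le> a\<^sup>2 + 2 * d"
proof -
  have "b\<^sup>2 - a\<^sup>2 = (b - a) * (b + a)" by (simp add: power2_eq_square algebra_simps)
  also have "\<dots> \<le> \<bar>b - a\<bar> * 2" using assms by (simp add: abs_mult order_trans[OF abs_ge_self] mult_mono)
  also have "\<dots> \<le> 2 * d" using assms by (simp add: abs_minus_commute)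
  finally show ?thesis by simp
qed

lemma integral_square_le_near:
  fixes h k :: "'a \<Rightarrow> real"
  assumes [measurable]: "h \<in> borel_measurable M" "k \<in> borel_measurable M"
    and "\<And>x. 0 \<le> h x" "\<And>x. h x \<le> 1" "\<And>x. 0 \<le> k x" "\<And>x. k x \<le> 1" "\<And>x. \<bar>h x - k x\<bar> \<le> d"
  shows "(\<integral>x. (k x)\<^sup>2 \<partial>M) \<le> (\<integral>x. (h x)\<^sup>2 \<partial>M) + 2 * d"
proof -
  have int: "integrable M (\<lambda>x. (h x)\<^sup>2)" "integrable M (\<lambda>x. (k x)\<^sup>2)"
    by (rule integrable_bounded[where C = 1]; use assms in \<open>simp add: abs_square_le_1\<close>)+
  then have "(\<integral>x. (k x)\<^sup>2 \<partial>M) \<le> (\<integral>x. (h x)\<^sup>2 + 2 * d \<partial>M)"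
    using assms by (intro integral_mono square_diff_le) auto
  then show ?thesis using int by (simp add: prob_space)
qed

text \<open>Riesz's argument: averaging does not increase the norm and changes another average
  only slightly, so averages of almost minimal norm are close to each other by the
  parallelogram law.\<close>

lemma avg_near_minimal:
  assumes [measurable]: "f \<in> borel_measurable M" and f: "\<And>x. 0 \<le> f x" "\<And>x. f x \<le> 1"
    and "0 < p" "0 < q" and c: "\<And>n. 0 < n \<Longrightarrow> c \<le> (\<integral>x. (avg n f x)\<^sup>2 \<partial>M)"
  shows "(\<integral>x. (avg p f x - avg q f x)\<^sup>2 \<partial>M)
    \<le> 2 * ((\<integral>x. (avg p f x)\<^sup>2 \<partial>M) - c) + 2 * ((\<integral>x. (avg q f x)\<^sup>2 \<partial>M) - c)"
proof -
  \<comment> \<open>The midpoint \<open>h\<close> is not itself an average of \<open>f\<close>, but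
    its long averages are close to those of \<open>f\<close> and have no larger norm than
    \<open>h\<close>. So the squared norm of \<open>h\<close> is at least \<open>c\<close> too,
    which is what the parallelogram law requires.\<close>
  define h where "h x = (avg p f x + avg q f x) / 2" for x
  have h: "h \<in> borel_measurable M" "0 \<le> h x" "h x \<le> 1" for x
    unfolding h_def[abs_def] using avg_bounds[where f = f, OF f]
      add_mono[of "avg p f x" 1 "avg q f x" 1] by auto
  have near: "\<bar>avg n h x - avg n f x\<bar> \<le> (p + q) / n" if "0 < n" for n :: nat and x
  proof -
    have "avg n h x = (avg n (avg p f) x + avg n (avg q f) x) / 2"
      by (simp add: h_def avg_def[of n] sum.distrib sum_divide_distrib[symmetric] add_divide_distrib)
    moreover have "\<bar>avg n (avg p f) x - avg n f x\<bar> \<le> p / n" "\<bar>avg n (avg q f) x - avg n f x\<bar> \<le> q / n"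
      using avg_avg[where f = f, OF f that] assms by auto
    moreover have "0 \<le> real p / n" "0 \<le> real q / n" by auto
    ultimately show ?thesis by (simp add: add_divide_distrib abs_le_iff)
  qed
  have "c \<le> (\<integral>x. (h x)\<^sup>2 \<partial>M) + 2 * ((p + q) / n)" if "0 < n" for n :: nat
  proof -
    have "c \<le> (\<integral>x. (avg n f x)\<^sup>2 \<partial>M)" using c that .
    also have "\<dots> \<le> (\<integral>x. (avg n h x)\<^sup>2 \<partial>M) + 2 * ((p + q) / n)"
      by (rule integral_square_le_near) (use avg_bounds f h near[OF that] in auto)
    also have "(\<integral>x. (avg n h x)\<^sup>2 \<partial>M) \<le> (\<integral>x. (h x)\<^sup>2 \<partial>M)"
      by (rule integral_avg_square_le[where C = 1]) (use h that in \<open>auto simp: abs_le_iff intro: order_trans[of _ 0]\<close>)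
    finally show ?thesis by simp
  qed
  moreover have "(\<lambda>n. (\<integral>x. (h x)\<^sup>2 \<partial>M) + 2 * ((p + q) / real n)) \<longlonglongrightarrow> (\<integral>x. (h x)\<^sup>2 \<partial>M) + 2 * 0"
    by (intro tendsto_intros lim_const_over_n)
  ultimately have "c \<le> (\<integral>x. (h x)\<^sup>2 \<partial>M) + 2 * 0"
    by (intro LIMSEQ_le_const[OF _ exI[of _ 1]]) auto
  moreover have int: "integrable M (\<lambda>x. (avg p f x)\<^sup>2)" "integrable M (\<lambda>x. (avg q f x)\<^sup>2)"
      "integrable M (\<lambda>x. (h x)\<^sup>2)"
    by (rule integrable_bounded[where C = 1]; use avg_bounds[where f = f, OF f] h in \<open>simp add: abs_square_le_1\<close>)+
  moreover have "(avg p f x - avg q f x)\<^sup>2 = 2 * (avg p f x)\<^sup>2 + 2 * (avg q f x)\<^sup>2 - 4 * (h x)\<^sup>2" for x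
    by (simp add: h_def power2_eq_square field_simps)
  ultimately show ?thesis by simp
qed

text \<open>The lengths of near-minimal averages can be taken arbitrarily large: averaging a
  near-minimal \<open>avg m f\<close> over a much longer range does not increase its norm and gives
  nearly \<open>avg n f\<close>. The bound \<open>4 * m / e < n\<close> makes the error
  \<open>2 * (m / n)\<close> less than \<open>e / 2\<close>.\<close>

lemma avg_minimizing:
  assumes [measurable]: "f \<in> borel_measurable M" and f: "\<And>x. 0 \<le> f x" "\<And>x. f x \<le> 1"
  obtains c where "\<And>n. 0 < n \<Longrightarrow> c \<le> (\<integral>x. (avg n f x)\<^sup>2 \<partial>M)"
    "\<And>N e. 0 < e \<Longrightarrow> \<exists>n>N. (\<integral>x. (avg n f x)\<^sup>2 \<partial>M) < c + e"
proof -
  define a where "a n = (\<integral>x. (avg n f x)\<^sup>2 \<partial>M)" for n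
  define c where "c = (INF n\<in>{0<..}. a n)"
  have bdd: "bdd_below (a ` {0<..})" by (rule bdd_belowI[of _ 0]) (auto simp: a_def)
  have 1: "c \<le> a n" if "0 < n" for n
    unfolding c_def using that by (intro cINF_lower bdd) auto
  have 2: "\<exists>n>N. a n < c + e" if "0 < e" for N :: nat and e
  proof -
    have "\<exists>m\<in>{0<..}. a m < c + e / 2"
      using cINF_less_iff[OF _ bdd, of "c + e / 2"] that unfolding c_def by auto
    then obtain m where m: "0 < m" "a m < c + e / 2" by auto
    obtain n where n: "N < n" "4 * m / e < n"
      using reals_Archimedean2[of "max N (4 * m / e)"] by auto
    then have "0 < n" by simp
    have "a n \<le> (\<integral>x. (avg n (avg m f) x)\<^sup>2 \<partial>M) + 2 * (m / n)"
      unfolding a_def by (rule integral_square_le_near)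
        (use avg_bounds f avg_avg[where f = f, OF f \<open>0 < n\<close> m(1)] in auto)
    also have "(\<integral>x. (avg n (avg m f) x)\<^sup>2 \<partial>M) \<le> a m"
      unfolding a_def by (rule integral_avg_square_le[where C = 1])
        (use avg_bounds[where f = f, OF f] \<open>0 < n\<close> in \<open>auto simp: abs_le_iff intro: order_trans[of _ 0]\<close>)
    also have "2 * (m / n) < e / 2" using n that \<open>0 < n\<close> by (simp add: field_simps)
    finally show ?thesis using m n by (intro exI[of _ n]) auto
  qed
  from that[of c] 1 2 show ?thesis unfolding a_def by blast
qed

text \<open>Cauchy-Schwarz against the constant 1, in the form
  \<open>2 * d * \<bar>g x\<bar> \<le> (g x)\<^sup>2 + d\<^sup>2\<close>.\<close>

lemma integral_abs_le_sqrt: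
  fixes g :: "'a \<Rightarrow> real"
  assumes [measurable]: "g \<in> borel_measurable M" and "\<And>x. \<bar>g x\<bar> \<le> 1" and "(\<integral>x. (g x)\<^sup>2 \<partial>M) \<le> d\<^sup>2" "0 < d"
  shows "(\<integral>x. \<bar>g x\<bar> \<partial>M) \<le> d"
proof -
  have int: "integrable M (\<lambda>x. (g x)\<^sup>2)" "integrable M (\<lambda>x. \<bar>g x\<bar>)"
    by (rule integrable_bounded[where C = 1]; use assms in \<open>simp add: abs_square_le_1\<close>)+
  have "2 * d * \<bar>g x\<bar> \<le> (g x)\<^sup>2 + d\<^sup>2" for x
    using sum_squares_bound[of "\<bar>g x\<bar>" d] by (simp add: mult.commute mult.left_commute)
  then have "(\<integral>x. 2 * d * \<bar>g x\<bar> \<partial>M) \<le> (\<integral>x. (g x)\<^sup>2 + d\<^sup>2 \<partial>M)"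
    using int by (intro integral_mono) auto
  then have "2 * d * (\<integral>x. \<bar>g x\<bar> \<partial>M) \<le> 2 * d * d"
    using int assms(3) by (simp add: prob_space power2_eq_square)
  then show ?thesis using \<open>0 < d\<close> by simp
qed

lemma avg_invariant: "\<bar>avg n f (T x) - avg n f x\<bar> \<le> 1 / n"
  if f: "\<And>x. 0 \<le> f x" "\<And>x. f x \<le> 1"
proof -
  have "\<bar>(\<Sum>i<n. f ((T ^^ (i + 1)) x)) - (\<Sum>i<n. f ((T ^^ i) x))\<bar> \<le> 1"
    using shifted_sum_diff[where a = "\<lambda>i. f ((T ^^ i) x)" and n = n and j = 1] f by simp
  then show ?thesis
    by (simp add: avg_def diff_divide_distrib[symmetric] funpow_swap1 divide_right_mono)
qed

text \<open>Later only one average with second moment close to the squared mean is used, so it is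
  enough that a subsequence of the averages converges almost everywhere to the mean.\<close>

theorem mean_ergodic:
  assumes [measurable]: "f \<in> borel_measurable M" and f: "\<And>x. 0 \<le> f x" "\<And>x. f x \<le> 1"
    and e: "0 < e"
  shows "\<exists>n>0. (\<integral>x. (avg n f x)\<^sup>2 \<partial>M) < (\<integral>x. f x \<partial>M)\<^sup>2 + e"
proof -
  obtain c where c: "\<And>n. 0 < n \<Longrightarrow> c \<le> (\<integral>x. (avg n f x)\<^sup>2 \<partial>M)"
    and c_inf: "\<And>N e. 0 < e \<Longrightarrow> \<exists>n>N. (\<integral>x. (avg n f x)\<^sup>2 \<partial>M) < c + e"
    using avg_minimizing[OF assms(1) f] by blast
  \<comment> \<open>The tolerance makes consecutive averages of the subsequence differ by at most
    \<open>(1/2) ^ k\<close> in L2, hence in L1, so the differences are summable. The condition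
    \<open>k < p k\<close> lets the lengths tend to infinity, which makes the limit
    invariant.\<close>
  have "\<exists>p. \<forall>k. k < p k \<and> (\<integral>x. (avg (p k) f x)\<^sup>2 \<partial>M) < c + ((1/2) ^ k)\<^sup>2 / 4"
    by (rule choice) (simp add: c_inf)
  then obtain p where p: "\<And>k. k < p k" "\<And>k. (\<integral>x. (avg (p k) f x)\<^sup>2 \<partial>M) < c + ((1/2) ^ k)\<^sup>2 / 4"
    by blast
  define F where "F k = avg (p k) f" for k
  have [measurable]: "F k \<in> borel_measurable M" for k unfolding F_def by measurable
  have F: "0 \<le> F k x" "F k x \<le> 1" for k x using avg_bounds[where f = f, OF f] by (simp_all add: F_def)
  have Fdiff: "\<bar>F (Suc k) x - F k x\<bar> \<le> 1" for k x
    using F[of k x] F[of "Suc k" x] by (simp add: abs_le_iff)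
  have L1: "(\<integral>x. \<bar>F (Suc k) x - F k x\<bar> \<partial>M) \<le> (1/2) ^ k" for k
  proof (rule integral_abs_le_sqrt)
    have "(\<integral>x. (F (Suc k) x - F k x)\<^sup>2 \<partial>M) \<le> 2 * (((1/2) ^ Suc k)\<^sup>2 / 4) + 2 * (((1/2) ^ k)\<^sup>2 / 4)"
      using avg_near_minimal[OF assms(1) f, of "p (Suc k)" "p k" c] c p(1)[of k] p(1)[of "Suc k"]
        p(2)[of k] p(2)[of "Suc k"] unfolding F_def by simp
    also have "\<dots> \<le> ((1/2) ^ k)\<^sup>2" by (simp add: power_mult_distrib power2_eq_square field_simps)
    finally show "(\<integral>x. (F (Suc k) x - F k x)\<^sup>2 \<partial>M) \<le> ((1/2) ^ k)\<^sup>2" .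
  qed (use Fdiff in auto)
  have "(\<integral>\<^sup>+x. (\<Sum>k. ennreal \<bar>F (Suc k) x - F k x\<bar>) \<partial>M) = (\<Sum>k. \<integral>\<^sup>+x. ennreal \<bar>F (Suc k) x - F k x\<bar> \<partial>M)"
    by (rule nn_integral_suminf) measurable
  also have "\<dots> = (\<Sum>k. ennreal (\<integral>x. \<bar>F (Suc k) x - F k x\<bar> \<partial>M))"
    by (intro suminf_cong nn_integral_eq_integral integrable_bounded[where C = 1]) (use Fdiff in auto)
  also have "\<dots> \<le> (\<Sum>k. ennreal ((1/2) ^ k))"
    by (intro suminf_le ennreal_leI L1) auto
  also have "\<dots> = ennreal (\<Sum>k. (1/2) ^ k)"
    by (intro suminf_ennreal2 summable_geometric) auto
  also have "\<dots> < \<infinity>" by simp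
  finally have "AE x in M. (\<Sum>k. ennreal \<bar>F (Suc k) x - F k x\<bar>) \<noteq> \<infinity>"
    by (intro nn_integral_noteq_infinite) auto
  then have conv: "AE x in M. convergent (\<lambda>k. F k x)"
  proof eventually_elim
    case (elim x)
    then have "summable (\<lambda>k. \<bar>F (Suc k) x - F k x\<bar>)" by (intro summable_suminf_not_top) auto
    then have "summable (\<lambda>k. F (Suc k) x - F k x)" by (rule summable_rabs_cancel)
    then have "convergent (\<lambda>n. \<Sum>k<n. F (Suc k) x - F k x)" by (simp add: summable_iff_convergent)
    then have "convergent (\<lambda>n. (F n x - F 0 x) + F 0 x)"
      by (intro convergent_add convergent_const) (simp add: sum_lessThan_telescope[of "\<lambda>k. F k x"])
    then show ?case by simp
  qed
  define L where "L x = lim (\<lambda>k. F k x)" for x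
  have [measurable]: "L \<in> borel_measurable M" unfolding L_def[abs_def] by measurable
  have L_lim: "AE x in M. (\<lambda>k. F k x) \<longlonglongrightarrow> L x"
    using conv by eventually_elim (simp add: L_def convergent_LIMSEQ_iff)
  have L_bounds: "AE x in M. 0 \<le> L x \<and> L x \<le> 1"
    using L_lim
  proof eventually_elim
    case (elim x)
    then show ?case using LIMSEQ_le_const[OF elim, of 0] LIMSEQ_le_const2[OF elim, of 1] F by blast
  qed
  have "(\<lambda>k. F k (T x) - F k x) \<longlonglongrightarrow> 0" for x
  proof (rule Lim_null_comparison[OF always_eventually])
    show "\<forall>k. norm (F k (T x) - F k x) \<le> 1 / real (Suc k)"
    proof
      fix k
      have "\<bar>F k (T x) - F k x\<bar> \<le> 1 / p k" unfolding F_def by (rule avg_invariant[where f = f, OF f])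
      also have "\<dots> \<le> 1 / Suc k" using p(1)[of k] by (intro divide_left_mono) (auto simp: Suc_le_eq)
      finally show "norm (F k (T x) - F k x) \<le> 1 / real (Suc k)" by simp
    qed
    show "(\<lambda>k. 1 / real (Suc k)) \<longlonglongrightarrow> 0" by (rule LIMSEQ_Suc[OF lim_1_over_n])
  qed
  then have "(\<lambda>k. F k (T x)) \<longlonglongrightarrow> l \<longleftrightarrow> (\<lambda>k. F k x) \<longlonglongrightarrow> l" for x l
    by (rule Lim_transform_eq)
  \<comment> \<open>This holds at every point, also where the averages diverge, because
    \<open>lim\<close> is determined by the set of limits, and that set is the same at
    \<open>x\<close> and \<open>T x\<close>. So the superlevel sets of \<open>L\<close> are strictly
    invariant.\<close>
  then have L_T: "L (T x) = L x" for x by (simp add: L_def lim_def)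
  have int_L: "integrable M L" by (rule integrable_const_bound[of L 1]) (use L_bounds in auto)
  have T_space: "T x \<in> space M" if "x \<in> space M" for x
    using ergodic that by (auto simp: ergodic_def dest: measurable_space)
  \<comment> \<open>One superlevel set is enough. If \<open>a < L\<close> held almost everywhere,
    the mean of \<open>L\<close> would exceed \<open>a\<close>; hence \<open>L \<le> a\<close>
    almost everywhere, and equality of the integrals forces \<open>L = a\<close>.\<close>
  define a where "a = (\<integral>x. L x \<partial>M)"
  have "T -` {x \<in> space M. a < L x} \<inter> space M = {x \<in> space M. a < L x}"
    using L_T T_space by auto
  moreover have "{x \<in> space M. a < L x} \<in> sets M" by measurable
  moreover have "emeasure M B = 0 \<or> emeasure M B = 1"
    if "T -` B \<inter> space M = B" "B \<in> sets M" for B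
  proof -
    have "sym_diff (T -` B \<inter> space M) B \<in> null_sets M" using that by simp
    then show ?thesis using ergodic that(2) unfolding ergodic_def by blast
  qed
  ultimately have "emeasure M {x \<in> space M. a < L x} = 0 \<or> emeasure M {x \<in> space M. a < L x} = 1"
    by blast
  then have "AE x in M. L x \<le> a"
  proof
    assume "emeasure M {x \<in> space M. a < L x} = 0"
    then show ?thesis by (subst AE_iff_measurable[OF _ refl]) (auto simp: not_le)
  next
    assume "emeasure M {x \<in> space M. a < L x} = 1"
    then have "AE x in M. a < L x" by (subst AE_iff_emeasure_eq_1) auto
    then have "(\<integral>x. a \<partial>M) < (\<integral>x. L x \<partial>M)"
      by (intro integral_less_AE_space) (auto simp: int_L emeasure_space_1)
    then show ?thesis by (simp add: a_def prob_space)
  qed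
  moreover have "(\<integral>x. a - L x \<partial>M) = 0" using int_L by (simp add: a_def prob_space)
  ultimately have "AE x in M. a - L x = 0"
    using integral_nonneg_eq_0_iff_AE[of M "\<lambda>x. a - L x"] int_L by simp
  then have F_a: "AE x in M. (\<lambda>k. F k x) \<longlonglongrightarrow> a" using L_lim by eventually_elim simp
  have "(\<lambda>k. \<integral>x. F k x \<partial>M) \<longlonglongrightarrow> (\<integral>x. a \<partial>M)"
    by (rule integral_dominated_convergence[where w = "\<lambda>_. 1"]) (use F_a F in \<open>auto simp: abs_le_iff intro: order_trans[of _ 0]\<close>)
  moreover have "(\<integral>x. F k x \<partial>M) = (\<integral>x. f x \<partial>M)" for k
    unfolding F_def using p(1)[of k] f
    by (intro integral_avg integrable_bounded[where C = 1]) (auto simp: abs_le_iff intro: order_trans[of _ 0])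
  ultimately have a: "a = (\<integral>x. f x \<partial>M)" by (simp add: LIMSEQ_const_iff prob_space)
  have "AE x in M. (\<lambda>k. (F k x)\<^sup>2) \<longlonglongrightarrow> a\<^sup>2" using F_a by eventually_elim (rule tendsto_power)
  then have "(\<lambda>k. \<integral>x. (F k x)\<^sup>2 \<partial>M) \<longlonglongrightarrow> (\<integral>x. a\<^sup>2 \<partial>M)"
    by (rule_tac integral_dominated_convergence[where w = "\<lambda>_. 1"]) (use F in \<open>auto simp: abs_square_le_1 abs_le_iff intro: order_trans[of _ 0]\<close>)
  then have "(\<lambda>k. \<integral>x. (F k x)\<^sup>2 \<partial>M) \<longlonglongrightarrow> a\<^sup>2" by (simp add: prob_space)
  then have "eventually (\<lambda>k. (\<integral>x. (F k x)\<^sup>2 \<partial>M) < a\<^sup>2 + e) sequentially"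
    by (rule order_tendstoD) (use e in simp)
  then obtain k where "(\<integral>x. (F k x)\<^sup>2 \<partial>M) < a\<^sup>2 + e" by (auto simp: eventually_sequentially)
  then show ?thesis using p(1)[of k] unfolding F_def a by (intro exI[of _ "p k"]) auto
qed

end

section \<open>Orbits avoid effectively open sets of measure less than one\<close>

lemma computable_prod_decode: "computable_in B f \<Longrightarrow> computable_in B (\<lambda>x. prod_decode (f x))"
  using computable_encI[of B "\<lambda>x. prod_decode (f x)"] by simp

text \<open>\<open>computable_g\<close> is required for every oracle because the results are applied
  relative to the coordinates already treated.\<close>

locale computable_ergodic =
  fixes T :: "bitseq \<Rightarrow> bitseq" and g :: "bool list \<Rightarrow> bool list"
  assumes ergodic_T: "ergodic uniform T" and approx: "approximates g T"
    and computable_g: "\<And>B. computable_in B g"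
begin

sublocale ergodic_system uniform T
  by (rule ergodic_system.intro[OF prob_space_uniform]) (simp add: ergodic_system_axioms_def ergodic_T)

lemma approx_funpow: "approximates (g ^^ i) (T ^^ i)"
  by (rule approximates_funpow[OF approx])

lemma computable_approx_funpow [computable]:
  "computable_in B n \<Longrightarrow> computable_in B u \<Longrightarrow> computable_in B (\<lambda>x. (g ^^ n x) (u x))"
  by (rule computable_funpow[OF computable_g])

section \<open>Visit counts of a cylinder and a computable waiting time\<close>

definition visits :: "nat \<Rightarrow> bool list \<Rightarrow> bitseq \<Rightarrow> real" where
  "visits n v \<omega> = (\<Sum>i<n. indicator (cylinder v) ((T ^^ i) \<omega>))"

lemma visits_measurable [measurable]: "visits n v \<in> borel_measurable uniform"
  unfolding visits_def[abs_def] by (intro borel_measurable_sum measurable_compose[OF measurable_funpow]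
      borel_measurable_indicator sets_cylinder)

lemma visits_bounds: "0 \<le> visits n v \<omega>" "visits n v \<omega> \<le> n"
  using sum_bounded_above[of "{..<n}" "\<lambda>i. indicator (cylinder v) ((T ^^ i) \<omega>) :: real" 1]
  by (auto simp: visits_def sum_nonneg indicator_def)

lemma integrable_visits_square: "integrable uniform (\<lambda>\<omega>. (visits n v \<omega>)\<^sup>2)"
  by (rule integrable_bounded[where C = "(real n)\<^sup>2"]) (use visits_bounds in \<open>auto intro: power_mono\<close>)

text \<open>An upper approximation to the number of visits: it counts the times at which a visit is
  not excluded by the known bits.\<close>

definition possible_visits :: "nat \<Rightarrow> bool list \<Rightarrow> bool list \<Rightarrow> nat" where
  "possible_visits n v u =
    (\<Sum>i<n. of_bool (take (length ((g ^^ i) u)) v = take (length v) ((g ^^ i) u)))"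

lemma visits_le_possible: "visits n v \<omega> \<le> possible_visits n v (seg \<omega> s)"
  unfolding visits_def possible_visits_def of_nat_sum
proof (rule sum_mono)
  fix i
  let ?w = "(g ^^ i) (seg \<omega> s)"
  have w: "?w = seg ((T ^^ i) \<omega>) (length ?w)" by (rule approximates_seg[OF approx_funpow])
  have "take (length ?w) v = take (length v) ?w" if "(T ^^ i) \<omega> \<in> cylinder v"
  proof -
    have "v = seg ((T ^^ i) \<omega>) (length v)" using that by (simp add: in_cylinder_iff)
    then show ?thesis using w by (metis min.commute take_seg)
  qed
  then show "indicator (cylinder v) ((T ^^ i) \<omega>)
      \<le> real (of_bool (take (length ?w) v = take (length v) ?w))"
    by (auto simp: indicator_def)
qed

lemma possible_visits_tendsto: "(\<lambda>s. real (possible_visits n v (seg \<omega> s))) \<longlonglongrightarrow> visits n v \<omega>"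
  unfolding visits_def possible_visits_def of_nat_sum
proof (rule tendsto_sum, rule tendsto_eventually)
  fix i
  obtain s where s: "\<forall>t\<ge>s. length v \<le> length ((g ^^ i) (seg \<omega> t))"
    using approximates_length[OF approx_funpow] by blast
  show "eventually (\<lambda>s. real (of_bool (take (length ((g ^^ i) (seg \<omega> s))) v
      = take (length v) ((g ^^ i) (seg \<omega> s)))) = indicator (cylinder v) ((T ^^ i) \<omega>)) sequentially"
  proof (rule eventually_sequentiallyI)
    fix t assume "s \<le> t"
    let ?w = "(g ^^ i) (seg \<omega> t)"
    have len: "length v \<le> length ?w" using s \<open>s \<le> t\<close> by blast
    have "take (length v) ?w = seg ((T ^^ i) \<omega>) (length v)"
      using approximates_seg[OF approx_funpow, of i \<omega> t] take_seg len by (metis min.absorb1)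
    then show "real (of_bool (take (length ?w) v = take (length v) ?w))
        = indicator (cylinder v) ((T ^^ i) \<omega>)"
      using len by (auto simp: in_cylinder_iff indicator_def)
  qed
qed

text \<open>The second moment of the upper approximation is at most \<open>a / b\<close> times the
  square of the mean number of visits. Denominators are cleared so that this is a decidable
  statement about natural numbers.\<close>

definition enough :: "nat \<Rightarrow> nat \<Rightarrow> bool list \<Rightarrow> nat \<Rightarrow> nat \<Rightarrow> bool" where
  "enough a b v n s \<longleftrightarrow> 0 < n \<and>
    b * 4 ^ length v * (\<Sum>u | length u = s. (possible_visits n v u)\<^sup>2) \<le> a * n\<^sup>2 * 2 ^ s"

lemma integral_possible_visits:
  "(\<integral>\<omega>. (real (possible_visits n v (seg \<omega> s)))\<^sup>2 \<partial>uniform)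
    = real (\<Sum>u | length u = s. (possible_visits n v u)\<^sup>2) / 2 ^ s"
  by (simp add: integral_seg(2)[of "\<lambda>u. (real (possible_visits n v u))\<^sup>2"])

lemma enough_iff:
  assumes "0 < b"
  shows "enough a b v n s \<longleftrightarrow> 0 < n \<and>
    (\<integral>\<omega>. (real (possible_visits n v (seg \<omega> s)))\<^sup>2 \<partial>uniform)
      \<le> real a / real b * (real n * measure uniform (cylinder v))\<^sup>2"
proof -
  have "b * 4 ^ length v * (\<Sum>u | length u = s. (possible_visits n v u)\<^sup>2) \<le> a * n\<^sup>2 * 2 ^ s
    \<longleftrightarrow> real b * 4 ^ length v * real (\<Sum>u | length u = s. (possible_visits n v u)\<^sup>2)
      \<le> real a * (real n)\<^sup>2 * 2 ^ s"
    by (subst of_nat_le_iff[symmetric, where 'a = real]) simp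
  also have "\<dots> \<longleftrightarrow> real (\<Sum>u | length u = s. (possible_visits n v u)\<^sup>2) / 2 ^ s
      \<le> real a / real b * (real n * (1 / 2) ^ length v)\<^sup>2" (is "?l \<longleftrightarrow> ?r")
  proof -
    define p :: real where "p = 2 ^ length v"
    have "(4 :: real) ^ length v = p\<^sup>2" "(1 / 2 :: real) ^ length v = 1 / p" "0 < p"
      by (simp_all add: p_def power_divide power2_eq_square flip: power_mult_distrib)
    then show "?l \<longleftrightarrow> ?r" using assms by (simp add: field_simps power_mult_distrib power_divide)
  qed
  finally show ?thesis by (simp add: enough_def integral_possible_visits measure_cylinder)
qed

lemma enough_visits:
  assumes "enough a b v n s" "0 < b"
  shows "(\<integral>\<omega>. (visits n v \<omega>)\<^sup>2 \<partial>uniform) \<le> real a / real b * (real n * measure uniform (cylinder v))\<^sup>2"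
proof -
  have "(\<integral>\<omega>. (visits n v \<omega>)\<^sup>2 \<partial>uniform) \<le> (\<integral>\<omega>. (real (possible_visits n v (seg \<omega> s)))\<^sup>2 \<partial>uniform)"
    by (intro integral_mono integrable_visits_square integral_seg(1)[of "\<lambda>u. (real (possible_visits n v u))\<^sup>2"]
      power_mono visits_le_possible visits_bounds)
  then show ?thesis using assms enough_iff by simp
qed

text \<open>As \<open>a / b\<close> exceeds 1, \<open>mean_ergodic\<close> yields a length
  \<open>n\<close> with strict inequality for the true visit count. The strictness leaves room to
  replace the count by its approximation at a finite stage, by dominated convergence.\<close>

lemma enough_exists:
  assumes "0 < b" "b < a"
  shows "\<exists>n s. enough a b v n s"
proof -
  let ?m = "measure uniform (cylinder v)"
  have m: "0 < ?m" by (simp add: measure_cylinder)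
  have "1 < real a / real b" using assms by simp
  then have "0 < (real a / real b - 1) * ?m\<^sup>2" using m by simp
  from mean_ergodic[of "indicator (cylinder v)", OF _ _ _ this]
  obtain n where n: "0 < n"
      "(\<integral>\<omega>. (avg n (indicator (cylinder v)) \<omega>)\<^sup>2 \<partial>uniform) < real a / real b * ?m\<^sup>2"
    by (auto simp: algebra_simps sets_cylinder)
  have "avg n (indicator (cylinder v)) \<omega> = visits n v \<omega> / n" for \<omega>
    by (simp add: avg_def visits_def)
  then have "(\<integral>\<omega>. (visits n v \<omega>)\<^sup>2 \<partial>uniform) / (real n)\<^sup>2 < real a / real b * ?m\<^sup>2"
    using n(2) by (simp add: power_divide)
  then have less: "(\<integral>\<omega>. (visits n v \<omega>)\<^sup>2 \<partial>uniform) < real a / real b * (real n * ?m)\<^sup>2"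
    using n(1) by (simp add: power_mult_distrib field_simps)
  have "(\<lambda>s. \<integral>\<omega>. (real (possible_visits n v (seg \<omega> s)))\<^sup>2 \<partial>uniform) \<longlonglongrightarrow> (\<integral>\<omega>. (visits n v \<omega>)\<^sup>2 \<partial>uniform)"
  proof (rule integral_dominated_convergence[where w = "\<lambda>_. (real n)\<^sup>2"])
    show "(\<lambda>\<omega>. (real (possible_visits n v (seg \<omega> s)))\<^sup>2) \<in> borel_measurable uniform" for s
      using integral_seg(1)[of "\<lambda>u. (real (possible_visits n v u))\<^sup>2" s] by simp
    show "AE \<omega> in uniform. (\<lambda>s. (real (possible_visits n v (seg \<omega> s)))\<^sup>2) \<longlonglongrightarrow> (visits n v \<omega>)\<^sup>2"
      by (intro AE_I2 tendsto_power possible_visits_tendsto)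
    have "possible_visits n v u \<le> n" for u
      using sum_bounded_above[of "{..<n}" "\<lambda>i. of_bool (take (length ((g ^^ i) u)) v = take (length v) ((g ^^ i) u))" "1 :: nat"]
      by (simp add: possible_visits_def)
    then show "AE \<omega> in uniform. norm ((real (possible_visits n v (seg \<omega> s)))\<^sup>2) \<le> (real n)\<^sup>2" for s
      by (simp add: power_mono)
  qed auto
  from order_tendstoD(2)[OF this less]
  obtain s where "(\<integral>\<omega>. (real (possible_visits n v (seg \<omega> s)))\<^sup>2 \<partial>uniform) < real a / real b * (real n * ?m)\<^sup>2"
    by (auto simp: eventually_sequentially)
  then have "enough a b v n s" using n(1) assms(1) by (simp add: enough_iff)
  then show ?thesis by blast
qed

lemma computable_enough [computable]:
  assumes "computable_in B v" "computable_in B n" "computable_in B s"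
  shows "computable_in B (\<lambda>x. enough a b (v x) (n x) (s x))"
  unfolding enough_def possible_visits_def
  by (intro computable assms computable_compose[OF assms(1)] computable_compose[OF assms(2)] computable_g)

text \<open>\<open>enough\<close> is decidable and holds for some pair \<open>(n, s)\<close>, so a
  search through all pairs halts. The result depends on the ratio \<open>a / b\<close> and the
  cylinder, but not on the open set to be left.\<close>

lemma computable_horizon:
  assumes "0 < b" "b < a"
  obtains N where "\<And>B. computable_in B N"
    "\<And>v. (\<integral>\<omega>. (visits (N v) v \<omega>)\<^sup>2 \<partial>uniform) \<le> real a / real b * (real (N v) * measure uniform (cylinder v))\<^sup>2"
    "\<And>v. 0 < N v"
proof
  define k where "k v = (LEAST k. enough a b v (fst (prod_decode k)) (snd (prod_decode k)))" for v
  have ex: "\<exists>k. enough a b v (fst (prod_decode k)) (snd (prod_decode k))" for v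
    using enough_exists[OF assms, of v] by (metis fst_conv snd_conv prod_encode_inverse)
  have E: "enough a b v (fst (prod_decode (k v))) (snd (prod_decode (k v)))" for v
    unfolding k_def by (rule LeastI_ex[OF ex])
  show "0 < fst (prod_decode (k v))" for v using E[of v] by (simp add: enough_def)
  show "(\<integral>\<omega>. (visits (fst (prod_decode (k v))) v \<omega>)\<^sup>2 \<partial>uniform)
      \<le> real a / real b * (real (fst (prod_decode (k v))) * measure uniform (cylinder v))\<^sup>2" for v
    by (rule enough_visits[OF E assms(1)])
  show "computable_in B (\<lambda>v. fst (prod_decode (k v)))" for B
    unfolding k_def by (intro computable computable_prod_decode ex)
qed

text \<open>Points of \<open>cylinder v\<close> whose first \<open>n\<close> iterates stay in
  \<open>A\<close> are counted once for each of the \<open>n\<close> times at which the cylinder may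
  be visited. This bounds \<open>n\<close> times their measure by the integral of the visit count
  over a copy of \<open>A\<close>, and Cauchy-Schwarz with the second moment bound gives
  \<open>n * \<rho> * measure uniform (cylinder v)\<close>.\<close>

lemma measure_stay_le:
  assumes A [measurable]: "A \<in> sets uniform" and "0 < n" "0 < \<kappa>" "0 < \<rho>" "\<kappa> * measure uniform A \<le> \<rho>\<^sup>2"
    and v: "(\<integral>\<omega>. (visits n v \<omega>)\<^sup>2 \<partial>uniform) \<le> \<kappa> * (real n * measure uniform (cylinder v))\<^sup>2"
  shows "measure uniform (cylinder v \<inter> {\<omega>. \<forall>i<n. (T ^^ i) \<omega> \<in> A}) \<le> \<rho> * measure uniform (cylinder v)"
proof -
  let ?m = "measure uniform (cylinder v)"
  let ?D = "cylinder v \<inter> {\<omega>. \<forall>i<n. (T ^^ i) \<omega> \<in> A}"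
  \<comment> \<open>The entry into \<open>A\<close> is always observed at time \<open>n - 1\<close>.
    If the cylinder is visited at time \<open>j\<close>, then \<open>n - 1 - j\<close> steps remain,
    fewer than \<open>n\<close>, so a staying point is still in \<open>A\<close> then. As
    \<open>A'\<close> does not depend on \<open>j\<close>, the \<open>n\<close> estimates can be
    summed.\<close>
  define A' where "A' = (T ^^ (n - 1)) -` A"
  have A' [measurable]: "A' \<in> sets uniform"
    unfolding A'_def using measurable_sets[OF measurable_funpow A] by simp
  have "measure uniform A' = measure uniform A"
    unfolding A'_def using distr_funpow[of "n - 1"] A
    by (metis (no_types, lifting) Int_UNIV_right measurable_funpow measure_distr space_uniform)
  note [measurable] = sets_cylinder
  have D: "measure uniform ?D \<le> (\<integral>\<omega>. indicator (cylinder v) ((T ^^ j) \<omega>) * indicator A' \<omega> \<partial>uniform)"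
    if "j < n" for j
  proof -
    define h where "h \<omega> = (indicator (cylinder v) \<omega> * indicator A ((T ^^ (n - 1 - j)) \<omega>) :: real)" for \<omega>
    have h: "h \<in> borel_measurable uniform"
      unfolding h_def[abs_def] by (intro borel_measurable_times borel_measurable_indicator sets_cylinder
        measurable_compose[OF measurable_funpow] A)
    have "(T ^^ (n - 1 - j)) ((T ^^ j) \<omega>) = (T ^^ (n - 1)) \<omega>" for \<omega>
      using that by (metis comp_apply funpow_add le_add_diff_inverse2 Suc_leI Suc_pred' less_Suc_eq_le gr_implies_not0 not_gr0 diff_Suc_1')
    then have "(\<integral>\<omega>. indicator (cylinder v) ((T ^^ j) \<omega>) * indicator A' \<omega> \<partial>uniform) = (\<integral>\<omega>. h ((T ^^ j) \<omega>) \<partial>uniform)"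
      by (simp add: h_def A'_def indicator_def)
    also have "\<dots> = (\<integral>\<omega>. h \<omega> \<partial>uniform)" by (rule integral_funpow[OF h])
    finally have eq: "(\<integral>\<omega>. indicator (cylinder v) ((T ^^ j) \<omega>) * indicator A' \<omega> \<partial>uniform) = (\<integral>\<omega>. h \<omega> \<partial>uniform)" .
    have "h = indicator (cylinder v \<inter> (T ^^ (n - 1 - j)) -` A)"
      by (auto simp: h_def indicator_def fun_eq_iff)
    then have "(\<integral>\<omega>. h \<omega> \<partial>uniform) = measure uniform (cylinder v \<inter> (T ^^ (n - 1 - j)) -` A)"
      by simp
    moreover have "measure uniform ?D \<le> measure uniform (cylinder v \<inter> (T ^^ (n - 1 - j)) -` A)"
    proof (rule uniform.finite_measure_mono)
      show "?D \<subseteq> cylinder v \<inter> (T ^^ (n - 1 - j)) -` A" using that by auto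
      show "cylinder v \<inter> (T ^^ (n - 1 - j)) -` A \<in> sets uniform"
        using measurable_sets[OF measurable_funpow A] sets_cylinder by auto
    qed
    ultimately show ?thesis using eq by simp
  qed
  have int: "integrable uniform (\<lambda>\<omega>. indicator (cylinder v) ((T ^^ j) \<omega>) * indicator A' \<omega> :: real)" for j
    by (rule integrable_bounded[where C = 1])
      (auto simp: indicator_def intro!: borel_measurable_times borel_measurable_indicator sets_cylinder
        measurable_compose[OF measurable_funpow] A')
  have "n * measure uniform ?D \<le> (\<Sum>j<n. \<integral>\<omega>. indicator (cylinder v) ((T ^^ j) \<omega>) * indicator A' \<omega> \<partial>uniform)"
    using sum_mono[of "{..<n}" "\<lambda>_. measure uniform ?D"] D by simp
  also have "\<dots> = (\<integral>\<omega>. visits n v \<omega> * indicator A' \<omega> \<partial>uniform)"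
    unfolding visits_def sum_distrib_right by (rule Bochner_Integration.integral_sum[symmetric, OF int])
  \<comment> \<open>Cauchy-Schwarz in the form
    \<open>x * y \<le> (t * x\<^sup>2 + y\<^sup>2 / t) / 2\<close>, with the indicator equal to its
    square and \<open>t\<close> to be chosen.\<close>
  also have "\<dots> \<le> (\<integral>\<omega>. (t * (visits n v \<omega>)\<^sup>2 + indicator A' \<omega> / t) / 2 \<partial>uniform)" if "0 < t" for t
  proof (rule integral_mono)
    have "visits n v \<omega> * i \<le> (t * (visits n v \<omega>)\<^sup>2 + i / t) / 2" if "i = 0 \<or> i = 1" for i \<omega>
    proof -
      have "0 \<le> (t * visits n v \<omega> - i)\<^sup>2" by simp
      then have "2 * t * visits n v \<omega> * i \<le> t * t * (visits n v \<omega>)\<^sup>2 + i"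
        using that by (auto simp: power2_eq_square algebra_simps)
      then show ?thesis using \<open>0 < t\<close> by (simp add: field_simps power2_eq_square)
    qed
    then show "visits n v \<omega> * indicator A' \<omega> \<le> (t * (visits n v \<omega>)\<^sup>2 + indicator A' \<omega> / t) / 2" for \<omega>
      by (simp add: indicator_def)
    show "integrable uniform (\<lambda>\<omega>. visits n v \<omega> * indicator A' \<omega>)"
      unfolding visits_def sum_distrib_right by (intro Bochner_Integration.integrable_sum int)
    show "integrable uniform (\<lambda>\<omega>. (t * (visits n v \<omega>)\<^sup>2 + indicator A' \<omega> / t) / 2)"
      using integrable_visits_square A' by (simp add: integrable_indicator_iff uniform.emeasure_eq_measure)
  qed
  finally have n_le: "n * measure uniform ?D \<le> (\<integral>\<omega>. (t * (visits n v \<omega>)\<^sup>2 + indicator A' \<omega> / t) / 2 \<partial>uniform)"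
    if "0 < t" for t using that by blast
  have m: "0 < ?m" by (simp add: measure_cylinder)
  \<comment> \<open>This value balances the two terms: after inserting the bounds, each of them
    equals \<open>n * \<rho> * ?m\<close>.\<close>
  define t where "t = \<rho> / (\<kappa> * n * ?m)"
  have t: "0 < t" unfolding t_def using assms m by simp
  have "(\<integral>\<omega>. (t * (visits n v \<omega>)\<^sup>2 + indicator A' \<omega> / t) / 2 \<partial>uniform)
      = (t * (\<integral>\<omega>. (visits n v \<omega>)\<^sup>2 \<partial>uniform) + measure uniform A / t) / 2"
    using integrable_visits_square A' \<open>measure uniform A' = measure uniform A\<close>
    by (simp add: integrable_indicator_iff uniform.emeasure_eq_measure)
  also have "\<dots> \<le> (t * (\<kappa> * (n * ?m)\<^sup>2) + (\<rho>\<^sup>2 / \<kappa>) / t) / 2"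
    using t v assms by (intro divide_right_mono add_mono mult_left_mono) (auto simp: field_simps)
  also have "\<dots> = n * (\<rho> * ?m)"
    unfolding t_def using assms m by (simp add: field_simps power2_eq_square)
  finally have "n * measure uniform ?D \<le> n * (\<rho> * ?m)" using n_le[OF t] by simp
  then show ?thesis using \<open>0 < n\<close> by simp
qed

end

section \<open>Levels: repeating the estimate inside smaller cylinders\<close>

lemma cylinder_antimono: "prefix u v \<Longrightarrow> cylinder v \<subseteq> cylinder u"
  by (auto simp: cylinder_def nth_append elim!: prefixE)

text \<open>The cover of the points whose orbits stay in \<open>open_of R\<close>: the level rises when, for the
  current marker \<open>v\<close>, the iterates up to time \<open>N v\<close> have all been seen to enter \<open>open_of R\<close>;
  the string read so far becomes the new marker.\<close>

definition stays ::
  "(bool list \<Rightarrow> bool list) \<Rightarrow> (bool list \<Rightarrow> bool) \<Rightarrow> (bool list \<Rightarrow> nat) \<Rightarrow> bool list \<Rightarrow> bool list \<Rightarrow> bool"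
  where "stays g R N v u \<longleftrightarrow> (\<forall>i<N v. R ((g ^^ i) u))"

definition climb_step ::
  "(bool list \<Rightarrow> bool list \<Rightarrow> bool) \<Rightarrow> nat \<times> bool list \<times> bool list \<Rightarrow> bool \<Rightarrow> nat \<times> bool list \<times> bool list"
  where "climb_step Q z b =
    (let u = snd (snd z) @ [b]
     in if Q (fst (snd z)) u then (Suc (fst z), u, u) else (fst z, fst (snd z), u))"

definition level :: "(bool list \<Rightarrow> bool list \<Rightarrow> bool) \<Rightarrow> bool list \<Rightarrow> nat" where
  "level Q u = fst (foldl (climb_step Q) (0, [], []) u)"

definition marker :: "(bool list \<Rightarrow> bool list \<Rightarrow> bool) \<Rightarrow> bool list \<Rightarrow> bool list" where
  "marker Q u = fst (snd (foldl (climb_step Q) (0, [], []) u))"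

lemma climb_read: "snd (snd (foldl (climb_step Q) (0, [], []) u)) = u"
  by (induction u rule: rev_induct) (simp_all add: climb_step_def Let_def)

lemma level_simps [simp]:
  "level Q [] = 0"
  "level Q (u @ [b]) = (if Q (marker Q u) (u @ [b]) then Suc (level Q u) else level Q u)"
  by (simp_all add: level_def marker_def climb_step_def Let_def climb_read)

lemma marker_simps [simp]:
  "marker Q [] = []"
  "marker Q (u @ [b]) = (if Q (marker Q u) (u @ [b]) then u @ [b] else marker Q u)"
  by (simp_all add: marker_def climb_step_def Let_def climb_read)

lemma level_mono: "level Q u \<le> level Q (u @ v)"
  by (induction v rule: rev_induct) (simp_all flip: append_assoc)

lemma marker_const: "level Q (u @ v) = level Q u \<Longrightarrow> marker Q (u @ v) = marker Q u"
proof (induction v rule: rev_induct)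
  case (snoc b v)
  have "level Q u \<le> level Q (u @ v)" by (rule level_mono)
  then show ?case using snoc by (auto simp flip: append_assoc split: if_splits)
qed simp

lemma prefix_marker: "prefix (marker Q u) u"
  by (induction u rule: rev_induct) auto

lemma marker_marker: "marker Q (marker Q u) = marker Q u" "level Q (marker Q u) = level Q u"
  by (induction u rule: rev_induct) auto

lemma upward_level: "upward (\<lambda>u. k \<le> level Q u)"
  unfolding upward_def using level_mono order_trans by blast

text \<open>These are the strings at which level \<open>k\<close> is first reached. They are
  prefix-free, so the set of level at least \<open>k\<close> splits into disjoint cylinders in which
  the estimate can be repeated.\<close>

definition markers :: "(bool list \<Rightarrow> bool list \<Rightarrow> bool) \<Rightarrow> nat \<Rightarrow> bool list set" where
  "markers Q k = {u. level Q u = k \<and> marker Q u = u}"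

lemma open_of_level: "open_of (\<lambda>u. k \<le> level Q u) = (\<Union>u\<in>markers Q k. cylinder u)"
proof -
  have "\<exists>t\<le>length u. take t u \<in> markers Q k" if "k \<le> level Q u" for u
    using that
  proof (induction u rule: rev_induct)
    case (snoc b u)
    show ?case
    proof (cases "k \<le> level Q u")
      case True
      then obtain t where "t \<le> length u" "take t u \<in> markers Q k" using snoc.IH by blast
      then show ?thesis by (intro exI[of _ t]) auto
    next
      case False
      then have "u @ [b] \<in> markers Q k" using snoc.prems by (auto simp: markers_def split: if_splits)
      then show ?thesis by (intro exI[of _ "length (u @ [b])"]) simp
    qed
  qed (simp add: markers_def)
  then have "\<exists>t. seg \<omega> t \<in> markers Q k" if "k \<le> level Q (seg \<omega> s)" for \<omega> s
    using that by (metis take_seg)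
  then have "open_of (\<lambda>u. k \<le> level Q u) \<subseteq> (\<Union>u\<in>markers Q k. cylinder u)"
    by (auto simp: open_of_def) (metis in_cylinder_seg)
  moreover have "(\<Union>u\<in>markers Q k. cylinder u) \<subseteq> open_of (\<lambda>u. k \<le> level Q u)"
    unfolding open_of_eq_cylinders by (auto simp: markers_def)
  ultimately show ?thesis by blast
qed

lemma disjoint_markers: "disjoint_family_on cylinder (markers Q k)"
proof (unfold disjoint_family_on_def, intro ballI impI)
  have *: "u = v" if uv: "u \<in> markers Q k" "v \<in> markers Q k" "prefix u v" for u v
  proof -
    obtain w where "v = u @ w" using uv(3) by (rule prefixE)
    then show ?thesis using uv marker_const[of Q u w] by (simp add: markers_def)
  qed
  fix u v assume uv: "u \<in> markers Q k" "v \<in> markers Q k" "u \<noteq> v"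
  show "cylinder u \<inter> cylinder v = {}"
  proof (rule ccontr)
    assume "cylinder u \<inter> cylinder v \<noteq> {}"
    then obtain \<omega> where "seg \<omega> (length u) = u" "seg \<omega> (length v) = v" by (auto simp: in_cylinder_iff)
    then have "prefix u v \<or> prefix v u" by (metis nle_le prefixI seg_append)
    then show False using * uv by blast
  qed
qed

text \<open>On its way to level \<open>Suc k\<close> a point passes a marker \<open>v\<close> of
  level \<open>k\<close>, and the next rise certifies that it lies in \<open>X v\<close>. Within
  each of the disjoint cylinders at level \<open>k\<close> only the fraction \<rho> can do
  so.\<close>

lemma measure_level_Suc:
  assumes stay: "\<And>v. measure uniform (cylinder v \<inter> X v) \<le> \<rho> * measure uniform (cylinder v)"
    and X: "\<And>v. X v \<in> sets uniform" "\<And>v u. Q v u \<Longrightarrow> cylinder u \<subseteq> X v" and "0 \<le> \<rho>"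
  shows "measure uniform (open_of (\<lambda>u. Suc k \<le> level Q u))
    \<le> \<rho> * measure uniform (open_of (\<lambda>u. k \<le> level Q u))"
proof -
  have "open_of (\<lambda>u. Suc k \<le> level Q u) \<subseteq> (\<Union>v\<in>markers Q k. cylinder v \<inter> X v)"
  proof
    fix \<omega> assume "\<omega> \<in> open_of (\<lambda>u. Suc k \<le> level Q u)"
    then obtain u where u: "u \<in> markers Q (Suc k)" "\<omega> \<in> cylinder u" by (auto simp: open_of_level)
    then obtain u' b where u': "u = u' @ [b]" by (cases u rule: rev_cases) (auto simp: markers_def)
    have "Q (marker Q u') u"
    proof (rule ccontr)
      assume "\<not> Q (marker Q u') u"
      then have "marker Q u' = u' @ [b]" using u by (simp add: markers_def u')
      then show False using prefix_length_le[OF prefix_marker[of Q u']] by simp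
    qed
    moreover from this have "marker Q u' \<in> markers Q k"
      using u by (simp add: markers_def u' marker_marker)
    moreover have "\<omega> \<in> cylinder (marker Q u')"
      using u(2) cylinder_antimono prefix_prefix[OF prefix_marker[of Q u']] u' by blast
    ultimately show "\<omega> \<in> (\<Union>v\<in>markers Q k. cylinder v \<inter> X v)" using X(2) u(2) by blast
  qed
  moreover have CX: "cylinder v \<inter> X v \<in> sets uniform" for v
    by (rule sets.Int[OF sets_cylinder X(1)])
  ultimately have "emeasure uniform (open_of (\<lambda>u. Suc k \<le> level Q u))
      \<le> emeasure uniform (\<Union>v\<in>markers Q k. cylinder v \<inter> X v)"
    by (intro emeasure_mono sets.countable_UN') auto
  also have "\<dots> = (\<integral>\<^sup>+v. emeasure uniform (cylinder v \<inter> X v) \<partial>count_space (markers Q k))"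
    by (rule emeasure_UN_countable)
      (use disjoint_markers[of Q k] CX in \<open>auto simp: disjoint_family_on_def\<close>)
  also have "\<dots> \<le> (\<integral>\<^sup>+v. ennreal \<rho> * emeasure uniform (cylinder v) \<partial>count_space (markers Q k))"
    by (rule nn_integral_mono)
      (use stay \<open>0 \<le> \<rho>\<close> in \<open>simp add: uniform.emeasure_eq_measure ennreal_leI flip: ennreal_mult\<close>)
  also have "\<dots> = ennreal \<rho> * (\<integral>\<^sup>+v. emeasure uniform (cylinder v) \<partial>count_space (markers Q k))"
    by (rule nn_integral_cmult) simp
  also have "(\<integral>\<^sup>+v. emeasure uniform (cylinder v) \<partial>count_space (markers Q k))
      = emeasure uniform (open_of (\<lambda>u. k \<le> level Q u))"
    unfolding open_of_level
    by (rule emeasure_UN_countable[symmetric]) (auto simp: disjoint_markers sets_cylinder)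
  finally show ?thesis
    using \<open>0 \<le> \<rho>\<close> by (simp add: uniform.emeasure_eq_measure flip: ennreal_mult)
qed

lemma measure_level_le:
  assumes "\<And>v. measure uniform (cylinder v \<inter> X v) \<le> \<rho> * measure uniform (cylinder v)"
    and "\<And>v. X v \<in> sets uniform" "\<And>v u. Q v u \<Longrightarrow> cylinder u \<subseteq> X v" and "0 \<le> \<rho>"
  shows "measure uniform (open_of (\<lambda>u. k \<le> level Q u)) \<le> \<rho> ^ k"
proof (induction k)
  case (Suc k)
  have "measure uniform (open_of (\<lambda>u. Suc k \<le> level Q u))
      \<le> \<rho> * measure uniform (open_of (\<lambda>u. k \<le> level Q u))"
    by (rule measure_level_Suc[OF assms])
  also have "\<dots> \<le> \<rho> * \<rho> ^ k" using Suc \<open>0 \<le> \<rho>\<close> by (rule mult_left_mono)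
  finally show ?case by simp
qed simp

text \<open>If the level stalled, the marker would stay at some fixed \<open>v\<close>, and the next
  test against \<open>v\<close> that succeeds would raise the level. The premise speaks of all large
  \<open>t\<close> because \<open>v\<close> may become the marker only late.\<close>

lemma level_unbounded:
  assumes "\<And>v. \<exists>s. \<forall>t\<ge>s. Q v (seg \<omega> t)"
  shows "\<omega> \<in> open_of (\<lambda>u. k \<le> level Q u)"
proof (induction k)
  case 0
  show ?case by (simp add: open_of_def)
next
  case (Suc k)
  show ?case
  proof (rule ccontr)
    assume "\<omega> \<notin> open_of (\<lambda>u. Suc k \<le> level Q u)"
    then have le: "level Q (seg \<omega> t) \<le> k" for t by (auto simp: open_of_def not_less_eq_eq)
    obtain s where s: "k \<le> level Q (seg \<omega> s)" using Suc by (auto simp: open_of_def)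
    have eq: "level Q (seg \<omega> t) = k" if "s \<le> t" for t
      using upward_seg[OF upward_level s that] le[of t] by simp
    define v where "v = marker Q (seg \<omega> s)"
    have v: "marker Q (seg \<omega> t) = v" if "s \<le> t" for t
      using seg_append[OF that, of \<omega>] marker_const[of Q "seg \<omega> s"] eq[OF that] eq[of s]
      by (auto simp: v_def)
    obtain r where r: "\<forall>t\<ge>r. Q v (seg \<omega> t)" using assms by blast
    have "Q v (seg \<omega> (Suc (max r s)))" using r by simp
    then have "level Q (seg \<omega> (Suc (max r s))) = Suc k"
      using v[of "max r s"] eq[of "max r s"] by (simp add: seg_Suc)
    then show False using le[of "Suc (max r s)"] by simp
  qed
qed

context computable_ergodic
begin

theorem orbit_leaves_open:
  assumes x: "passes_tests B x" and R: "upward R" "computable_in B R"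
    and less: "measure uniform (open_of R) < 1"
  shows "\<exists>n. (T ^^ n) x \<notin> open_of R"
proof (rule ccontr)
  assume "\<nexists>n. (T ^^ n) x \<notin> open_of R"
  then have orbit: "(T ^^ n) x \<in> open_of R" for n by blast
  define \<alpha> where "\<alpha> = measure uniform (open_of R)"
  \<comment> \<open>\<kappa> has to exceed 1 and be a ratio of natural numbers for
    \<open>computable_horizon\<close>, and to be so close to 1 that
    \<open>\<kappa> * \<alpha> < 1\<close>. It is fixed once for the given set; \<alpha> itself is
    not computed.\<close>
  obtain m where m: "1 / real (Suc m) < 1 - \<alpha>"
    using reals_Archimedean[of "1 - \<alpha>"] less by (auto simp: \<alpha>_def inverse_eq_divide)
  define \<kappa> where "\<kappa> = real (Suc (Suc m)) / real (Suc m)"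
  have \<kappa>: "\<kappa> = 1 + 1 / real (Suc m)" by (simp add: \<kappa>_def field_simps)
  have "\<kappa> * \<alpha> \<le> \<alpha> + 1 / real (Suc m)"
    using less mult_left_mono[of \<alpha> 1 "1 / real (Suc m)"] by (simp add: \<kappa> \<alpha>_def distrib_right)
  then have \<kappa>\<alpha>: "\<kappa> * \<alpha> < 1" using m by simp
  \<comment> \<open>The maximum with 1/4 keeps \<rho> positive when the open set has measure
    0.\<close>
  define \<rho> where "\<rho> = sqrt (max (1/4) (\<kappa> * \<alpha>))"
  have \<rho>: "0 < \<rho>" "\<rho> < 1" "\<kappa> * \<alpha> \<le> \<rho>\<^sup>2" using \<kappa>\<alpha> by (simp_all add: \<rho>_def)
  obtain N where "\<And>B. computable_in B N"
    "\<And>v. (\<integral>\<omega>. (visits (N v) v \<omega>)\<^sup>2 \<partial>uniform) \<le> real (Suc (Suc m)) / real (Suc m) * (real (N v) * measure uniform (cylinder v))\<^sup>2"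
    "\<And>v. 0 < N v"
    by (rule computable_horizon[of "Suc m" "Suc (Suc m)", OF zero_less_Suc lessI]) (rule that)
  note N = this[folded \<kappa>_def]
  let ?Q = "stays g R N"
  define X where "X v = {\<omega>. \<forall>i<N v. (T ^^ i) \<omega> \<in> open_of R}" for v
  have X_sets: "X v \<in> sets uniform" for v
  proof -
    have "(T ^^ i) -` open_of R \<inter> space uniform \<in> sets uniform" for i
      by (rule measurable_sets[OF measurable_funpow sets_open_of])
    then have "(\<Inter>i\<in>{..<N v}. (T ^^ i) -` open_of R) \<in> sets uniform"
      using N(3)[of v] by (intro sets.finite_INT) auto
    moreover have "(\<Inter>i\<in>{..<N v}. (T ^^ i) -` open_of R) = X v" by (auto simp: X_def)
    ultimately show ?thesis by simp
  qed
  have le: "measure uniform (open_of (\<lambda>u. k \<le> level ?Q u)) \<le> \<rho> ^ k" for k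
  proof (rule measure_level_le[where X = X])
    show "measure uniform (cylinder v \<inter> X v) \<le> \<rho> * measure uniform (cylinder v)" for v
      unfolding X_def by (rule measure_stay_le[OF sets_open_of N(3) _ \<rho>(1) _ N(2)])
        (use \<rho>(3) in \<open>auto simp: \<kappa>_def \<alpha>_def\<close>)
    show "cylinder u \<subseteq> X v" if "?Q v u" for u v
    proof
      fix \<omega> assume "\<omega> \<in> cylinder u"
      then have "(T ^^ i) \<omega> \<in> cylinder ((g ^^ i) u)" for i
        using approx_funpow[of i] by (simp add: approximates_def)
      then show "\<omega> \<in> X v" using that by (auto simp: X_def stays_def open_of_eq_cylinders)
    qed
  qed (use \<rho> X_sets in auto)
  \<comment> \<open>Taking every \<open>J\<close>-th level turns the geometric bound with ratio
    \<rho> into the bound required of a test.\<close>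
  obtain J where J: "\<rho> ^ J < 1/2" using real_arch_pow_inv[of "1/2" \<rho>] \<rho> by auto
  have "ml_test B (\<lambda>k u. J * k \<le> level ?Q u)"
    unfolding ml_test_def
  proof (intro conjI allI)
    have "computable_in B (\<lambda>z :: (nat \<times> bool list \<times> bool list) \<times> bool \<times> nat \<times> bool list.
        climb_step ?Q (fst z) (fst (snd z)))"
      unfolding climb_step_def stays_def Let_def
      by (intro computable computable_compose[OF R(2)] computable_g computable_compose[OF N(1)])
    then show "computable_in B (\<lambda>z. J * fst z \<le> level ?Q (snd z))"
      unfolding level_def by (intro computable)
    fix k
    show "upward (\<lambda>u. J * k \<le> level ?Q u)" by (rule upward_level)
    have "measure uniform (open_of (\<lambda>u. J * k \<le> level ?Q u)) \<le> (\<rho> ^ J) ^ k"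
      using le[of "J * k"] by (simp add: power_mult)
    also have "\<dots> \<le> (1/2) ^ k" using J \<rho> by (intro power_mono) auto
    finally show "measure uniform (open_of (\<lambda>u. J * k \<le> level ?Q u)) \<le> (1/2) ^ k" .
  qed
  then obtain k where k: "x \<notin> open_of (\<lambda>u. J * k \<le> level ?Q u)"
    using x unfolding passes_tests_def by blast
  have "\<exists>s. \<forall>t\<ge>s. ?Q v (seg x t)" for v
  proof -
    have "\<exists>s. R ((g ^^ i) (seg x s))" for i
      using orbit[of i] open_of_approximates[OF R(1) approx_funpow[of i]] by (auto simp: open_of_def)
    then obtain s where s: "R ((g ^^ i) (seg x (s i)))" for i by metis
    have "?Q v (seg x t)" if "Max (s ` {..<N v}) \<le> t" for t
      unfolding stays_def
    proof (intro allI impI)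
      fix i assume "i < N v"
      then have "s i \<le> t" using that by (meson Max_ge finite_imageI finite_lessThan imageI lessThan_iff order_trans)
      then show "R ((g ^^ i) (seg x t))"
        using upward_seg[OF upward_approximates[OF R(1) approx_funpow] s] by blast
    qed
    then show ?thesis by blast
  qed
  then show False using level_unbounded[of ?Q x "J * k"] k by blast
qed

end

section \<open>Pairs of sequences\<close>

definition join :: "bitseq \<Rightarrow> bitseq \<Rightarrow> bitseq" where
  "join x y p = (if even p then x (p div 2) else y (p div 2))"

definition interleave :: "bool list \<Rightarrow> bool list \<Rightarrow> bool list" where
  "interleave u v =
    map (\<lambda>p. nth_default False (if even p then u else v) (p div 2)) [0..<2 * min (length u) (length v)]"

lemma length_interleave [simp]: "length (interleave u v) = 2 * min (length u) (length v)"
  by (simp add: interleave_def)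

lemma interleave_seg: "interleave (seg x s) (seg y t) = seg (join x y) (2 * min s t)"
  by (rule nth_equalityI) (auto simp: interleave_def join_def nth_default_def)

lemma computable_interleave [computable]:
  assumes "computable_in B f" "computable_in B h"
  shows "computable_in B (\<lambda>x. interleave (f x) (h x))"
  unfolding interleave_def min_def
  by (intro computable assms computable_compose[OF assms(1)] computable_compose[OF assms(2)])

lemma seg_nth_default: "seg (nth_default False u) (length u) = u"
  by (rule nth_equalityI) (simp_all add: nth_default_def)

lemma prefix_interleave:
  assumes "prefix u u'" "prefix v v'" shows "prefix (interleave u v) (interleave u' v')"
proof -
  have take: "w = seg (nth_default False w') (length w)" if w: "prefix w w'" for w w' :: "bool list"
  proof -
    have "seg (nth_default False w') (length w) = take (length w) (seg (nth_default False w') (length w'))"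
      using prefix_length_le[OF w] by simp
    also have "\<dots> = w" unfolding seg_nth_default using w by (auto elim: prefixE)
    finally show ?thesis ..
  qed
  define z where "z = join (nth_default False u') (nth_default False v')"
  have "interleave u v = seg z (2 * min (length u) (length v))"
      "interleave u' v' = seg z (2 * min (length u') (length v'))"
    using take assms interleave_seg unfolding z_def by (metis prefix_order.refl)+
  moreover have "2 * min (length u) (length v) \<le> 2 * min (length u') (length v')"
    using assms[THEN prefix_length_le] by (intro mult_le_mono2 min.mono)
  ultimately show ?thesis using seg_append by (metis prefixI)
qed

lemma inj_on_interleave:
  "inj_on (\<lambda>(u, v). interleave u v) ({u. length u = s} \<times> {v. length v = s})"
proof (rule inj_onI)
  fix z z' :: "bool list \<times> bool list"
  assume z: "z \<in> {u. length u = s} \<times> {v. length v = s}" "z' \<in> {u. length u = s} \<times> {v. length v = s}"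
    and eq: "(case z of (u, v) \<Rightarrow> interleave u v) = (case z' of (u, v) \<Rightarrow> interleave u v)"
  obtain u v u' v' where z_eq: "z = (u, v)" "z' = (u', v')" by (cases z, cases z')
  have len: "length u = s" "length v = s" "length u' = s" "length v' = s" using z z_eq by auto
  have nth: "interleave a b ! (2 * i) = a ! i" "interleave a b ! Suc (2 * i) = b ! i"
    if "length a = length b" "i < length b" for a b i
    using that by (simp_all add: interleave_def nth_default_def del: upt_Suc)
  have "u ! i = u' ! i" "v ! i = v' ! i" if "i < s" for i
    using nth[of u v i] nth[of u' v' i] len eq z_eq that by simp_all
  then show "z = z'" using len z_eq by (auto intro!: nth_equalityI)
qed

text \<open>The section is taken at the image \<open>S z\<close>, but the bits read are those of
  \<open>z\<close>, with \<open>h\<close> approximating \<open>S\<close>. So sections at an iterate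
  of \<open>\<omega> i\<close> remain computable from the original \<open>\<omega> i\<close>, the
  oracle to which the later coordinates are random.\<close>

definition slice :: "(bool list \<Rightarrow> bool list) \<Rightarrow> bitseq \<Rightarrow> (bool list \<Rightarrow> bool) \<Rightarrow> bool list \<Rightarrow> bool" where
  "slice h z R v \<longleftrightarrow> R (interleave (h (seg z (length v))) v)"

lemma upward_slice:
  assumes "upward R" "approximates h S" shows "upward (slice h z R)"
  unfolding upward_def slice_def
proof (intro allI impI)
  fix u v assume "R (interleave (h (seg z (length u))) u)"
  moreover have "prefix (seg z (length u)) (seg z (length (u @ v)))"
    using seg_append[of "length u" "length (u @ v)" z] by (auto simp: prefix_def)
  ultimately show "R (interleave (h (seg z (length (u @ v)))) (u @ v))"
    using upward_prefix[OF assms(1)] prefix_interleave approximates_prefix[OF assms(2)] by (meson prefixI)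
qed

lemma open_of_slice:
  assumes R: "upward R" and h: "approximates h S"
  shows "open_of (slice h z R) = {y. join (S z) y \<in> open_of R}"
proof -
  have eq: "interleave (h (seg z s)) (seg y s) = seg (join (S z) y) (2 * min (length (h (seg z s))) s)" for y s
    using approximates_seg[OF h, of z s] interleave_seg by metis
  have "\<exists>s. R (interleave (h (seg z s)) (seg y s))" if "R (seg (join (S z) y) n)" for y n
  proof -
    obtain s where "\<forall>t\<ge>s. n \<le> length (h (seg z t))" using approximates_length[OF h] by blast
    then have "n \<le> 2 * min (length (h (seg z (max n s)))) (max n s)"
      by (metis max.cobounded1 max.cobounded2 min.boundedI mult_2 trans_le_add1)
    then show ?thesis using upward_seg[OF R that] eq[of "max n s" y] by metis
  qed
  then show ?thesis by (auto simp: open_of_def slice_def eq)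
qed

lemma computable_slice:
  assumes R: "computable_in B (\<lambda>z. R (fst z) (snd z))" and h: "computable_in B h"
    and x: "computable_in B x" and k: "computable_in B k" and v: "computable_in B v"
  shows "computable_in B (\<lambda>z. slice h x (R (k z)) (v z))"
  unfolding slice_def seg_def
  by (intro computable computable_apply2[OF R] computable_compose[OF h] computable_compose[OF x] k v)

text \<open>The part of the section already visible at this stage has measure greater than
  \<open>c / d\<close>; stated by counting strings, this is decidable.\<close>

definition heavy :: "nat \<Rightarrow> nat \<Rightarrow> (bool list \<Rightarrow> bool) \<Rightarrow> bool list \<Rightarrow> bool" where
  "heavy c d R u \<longleftrightarrow> c * 2 ^ length u < d * card {v. length v = length u \<and> R (interleave u v)}"

lemma heavy_iff:
  "heavy c d R u \<longleftrightarrow> c < d * measure uniform {y. R (interleave u (seg y (length u)))}"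
proof -
  have "heavy c d R u \<longleftrightarrow> real (c * 2 ^ length u)
      < real (d * card {v. length v = length u \<and> R (interleave u v)})"
    unfolding heavy_def of_nat_less_iff ..
  then show ?thesis by (simp add: measure_seg[of "\<lambda>v. R (interleave u v)"] field_simps)
qed

lemma upward_heavy:
  assumes "upward R" shows "upward (heavy c d R)"
  unfolding upward_def
proof (intro allI impI)
  fix u w assume u: "heavy c d R u"
  have "measure uniform {y. R (interleave u (seg y (length u)))}
      \<le> measure uniform {y. R (interleave (u @ w) (seg y (length (u @ w))))}"
  proof (rule uniform.finite_measure_mono)
    have "prefix (interleave u (seg y (length u))) (interleave (u @ w) (seg y (length (u @ w))))" for y
      using seg_append[of "length u" "length (u @ w)" y] by (intro prefix_interleave) (auto simp: prefix_def)
    then show "{y. R (interleave u (seg y (length u)))} \<subseteq> {y. R (interleave (u @ w) (seg y (length (u @ w))))}"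
      using upward_prefix[OF assms] by blast
  qed (rule sets_seg)
  from mult_left_mono[OF this, of "real d"] u show "heavy c d R (u @ w)" by (simp add: heavy_iff)
qed

text \<open>Markov's inequality by counting at each stage: every heavy string of length
  \<open>s\<close> has more than \<open>c * 2 ^ s / d\<close> partners, and distinct pairs
  interleave to distinct strings of length \<open>2 * s\<close>.\<close>

lemma measure_heavy_le:
  assumes R: "upward R" and "0 < c"
  shows "measure uniform (open_of (heavy c d R)) \<le> d / c * measure uniform (open_of R)"
proof (rule measure_open_of_le[OF upward_heavy[OF R]])
  fix s
  let ?G = "\<lambda>u. {v. length v = s \<and> R (interleave u v)}"
  let ?H = "{u. length u = s \<and> heavy c d R u}"
  have fin: "finite (?G u)" for u by (rule finite_subset[OF _ finite_strings[of s]]) auto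
  have finH: "finite ?H" by (rule finite_subset[OF _ finite_strings[of s]]) auto
  have "c * 2 ^ s * card ?H = (\<Sum>u\<in>?H. c * 2 ^ s)" by simp
  also have "\<dots> \<le> (\<Sum>u\<in>?H. d * card (?G u))"
    by (rule sum_mono) (auto simp: heavy_def less_imp_le)
  also have "\<dots> = d * card (SIGMA u:?H. ?G u)"
    using finH fin by (simp add: sum_distrib_left)
  also have "card (SIGMA u:?H. ?G u) = card ((\<lambda>(u, v). interleave u v) ` (SIGMA u:?H. ?G u))"
    by (rule card_image[symmetric], rule inj_on_subset[OF inj_on_interleave[of s]]) auto
  also have "\<dots> \<le> card {w. length w = 2 * s \<and> R w}"
    by (rule card_mono) (auto intro: finite_subset[OF _ finite_strings[of "2 * s"]])
  finally have "c * 2 ^ s * card ?H \<le> d * card {w. length w = 2 * s \<and> R w}" by simp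
  then have "real (c * 2 ^ s * card ?H) \<le> real (d * card {w. length w = 2 * s \<and> R w})"
    by (rule of_nat_mono)
  then have "real (card ?H) / 2 ^ s \<le> d / c * (card {w. length w = 2 * s \<and> R w} / 2 ^ (2 * s))"
    using \<open>0 < c\<close> by (simp add: field_simps power_mult power2_eq_square mult_2 power_add)
  also have "\<dots> \<le> d / c * measure uniform (open_of R)"
    using measure_seg_le_open_of[of R "2 * s"] by (intro mult_left_mono) (auto simp: measure_seg)
  finally show "measure uniform {x. heavy c d R (seg x s)} \<le> d / c * measure uniform (open_of R)"
    by (simp add: measure_seg)
qed

lemma measure_section_le:
  assumes R: "upward R" and "0 < d" and x: "x \<notin> open_of (heavy c d R)"
  shows "measure uniform {y. join x y \<in> open_of R} \<le> c / d"
proof -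
  have "measure uniform (open_of (slice (\<lambda>u. u) x R)) \<le> c / d"
  proof (rule measure_open_of_le[OF upward_slice[OF R approximates_id]])
    fix s
    have "\<not> heavy c d R (seg x s)" using x by (auto simp: open_of_def)
    then show "measure uniform {y. slice (\<lambda>u. u) x R (seg y s)} \<le> c / d"
      using \<open>0 < d\<close> by (simp add: heavy_iff slice_def field_simps)
  qed
  then show ?thesis using open_of_slice[OF R approximates_id, of x] by simp
qed

lemma computable_heavy:
  assumes R: "computable_in B (\<lambda>z. R (fst z) (snd z))"
    and "computable_in B c" "computable_in B d" "computable_in B k" "computable_in B u"
  shows "computable_in B (\<lambda>z. heavy (c z) (d z) (R (k z)) (u z))"
  unfolding heavy_def
  by (intro computable assms computable_apply2[OF R] computable_compose[OF assms(4)]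
      computable_compose[OF assms(5)])

text \<open>The tail of the sets of points with large sections is a test.  This is the argument by
  which van Lambalgen's theorem splits a test for pairs.\<close>

lemma section_of_test:
  assumes D: "ml_test B D" and x: "passes_tests B x"
  shows "\<exists>j. \<forall>i. measure uniform {y. join x y \<in> open_of (D (2 * (i + j + 1)))} \<le> (1 / 2) ^ i"
proof -
  have up: "upward (D k)" and le: "measure uniform (open_of (D k)) \<le> (1 / 2) ^ k" for k
    using D by (auto simp: ml_test_def)
  have comp: "computable_in B (\<lambda>z. D (fst z) (snd z))" using D by (simp add: ml_test_def)
  define H where "H j u \<longleftrightarrow> (\<exists>i<length u. heavy 1 (2 ^ (i + j + 1)) (D (2 * (i + j + 1))) u)" for j u
  have uH: "upward (H j)" for j
    using upward_heavy[OF up] unfolding H_def upward_def by (metis length_append trans_less_add1)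
  have H_eq: "open_of (H j) = (\<Union>i. open_of (heavy 1 (2 ^ (i + j + 1)) (D (2 * (i + j + 1)))))" for j
  proof -
    have "\<exists>s. H j (seg y s)" if "heavy 1 (2 ^ (i + j + 1)) (D (2 * (i + j + 1))) (seg y s)" for i y s
      unfolding H_def using upward_seg[OF upward_heavy[OF up] that, of "max s (Suc i)"]
      by (intro exI[of _ "max s (Suc i)"] exI[of _ i]) simp
    then show ?thesis by (auto simp: open_of_def H_def)
  qed
  have small: "measure uniform (open_of (heavy 1 (2 ^ k) (D (2 * k)))) \<le> (1 / 2) ^ k" for k
  proof -
    have "measure uniform (open_of (heavy 1 (2 ^ k) (D (2 * k)))) \<le> 2 ^ k * measure uniform (open_of (D (2 * k)))"
      using measure_heavy_le[OF up, of 1 "2 ^ k" "2 * k"] by simp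
    also have "\<dots> \<le> 2 ^ k * (1 / 2) ^ (2 * k)" by (rule mult_left_mono[OF le]) simp
    also have "\<dots> = (1 / 2) ^ k" by (simp add: power_mult power2_eq_square power_divide power_mult_distrib mult_2 power_add)
    finally show ?thesis .
  qed
  have "ml_test B H"
    unfolding ml_test_def
  proof (intro conjI allI uH)
    show "computable_in B (\<lambda>z. H (fst z) (snd z))"
      unfolding H_def by (intro computable computable_heavy[OF comp])
    fix j
    have sums: "(\<lambda>i. (1 / 2) ^ (i + j + 1)) sums ((1 / 2 :: real) ^ j)"
      using sums_mult[OF power_half_series, of "(1 / 2) ^ j"] by (simp add: power_add mult.commute)
    have "measure uniform (open_of (H j))
        \<le> (\<Sum>i. measure uniform (open_of (heavy 1 (2 ^ (i + j + 1)) (D (2 * (i + j + 1))))))"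
      unfolding H_eq
      by (rule uniform.finite_measure_subadditive_countably)
        (auto intro!: sets_open_of summable_comparison_test'[OF sums_summable[OF sums]] small[of "_ + j + 1", simplified])
    also have "\<dots> \<le> (\<Sum>i. (1 / 2) ^ (i + j + 1))"
      by (rule suminf_le) (auto intro!: summable_comparison_test'[OF sums_summable[OF sums]]
          small[of "_ + j + 1", simplified] sums_summable[OF sums, simplified])
    also have "\<dots> = (1 / 2) ^ j" using sums by (rule sums_unique[symmetric])
    finally show "measure uniform (open_of (H j)) \<le> (1 / 2) ^ j" .
  qed
  then obtain j where j: "x \<notin> open_of (H j)" using x unfolding passes_tests_def by blast
  have "measure uniform {y. join x y \<in> open_of (D (2 * (i + j + 1)))} \<le> (1 / 2) ^ i" for i
  proof -
    have "measure uniform {y. join x y \<in> open_of (D (2 * (i + j + 1)))} \<le> real 1 / real (2 ^ (i + j + 1))"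
      by (rule measure_section_le[OF up]) (use j H_eq in auto)
    also have "\<dots> = (1 / 2) ^ i * (1 / 2) ^ (j + 1)" by (simp add: power_add power_divide)
    also have "\<dots> \<le> (1 / 2) ^ i * 1" by (intro mult_left_mono power_le_one) auto
    finally show ?thesis by simp
  qed
  then show ?thesis by blast
qed

section \<open>Sequences of sequences\<close>

text \<open>With this pairing, coordinate 0 occupies the even positions and the remaining
  coordinates are arranged on the odd ones in the same way. Hence \<open>flatten_join\<close>:
  fixing the first coordinate is taking a section, and the remainder is again a flattened
  sequence.\<close>

function row :: "nat \<Rightarrow> nat" where
  "row p = (if even p then 0 else Suc (row (p div 2)))"
  by pat_completeness auto
termination by (relation "Wellfounded.measure (\<lambda>p. p)") (auto dest: odd_pos)

function col :: "nat \<Rightarrow> nat" where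
  "col p = (if even p then p div 2 else col (p div 2))"
  by pat_completeness auto
termination by (relation "Wellfounded.measure (\<lambda>p. p)") (auto dest: odd_pos)

declare row.simps [simp del] col.simps [simp del]

definition pos :: "nat \<Rightarrow> nat \<Rightarrow> nat" where
  "pos i n = 2 ^ i * (2 * n + 1) - 1"

lemma pos_simps: "pos 0 n = 2 * n" "pos (Suc i) n = Suc (2 * pos i n)"
proof -
  have "0 < (2 :: nat) ^ i * (2 * n + 1)" by simp
  then show "pos (Suc i) n = Suc (2 * pos i n)" unfolding pos_def power_Suc by linarith
qed (simp add: pos_def)

lemma row_pos [simp]: "row (pos i n) = i" and col_pos [simp]: "col (pos i n) = n"
  by (induction i) (simp_all add: pos_simps row.simps[of "2 * _"] row.simps[of "Suc _"]
      col.simps[of "2 * _"] col.simps[of "Suc _"])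

lemma pos_row_col [simp]: "pos (row p) (col p) = p"
proof (induction p rule: row.induct)
  case (1 p)
  show ?case
  proof (cases "even p")
    case True
    then show ?thesis by (simp add: row.simps[of p] col.simps[of p] pos_simps)
  next
    case False
    then show ?thesis using 1 by (simp add: row.simps[of p] col.simps[of p] pos_simps)
  qed
qed

lemma computable_pos [computable]:
  "computable_in B f \<Longrightarrow> computable_in B h \<Longrightarrow> computable_in B (\<lambda>x. pos (f x) (h x))"
  unfolding pos_def by (intro computable)

definition flatten :: "(nat \<Rightarrow> bitseq) \<Rightarrow> bitseq" where
  "flatten \<omega> p = \<omega> (row p) (col p)"

lemma flatten_pos [simp]: "flatten \<omega> (pos i n) = \<omega> i n"
  by (simp add: flatten_def)

lemma flatten_join: "flatten \<omega> = join (\<omega> 0) (flatten (\<lambda>i. \<omega> (Suc i)))"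
  by (rule ext) (simp add: flatten_def join_def row.simps[of "_ :: nat"] col.simps[of "_ :: nat"])

lemma measurable_flatten [measurable]: "flatten \<in> uniform_seq \<rightarrow>\<^sub>M uniform"
proof -
  have "(\<lambda>\<omega>. \<omega> (row p) (col p)) \<in> uniform_seq \<rightarrow>\<^sub>M measure_pmf (bernoulli_pmf (1/2))" for p
  proof -
    have "(\<lambda>\<omega>. \<omega> (row p)) \<in> uniform_seq \<rightarrow>\<^sub>M uniform"
      unfolding uniform_seq_def by (rule measurable_component_singleton) simp
    moreover have "(\<lambda>x. x (col p)) \<in> uniform \<rightarrow>\<^sub>M measure_pmf (bernoulli_pmf (1/2))"
      unfolding uniform_def by (rule measurable_component_singleton) simp
    ultimately show ?thesis by (rule measurable_compose)
  qed
  then show ?thesis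
    unfolding uniform_def flatten_def[abs_def] by (intro measurable_PiM_single') auto
qed

lemma space_uniform_seq [simp]: "space uniform_seq = UNIV"
  by (simp add: uniform_seq_def space_PiM)

lemma prob_space_uniform_seq: "prob_space uniform_seq"
  unfolding uniform_seq_def by (intro prob_space_PiM prob_space_uniform)

lemma emeasure_uniform_bits:
  assumes "finite S" shows "emeasure uniform {x. \<forall>n\<in>S. x n = b n} = ennreal ((1 / 2) ^ card S)"
proof -
  interpret product_prob_space "\<lambda>_::nat. measure_pmf (bernoulli_pmf (1/2))" UNIV
    by standard
  have "{x. \<forall>n\<in>S. x n = b n} = {x \<in> space (\<Pi>\<^sub>M i\<in>UNIV. measure_pmf (bernoulli_pmf (1/2))). \<forall>n\<in>S. x n \<in> {b n}}"
    by (auto simp: space_PiM)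
  then have "emeasure uniform {x. \<forall>n\<in>S. x n = b n} =
      (\<Prod>n\<in>S. emeasure (measure_pmf (bernoulli_pmf (1/2))) {b n})"
    unfolding uniform_def using assms by (subst emeasure_PiM_Collect[symmetric]) auto
  also have "\<dots> = (\<Prod>n\<in>S. ennreal (1/2))"
    by (rule prod.cong) (auto simp: emeasure_pmf_single split: bool.splits)
  also have "\<dots> = ennreal ((1/2) ^ card S)"
    by (subst prod_ennreal) auto
  finally show ?thesis .
qed

text \<open>\<open>flatten\<close> preserves measure, seen on strings: a string of length
  \<open>s\<close> prescribes \<open>card (S i)\<close> distinct bits of coordinate
  \<open>i\<close>, and these numbers add up to \<open>s\<close>.\<close>

lemma measure_flatten_seg:
  "measure uniform_seq {\<omega>. P (seg (flatten \<omega>) s)} = measure uniform {x. P (seg x s)}"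
proof -
  interpret product_prob_space "\<lambda>_::nat. uniform" UNIV
    by standard
  interpret seq: prob_space uniform_seq by (rule prob_space_uniform_seq)
  have one: "emeasure uniform_seq {\<omega>. seg (flatten \<omega>) s = u} = ennreal ((1 / 2) ^ s)" if "length u = s" for u
  proof -
    define S where "S i = {n. pos i n < s}" for i
    have S: "S i = col ` {p\<in>{..<s}. row p = i}" for i
      by (force simp: S_def)
    have inj: "inj_on col {p\<in>{..<s}. row p = i}" for i
      by (rule inj_onI) (metis (mono_tags, lifting) mem_Collect_eq pos_row_col)
    have fin: "finite (S i)" for i unfolding S by simp
    define X where "X i = {x. \<forall>n\<in>S i. x n = u ! pos i n}" for i
    have X: "X i \<in> sets uniform" for i
    proof -
      have "Measurable.pred uniform (\<lambda>x. \<forall>n\<in>S i. x n = u ! pos i n)"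
        using fin[of i] unfolding uniform_def by measurable
      then show ?thesis by (simp add: pred_def X_def)
    qed
    have "seg (flatten \<omega>) s = u \<longleftrightarrow> (\<forall>p<s. flatten \<omega> p = u ! p)" for \<omega>
      using that by (auto simp: list_eq_iff_nth_eq)
    also have "\<dots> \<omega> \<longleftrightarrow> (\<forall>i\<in>row ` {..<s}. \<omega> i \<in> X i)" for \<omega>
      by (auto simp: X_def S_def flatten_def)
    finally have "{\<omega>. seg (flatten \<omega>) s = u} = {\<omega>\<in>space (\<Pi>\<^sub>M i\<in>UNIV. uniform). \<forall>i\<in>row ` {..<s}. \<omega> i \<in> X i}"
      by (simp add: space_PiM)
    then have "emeasure uniform_seq {\<omega>. seg (flatten \<omega>) s = u} = (\<Prod>i\<in>row ` {..<s}. emeasure uniform (X i))"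
      unfolding uniform_seq_def using X by (subst emeasure_PiM_Collect[symmetric]) auto
    also have "\<dots> = (\<Prod>i\<in>row ` {..<s}. ennreal ((1 / 2) ^ card (S i)))"
      using fin by (simp add: X_def emeasure_uniform_bits)
    also have "\<dots> = ennreal ((1 / 2) ^ (\<Sum>i\<in>row ` {..<s}. card (S i)))"
      by (subst prod_ennreal) (auto simp: power_sum)
    also have "(\<Sum>i\<in>row ` {..<s}. card (S i)) = (\<Sum>i\<in>row ` {..<s}. \<Sum>p\<in>{p\<in>{..<s}. row p = i}. 1)"
      unfolding S using card_image[OF inj] by simp
    also have "\<dots> = s"
      using sum.image_gen[of "{..<s}" "\<lambda>_. 1 :: nat" row] by simp
    finally show ?thesis .
  qed
  have sets: "{\<omega>. seg (flatten \<omega>) s = u} \<in> sets uniform_seq" for u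
    using measurable_sets[OF measurable_flatten sets_seg[of "\<lambda>v. v = u" s]] by (simp add: vimage_def)
  let ?U = "{u. length u = s \<and> P u}"
  have fin: "finite ?U" by (rule finite_subset[OF _ finite_strings[of s]]) auto
  have "{\<omega>. P (seg (flatten \<omega>) s)} = (\<Union>u\<in>?U. {\<omega>. seg (flatten \<omega>) s = u})" by auto
  then have "measure uniform_seq {\<omega>. P (seg (flatten \<omega>) s)} = (\<Sum>u\<in>?U. measure uniform_seq {\<omega>. seg (flatten \<omega>) s = u})"
    using seq.finite_measure_finite_Union[OF fin, of "\<lambda>u. {\<omega>. seg (flatten \<omega>) s = u}"] sets
    by (auto simp: disjoint_family_on_def)
  also have "\<dots> = (\<Sum>u\<in>?U. (1 / 2) ^ s)"
    using one by (intro sum.cong) (auto simp: measure_def)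
  finally show ?thesis by (simp add: measure_seg power_divide)
qed

section \<open>Tests for sequences of sequences\<close>

text \<open>A code is read as a list of triples; a triple whose last entry is not a bit is never satisfied.\<close>

definition satisfies :: "bool list \<Rightarrow> nat \<Rightarrow> bool" where
  "satisfies u y \<longleftrightarrow> (\<forall>z\<in>set (list_decode y).
    let i = fst (prod_decode z); n = fst (prod_decode (snd (prod_decode z)));
        b = snd (prod_decode (snd (prod_decode z)))
    in pos i n < length u \<and> of_bool (nth_default False u (pos i n)) = b)"

lemma computable_satisfies [computable]:
  assumes "computable_in B u" "computable_in B y"
  shows "computable_in B (\<lambda>x. satisfies (u x) (y x))"
  unfolding satisfies_def Let_def
  by (intro computable computable_list_decode computable_prod_decode assms computable_compose[OF assms(1)])

lemma upward_satisfies: "satisfies u y \<Longrightarrow> satisfies (u @ v) y"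
proof -
  have "nth_default False (u @ v) p = nth_default False u p" if "p < length u" for p
    using that by (simp add: nth_default_def nth_append)
  then show "satisfies u y \<Longrightarrow> satisfies (u @ v) y" unfolding satisfies_def Let_def
    by (simp add: trans_less_add1)
qed

lemma satisfies_seg_flatten_iff:
  "satisfies (seg (flatten \<omega>) s) (cond_code c) \<longleftrightarrow> \<omega> \<in> cylinder_seq c \<and> (\<forall>(i, n, b)\<in>set c. pos i n < s)"
proof -
  have nth: "nth_default False (seg (flatten \<omega>) s) (pos i n) = \<omega> i n" if "pos i n < s" for i n
    using that by (simp add: nth_default_def)
  have "satisfies (seg (flatten \<omega>) s) (cond_code c) \<longleftrightarrow> (\<forall>(i, n, b)\<in>set c. pos i n < s \<and>
      (of_bool (nth_default False (seg (flatten \<omega>) s) (pos i n)) :: nat) = of_bool b)"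
    by (simp add: satisfies_def cond_code_def Let_def case_prod_unfold)
  also have "\<dots> \<longleftrightarrow> (\<forall>(i, n, b)\<in>set c. pos i n < s \<and> \<omega> i n = b)"
    by (intro ball_cong refl) (simp add: nth case_prod_unfold cong: conj_cong)
  finally show ?thesis by (auto simp: cylinder_seq_def)
qed

text \<open>A program may list numbers that code no condition. \<open>enumerated_open\<close>
  ignores them, so no string may satisfy them.\<close>

lemma satisfies_imp_cond_code:
  assumes "satisfies u y" shows "\<exists>c. y = cond_code c"
proof -
  define c where "c = map (\<lambda>z. (fst (prod_decode z), fst (prod_decode (snd (prod_decode z))),
    snd (prod_decode (snd (prod_decode z))) = 1)) (list_decode y)"
  have "map (\<lambda>(i, n, b). prod_encode (i, prod_encode (n, of_bool b))) c = map (\<lambda>z. z) (list_decode y)"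
    unfolding c_def map_map
  proof (rule map_cong[OF refl])
    fix z assume "z \<in> set (list_decode y)"
    then have "snd (prod_decode (snd (prod_decode z))) = of_bool (nth_default False u
        (pos (fst (prod_decode z)) (fst (prod_decode (snd (prod_decode z))))))"
      using assms by (auto simp: satisfies_def Let_def)
    then have "of_bool (snd (prod_decode (snd (prod_decode z))) = 1) = snd (prod_decode (snd (prod_decode z)))"
      by simp
    then show "((\<lambda>(i, n, b). prod_encode (i, prod_encode (n, of_bool b))) \<circ>
        (\<lambda>z. (fst (prod_decode z), fst (prod_decode (snd (prod_decode z))),
          snd (prod_decode (snd (prod_decode z))) = 1))) z = z"
      by simp
  qed
  then have "cond_code c = y" by (simp add: cond_code_def)
  then show ?thesis by blast
qed

text \<open>The cover for the bound \<open>1 / 2 ^ k\<close>, carried over to single bit sequences.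
  Bounding both the fuel and the index in the enumeration by the length of the string makes
  membership decidable.\<close>

definition flat_test :: "recf \<Rightarrow> nat \<Rightarrow> bool list \<Rightarrow> bool" where
  "flat_test e k u \<longleftrightarrow> (\<exists>s<length u. \<exists>t<length u.
    (case eval_fuel no_oracle s e [1, 2 ^ k, t] of None \<Rightarrow> False | Some y \<Rightarrow> satisfies u y))"

lemma upward_flat_test: "upward (flat_test e k)"
  unfolding upward_def flat_test_def
  by (auto split: option.splits intro: upward_satisfies) (metis option.sel upward_satisfies trans_less_add1 option.distinct(1))

lemma flatten_in_flat_test:
  "flatten \<omega> \<in> open_of (flat_test e k) \<longleftrightarrow>
    \<omega> \<in> enumerated_open cond_code cylinder_seq no_oracle e [1, 2 ^ k]"
proof
  assume "flatten \<omega> \<in> open_of (flat_test e k)"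
  then obtain l s t y where y: "eval_fuel no_oracle s e [1, 2 ^ k, t] = Some y" "satisfies (seg (flatten \<omega>) l) y"
    by (auto simp: open_of_def flat_test_def split: option.splits)
  obtain c where c: "y = cond_code c" using satisfies_imp_cond_code[OF y(2)] by blast
  have "\<omega> \<in> cylinder_seq c" using y(2) unfolding c satisfies_seg_flatten_iff by blast
  moreover have "cond_code c \<in> enumerated no_oracle e [1, 2 ^ k]"
    using eval_fuel_sound[OF y(1)] c by (auto simp: enumerated_def)
  ultimately show "\<omega> \<in> enumerated_open cond_code cylinder_seq no_oracle e [1, 2 ^ k]"
    by (auto simp: enumerated_open_def)
next
  assume "\<omega> \<in> enumerated_open cond_code cylinder_seq no_oracle e [1, 2 ^ k]"
  then obtain c t where c: "\<omega> \<in> cylinder_seq c" "eval no_oracle e [1, 2 ^ k, t] (cond_code c)"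
    by (auto simp: enumerated_open_def enumerated_def)
  obtain s where s: "eval_fuel no_oracle s e [1, 2 ^ k, t] = Some (cond_code c)"
    using eval_fuel_complete[OF c(2)] by blast
  define m where "m = Max (insert 0 ((\<lambda>(i, n, b). pos i n) ` set c))"
  have m: "\<forall>(i, n, b)\<in>set c. pos i n \<le> m"
    unfolding m_def by (auto intro!: Max_ge simp: image_iff)
  define l where "l = Suc (s + t + m)"
  have "\<forall>(i, n, b)\<in>set c. pos i n < l" using m by (auto simp: l_def)
  then have "satisfies (seg (flatten \<omega>) l) (cond_code c)"
    using c(1) unfolding satisfies_seg_flatten_iff by blast
  then have "flat_test e k (seg (flatten \<omega>) l)"
    unfolding flat_test_def using s by (intro exI[of _ s] exI[of _ t] conjI) (auto simp: l_def)
  then show "flatten \<omega> \<in> open_of (flat_test e k)" by (auto simp: open_of_def)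
qed

lemma ml_test_flat_test:
  assumes "\<forall>p q :: nat. p > 0 \<and> q > 0 \<longrightarrow>
    measure uniform_seq (enumerated_open cond_code cylinder_seq no_oracle e [p, q]) \<le> real p / real q"
  shows "ml_test no_oracle (flat_test e)"
  unfolding ml_test_def
proof (intro conjI allI upward_flat_test)
  show "computable_in no_oracle (\<lambda>z. flat_test e (fst z) (snd z))"
    unfolding flat_test_def by (intro computable)
  fix k
  interpret seq: prob_space uniform_seq by (rule prob_space_uniform_seq)
  have "enumerated_open cond_code cylinder_seq no_oracle e [1, 2 ^ k] = flatten -` open_of (flat_test e k)"
    using flatten_in_flat_test by auto
  then have "measure uniform_seq (flatten -` open_of (flat_test e k)) \<le> (1 / 2) ^ k"
    using assms[rule_format, of 1 "2 ^ k"] by (simp add: power_divide)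
  moreover have "measure uniform {x. flat_test e k (seg x s)} \<le> measure uniform_seq (flatten -` open_of (flat_test e k))" for s
    unfolding measure_flatten_seg[symmetric]
  proof (rule seq.finite_measure_mono)
    show "flatten -` open_of (flat_test e k) \<in> sets uniform_seq"
      using measurable_sets[OF measurable_flatten sets_open_of] by simp
  qed (auto simp: open_of_def)
  ultimately show "measure uniform (open_of (flat_test e k)) \<le> (1 / 2) ^ k"
    by (intro measure_open_of_le upward_flat_test) (rule order_trans)
qed

section \<open>The construction\<close>

instance recf :: countable
  by countable_datatype

lemma open_of_disj: "open_of (\<lambda>u. R u \<or> S u) = open_of R \<union> open_of S"
  by (auto simp: open_of_def)

lemma computable_first_oracle_nth: "computable_in (first_oracle (Suc i) \<omega>) (\<omega> i)"
proof -
  have "computable_in (first_oracle (Suc i) \<omega>) (\<lambda>n. first_oracle (Suc i) \<omega> i n)"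
    by (intro computable)
  then show ?thesis by (simp add: first_oracle_def)
qed

text \<open>A state consists of an effectively open set to be avoided and of a family of tests to be
  passed by the remaining coordinates.\<close>

definition good_state :: "(nat \<Rightarrow> bitseq) \<Rightarrow> (bool list \<Rightarrow> bool) \<times> (recf \<Rightarrow> nat \<Rightarrow> bool list \<Rightarrow> bool) \<Rightarrow> bool" where
  "good_state A s \<longleftrightarrow> upward (fst s) \<and> computable_in A (fst s) \<and> measure uniform (open_of (fst s)) < 1 \<and>
    (\<forall>e. ml_test A (snd s e))"

text \<open>Membership is only carried forward, from the joined sequence to its remainder; the final
  contradiction argues in this direction. The index changes from \<open>k'\<close> to
  \<open>k\<close> because a section of a test is a test only after some members are skipped. The
  last clause adds a member of the test numbered \<open>i\<close> to the set to be avoided.\<close>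

definition next_state :: "nat \<Rightarrow> bitseq \<Rightarrow>
    (bool list \<Rightarrow> bool) \<times> (recf \<Rightarrow> nat \<Rightarrow> bool list \<Rightarrow> bool) \<Rightarrow>
    (bool list \<Rightarrow> bool) \<times> (recf \<Rightarrow> nat \<Rightarrow> bool list \<Rightarrow> bool) \<Rightarrow> bool" where
  "next_state i x s s' \<longleftrightarrow>
    (\<forall>y. join x y \<in> open_of (fst s) \<longrightarrow> y \<in> open_of (fst s')) \<and>
    (\<forall>e k. \<exists>k'. \<forall>y. join x y \<in> open_of (snd s e k') \<longrightarrow> y \<in> open_of (snd s' e k)) \<and>
    (\<exists>k. open_of (snd s' (from_nat i) k) \<subseteq> open_of (fst s'))"

lemma exists_fraction_between:
  assumes "0 \<le> (m :: real)" "m < 1"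
  shows "\<exists>(c :: nat) (d :: nat). 0 < c \<and> c < d \<and> m < real c / real d"
proof -
  obtain n where n: "1 / real (Suc n) < 1 - m"
    using reals_Archimedean[of "1 - m"] assms by (auto simp: inverse_eq_divide)
  then have "m < 1 - 1 / real (Suc n)" by simp
  also have "\<dots> = n / Suc n" by (simp add: field_simps)
  finally have "m < n / Suc n" .
  moreover from this have "0 < n" using assms by (cases n) auto
  ultimately show ?thesis by (intro exI[of _ n] exI[of _ "Suc n"]) simp
qed

section \<open>One stage of the construction and the final argument\<close>

context computable_ergodic
begin

lemma passes_tests_funpow: "passes_tests B x \<Longrightarrow> passes_tests B ((T ^^ n) x)"
proof (rule passes_tests_image[OF _ approx_funpow])
  show "computable_in B (g ^^ n)"
    using computable_approx_funpow[OF computable_const computable_id, of B n] by simp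
  show "measure uniform ((T ^^ n) -` open_of R) = measure uniform (open_of R)" for R
    using distr_funpow[of n] measure_distr[OF measurable_funpow sets_open_of, of n R] by simp
qed

lemma exists_next_state:
  assumes good: "good_state (first_oracle i \<omega>) s" and x: "passes_tests (first_oracle i \<omega>) (\<omega> i)"
  shows "\<exists>s' n. good_state (first_oracle (Suc i) \<omega>) s' \<and> next_state i ((T ^^ n) (\<omega> i)) s s'"
proof -
  let ?A = "first_oracle i \<omega>" and ?B = "first_oracle (Suc i) \<omega>"
  obtain W D where s: "s = (W, D)" by (cases s)
  have W: "upward W" "computable_in ?A W" "measure uniform (open_of W) < 1"
    and D: "\<And>e. ml_test ?A (D e)" using good by (simp_all add: good_state_def s)
  \<comment> \<open>A threshold strictly between the measure of \<open>W\<close> and 1 serves twice: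
    being above the measure, it makes the set of heavy points have measure less than 1, and being
    below 1, it leaves a section of measure less than 1 at any point that is not heavy.\<close>
  obtain c d where cd: "0 < c" "c < d" "measure uniform (open_of W) < real c / real d"
    using exists_fraction_between[OF _ W(3)] by auto
  have "measure uniform (open_of (heavy c d W)) \<le> d / c * measure uniform (open_of W)"
    by (rule measure_heavy_le[OF W(1) cd(1)])
  also have "\<dots> < 1" using cd by (simp add: field_simps)
  finally have heavy: "measure uniform (open_of (heavy c d W)) < 1" .
  have "computable_in ?A (heavy c d W)"
    using computable_heavy[of ?A "\<lambda>_ :: nat. W" "\<lambda>_. c" "\<lambda>_. d" "\<lambda>_. 0" "\<lambda>u. u"]
    by (simp add: computable_const computable_id computable_compose[OF W(2) computable_snd[OF computable_id]])
  from orbit_leaves_open[OF x upward_heavy[OF W(1)] this heavy]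
  obtain n where n: "(T ^^ n) (\<omega> i) \<notin> open_of (heavy c d W)" by blast
  define h where "h = g ^^ n"
  define x' where "x' = (T ^^ n) (\<omega> i)"
  have h: "approximates h (T ^^ n)" unfolding h_def by (rule approx_funpow)
  have comp_h: "computable_in ?B h"
    unfolding h_def using computable_approx_funpow[OF computable_const computable_id, of ?B n] by simp
  have section_open: "open_of (slice h (\<omega> i) R) = {y. join x' y \<in> open_of R}" if "upward R" for R
    unfolding x'_def by (rule open_of_slice[OF that h])
  have "measure uniform (open_of (slice h (\<omega> i) W)) \<le> real c / real d"
    unfolding section_open[OF W(1)] x'_def using cd n by (intro measure_section_le[OF W(1)]) auto
  also have "\<dots> < 1" using cd by simp
  finally have less: "measure uniform (open_of (slice h (\<omega> i) W)) < 1" .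
  have "passes_tests ?A x'" unfolding x'_def by (rule passes_tests_funpow[OF x])
  \<comment> \<open>The shift is chosen for all programs at once, with no claim of computability in
    \<open>e\<close>. Each \<open>D' e\<close> has only its own number \<open>j e\<close> built
    in.\<close>
  from section_of_test[OF D this]
  have "\<exists>j. \<forall>e k. measure uniform {y. join x' y \<in> open_of (D e (2 * (k + j e + 1)))} \<le> (1 / 2) ^ k"
    by metis
  then obtain j where j: "\<And>e k. measure uniform {y. join x' y \<in> open_of (D e (2 * (k + j e + 1)))} \<le> (1 / 2) ^ k"
    by blast
  define D' where "D' e k = slice h (\<omega> i) (D e (2 * (k + j e + 1)))" for e k
  have up: "upward (D e k)" for e k using D by (simp add: ml_test_def)
  have D'_open: "open_of (D' e k) = {y. join x' y \<in> open_of (D e (2 * (k + j e + 1)))}" for e k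
    unfolding D'_def by (rule section_open[OF up])
  have D'_up: "upward (D' e k)" for e k unfolding D'_def by (rule upward_slice[OF up h])
  have D'_comp: "computable_in ?B (\<lambda>z. D' e (fst z) (snd z))" for e
  proof -
    have "computable_in ?B (\<lambda>z. D e (fst z) (snd z))"
      using D[of e] by (intro computable_first_oracle_Suc) (simp add: ml_test_def)
    from computable_slice[OF this comp_h computable_first_oracle_nth]
    show ?thesis unfolding D'_def by this (intro computable)+
  qed
  have D'_test: "ml_test ?B (D' e)" for e
    unfolding ml_test_def using D'_comp D'_up D'_open j by simp
  \<comment> \<open>The member to be added must fit into the room which the section of
    \<open>W\<close> leaves below 1.\<close>
  obtain k where k: "(1 / 2 :: real) ^ k < 1 - measure uniform (open_of (slice h (\<omega> i) W))"
    using real_arch_pow_inv[of "1 - measure uniform (open_of (slice h (\<omega> i) W))" "1 / 2"] less by auto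
  define W' where "W' u \<longleftrightarrow> slice h (\<omega> i) W u \<or> D' (from_nat i) k u" for u
  have W'_open: "open_of W' = open_of (slice h (\<omega> i) W) \<union> open_of (D' (from_nat i) k)"
    unfolding W'_def[abs_def] by (rule open_of_disj)
  have "measure uniform (open_of W') \<le> measure uniform (open_of (slice h (\<omega> i) W)) + measure uniform (open_of (D' (from_nat i) k))"
    unfolding W'_open by (rule measure_Un_le) (rule sets_open_of)+
  also have "\<dots> < 1" using D'_test[of "from_nat i"] k unfolding ml_test_def by (smt (verit))
  finally have W'_less: "measure uniform (open_of W') < 1" .
  have W'_comp: "computable_in ?B W'"
  proof -
    have "computable_in ?B (\<lambda>z :: nat \<times> bool list. W (snd z))"
      by (rule computable_compose[OF computable_first_oracle_Suc[OF W(2)]]) (intro computable)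
    from computable_slice[OF this comp_h computable_first_oracle_nth computable_const computable_id]
    have "computable_in ?B (slice h (\<omega> i) W)" by simp
    moreover have "computable_in ?B (\<lambda>u. D' (from_nat i) k u)"
      by (rule computable_apply2[OF D'_comp]) (intro computable)+
    ultimately show ?thesis unfolding W'_def[abs_def] by (intro computable)
  qed
  have W'_up: "upward W'"
    using upward_slice[OF W(1) h, of "\<omega> i"] D'_up[of "from_nat i" k] by (auto simp: upward_def W'_def)
  have "good_state ?B (W', D')"
    by (simp add: good_state_def W'_up W'_comp W'_less D'_test)
  moreover have "next_state i x' s (W', D')"
    unfolding next_state_def s fst_conv snd_conv W'_open section_open[OF W(1)] D'_open by blast
  ultimately show ?thesis unfolding x'_def by blast
qed

theorem exists_random_orbit_sequence:
  assumes pass: "\<And>i. passes_tests (first_oracle i \<omega>) (\<omega> i)"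
  shows "\<exists>n. ml_random_seq (\<lambda>i. (T ^^ n i) (\<omega> i))"
proof -
  define valid where "valid e \<longleftrightarrow> (\<forall>p q :: nat. p > 0 \<and> q > 0 \<longrightarrow>
    measure uniform_seq (enumerated_open cond_code cylinder_seq no_oracle e [p, q]) \<le> real p / real q)" for e
  \<comment> \<open>Programs that violate the measure bounds get the empty test, so that every
    program has a test. Validity need not be decided, as each \<open>D0 e\<close> is a test on its
    own.\<close>
  define D0 where "D0 e = (if valid e then flat_test e else (\<lambda>k u. False))" for e
  have oracle_0: "first_oracle 0 \<omega> = no_oracle" by (simp add: first_oracle_def no_oracle_def)
  have empty: "upward (\<lambda>u. False)" "open_of (\<lambda>u. False) = {}"
    by (simp_all add: upward_def open_of_def)
  have "ml_test no_oracle (D0 e)" for e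
    using ml_test_flat_test[of e] by (auto simp: D0_def valid_def ml_test_def empty computable_const)
  then have init: "good_state (first_oracle 0 \<omega>) (\<lambda>u. False, D0)"
    by (simp add: good_state_def oracle_0 empty computable_const)
  have "\<exists>S. \<forall>i. (good_state (first_oracle i \<omega>) (S i) \<and> (i = 0 \<longrightarrow> S i = (\<lambda>u. False, D0))) \<and>
      (\<exists>n. next_state i ((T ^^ n) (\<omega> i)) (S i) (S (Suc i)))"
    by (rule dependent_nat_choice) (use init exists_next_state pass in \<open>blast+\<close>)
  then obtain S n where good: "\<And>i. good_state (first_oracle i \<omega>) (S i)" and S0: "S 0 = (\<lambda>u. False, D0)"
    and nxt: "\<And>i. next_state i ((T ^^ n i) (\<omega> i)) (S i) (S (Suc i))" by metis
  define x where "x i = (T ^^ n i) (\<omega> i)" for i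
  define sh where "sh i = flatten (\<lambda>j. x (i + j))" for i
  have sh: "sh i = join (x i) (sh (Suc i))" for i
    unfolding sh_def by (subst flatten_join) simp
  have "ml_random_seq x"
    unfolding ml_random_seq_def
  proof
    assume "\<exists>N. effectively_null cond_code cylinder_seq uniform_seq no_oracle N \<and> x \<in> N"
    then obtain e where e: "valid e"
      "\<And>p q :: nat. p > 0 \<Longrightarrow> q > 0 \<Longrightarrow> x \<in> enumerated_open cond_code cylinder_seq no_oracle e [p, q]"
      unfolding effectively_null_def valid_def by blast
    \<comment> \<open>A failure of the whole sequence is inherited by every remainder. The claim is
      for all \<open>k\<close> simultaneously, since the induction step passes to another index
      \<open>k'\<close>.\<close>
    have D: "sh i \<in> open_of (snd (S i) e k)" for i k
    proof (induction i arbitrary: k)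
      case 0
      have "flatten x \<in> open_of (flat_test e k)" using e(2)[of 1 "2 ^ k"] flatten_in_flat_test by simp
      then show ?case by (simp add: sh_def S0 D0_def e)
    next
      case (Suc i)
      then show ?case using nxt[of i] sh[of i] unfolding next_state_def x_def by metis
    qed
    \<comment> \<open>At stage \<open>to_nat e\<close> a member of the test of \<open>e\<close> was
      added, so from stage \<open>m\<close> on the remainder lies in the set to be avoided.\<close>
    define m where "m = Suc (to_nat e)"
    have "sh m \<in> open_of (fst (S m))"
      using nxt[of "to_nat e"] D[of m] unfolding next_state_def m_def by (metis from_nat_to_nat subsetD)
    then obtain s where s: "fst (S m) (seg (sh m) s)" by (auto simp: open_of_def)
    \<comment> \<open>Splitting off a coordinate removes the even positions, so the number of bits
      of the remainder that decide membership is halved. At \<open>j = s\<close> none is left, since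
      \<open>s < 2 ^ s\<close>; the cylinder is then the whole space, against the measure bound in
      \<open>good_state\<close>.\<close>
    have "cylinder (seg (sh (m + j)) (s div 2 ^ j)) \<subseteq> open_of (fst (S (m + j)))" for j
    proof (induction j)
      case 0
      show ?case using s by (auto simp: open_of_eq_cylinders)
    next
      case (Suc j)
      show ?case
      proof
        fix y assume y: "y \<in> cylinder (seg (sh (m + Suc j)) (s div 2 ^ Suc j))"
        have "join (x (m + j)) y \<in> cylinder (seg (sh (m + j)) (s div 2 ^ j))"
          unfolding sh[of "m + j"] cylinder_def
        proof (clarsimp simp: join_def)
          fix p assume "p < s div 2 ^ j" "odd p"
          moreover have "p div 2 < k div 2" if "p < k" "odd p" for k using that by presburger
          ultimately have "p div 2 < s div 2 ^ j div 2" by blast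
          then have "p div 2 < s div 2 ^ Suc j" by (metis div_mult2_eq mult.commute power_Suc)
          then show "y (p div 2) = sh (Suc (m + j)) (p div 2)" using y by (simp add: cylinder_def)
        qed
        then show "y \<in> open_of (fst (S (m + Suc j)))"
          using Suc nxt[of "m + j"] unfolding next_state_def x_def by auto
      qed
    qed
    from this[of s] have "open_of (fst (S (m + s))) = UNIV"
      by (auto simp: div_less)
    then show False using good[of "m + s"] uniform.prob_space by (simp add: good_state_def)
  qed
  then show ?thesis unfolding x_def by blast
qed

end

theorem theorem13:
  fixes \<omega> :: "nat \<Rightarrow> bitseq" and T :: "bitseq \<Rightarrow> bitseq"
  assumes "ml_random (\<omega> 0)"
    and "\<And>i. i \<ge> 1 \<Longrightarrow> random_relative (first_oracle i \<omega>) (\<omega> i)"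
    and "computable_map T"
    and "bij T"
    and "ergodic uniform T"
  shows "\<exists>\<omega>' :: nat \<Rightarrow> bitseq.
    (\<forall>i. \<exists>n :: int. \<omega>' i = int_iterate T n (\<omega> i)) \<and> ml_random_seq \<omega>'"
proof -
  obtain M where M: "wf_tm M" "\<forall>\<omega>. writes M \<omega> (T \<omega>)"
    using assms(3) unfolding computable_map_def by blast
  interpret computable_ergodic T "tm_map M"
    by standard (use assms(5) approximates_tm_map[OF M(2)] computable_tm_map[OF M(1)] in auto)
  have "random_relative (first_oracle i \<omega>) (\<omega> i)" for i
  proof (cases "i = 0")
    case True
    then show ?thesis using assms(1) by (simp add: ml_random_def first_oracle_def no_oracle_def)
  qed (use assms(2) in simp)
  then have "passes_tests (first_oracle i \<omega>) (\<omega> i)" for i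
    unfolding passes_tests_def using random_relative_passes by blast
  then obtain n where n: "ml_random_seq (\<lambda>i. (T ^^ n i) (\<omega> i))"
    using exists_random_orbit_sequence by blast
  show ?thesis
  proof (intro exI conjI allI)
    show "(T ^^ n i) (\<omega> i) = int_iterate T (int (n i)) (\<omega> i)" for i
      by (simp add: int_iterate_def)
  qed (rule n)
qed

end
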